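(* Let $n\ge 0$ and $\ell\ge 1$ be integers, and let $\varepsilon\ge 0$, $\Delta\in[0,1]$ satisfy $\frac{(1-\Delta)^2}{4}>\sqrt{2\varepsilon}$. Consider any quantum protocol (in the sense of the context) between Alice and Bob that uses as a resource a functionality allowing the parties to commit to (and later reveal) $n$ qubit states in total, and that implements a string commitment of length $\ell$ from Alice to Bob which is weakly $\varepsilon$-hiding and weakly $\Delta$-binding. Then $$\ell \le 2n-2\log\left(\frac{(1-\Delta)^2}{4}-\sqrt{2\varepsilon}\right)-1 .$$ In particular, if $\Delta=\varepsilon\le 0.01$, then $\ell\le 2n+6$.
   Context: $\log$ is to base $2$. All Hilbert spaces are finite-dimensional; $D(\rho,\tau)=\frac12\|\rho-\tau\|_1$ is the trace distance. **Qubit commitment functionality (resource).** The resource can be used for at most $n$ qubits in total (committed by either party). When a party $P$ commits to a qubit, the qubit is transferred from $P$'s system into the resource memory; later, on input "open" from $P$, the qubit is transferred to the other party. The quantum memory of the resource is the system $C$, with $\log|C|\le n$, where $|C|$ is the dimension of $C$. **Protocols.** Alice holds system $A$ and Bob holds system $B$; the total system is initially in a fixed pure state. A protocol has a fixed finite number of rounds. In each round a party may apply an arbitrary quantum operation to the system in her/his possession, conditioned on the classical information available to her/him, and may then: transfer a part of her/his system to the other party (noiseless quantum channel); have a register measured in a canonical basis with the outcome sent to the other party (noiseless classical channel); or use the resource. Purification convention: by enlarging the parties' systems, all local operations are isometries (conditioned on the available classical information), and each party keeps a copy of every classical value that she/he sends over the classical channel. Thus, conditioned on all the classical communication, the joint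 state of $A$, $B$ and $C$ at the end of the commit phase is pure. **String commitment protocol of length $\ell$ (Alice is the sender).** It consists of a commit phase, in which Alice has an input $x\in\{0,1\}^\ell$, followed by an opening phase in which $x$ is revealed to Bob. Let $\rho^x_{ABC}$ be the joint state of Alice's system, Bob's system and the resource memory at the end of the commit phase when both parties are honest and Alice's input is $x$. Let $\rho_{XABC}=2^{-\ell}\sum_{x\in\{0,1\}^\ell}|x\rangle\langle x|_X\otimes\rho^x_{ABC}$. For a nonempty set $\mathcal X\subseteq\{0,1\}^\ell$, let $\rho^{\mathcal X}_{A'BC}$, with $A'=XX'A$, be the joint state at the end of the commit phase when Alice prepares $\frac{1}{\sqrt{|\mathcal X|}}\sum_{x\in\mathcal X}|x\rangle_X\otimes|x\rangle_{X'}$, honestly executes the (purified) commit phase coherently controlled on the register $X$ as her input, and keeps $X'$. **Weakly $\varepsilon$-hiding:** $\min_{\sigma_B} D\big(\rho_{XB},\,2^{-\ell}\,\mathbb 1_X\otimes\sigma_B\big)\le\varepsilon$, where the minimum is over all density operators $\sigma_B$ on Bob's system. **Weakly $\Delta$-binding:** for all disjoint nonempty sets $\mathcal X_0,\mathcal X_1\subseteq\{0,1\}^\ell$ and all completely positive trace-preserving maps $\mathcal E_{A'}$ acting on Alice's system $A'$, $$D\big((\mathcal E_{A'}\otimes \mathrm{id}_{BC})(\rho^{\mathcal X_0}_{A'BC}),\,\rho^{\mathcal X_1}_{A'BC}\big)\ge 1-\Delta .$$ *)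

theory Defs
  imports Complex_Main "HOL-Library.Nonpos_Ints"
begin

section \<open>Operators on finite-dimensional Hilbert spaces\<close>

text \<open>
  A finite-dimensional Hilbert space is given by the finite set \<open>S\<close> of labels of its canonical
  orthonormal basis; an operator on it is its matrix, vanishing outside \<open>S \<times> S\<close>. The tensor
  product of two spaces has the label set \<open>S \<times> T\<close>.
\<close>

type_synonym 'i opr = "'i \<Rightarrow> 'i \<Rightarrow> complex"

definition oprs :: "'i set \<Rightarrow> 'i opr set" where
  "oprs S = {T. \<forall>i j. T i j \<noteq> 0 \<longrightarrow> i \<in> S \<and> j \<in> S}"

definition opr_mult :: "'i set \<Rightarrow> 'i opr \<Rightarrow> 'i opr \<Rightarrow> 'i opr" where
  "opr_mult S T U = (\<lambda>i j. \<Sum>k\<in>S. T i k * U k j)"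

definition opr_adjoint :: "'i opr \<Rightarrow> 'i opr" where
  "opr_adjoint T = (\<lambda>i j. cnj (T j i))"

definition opr_trace :: "'i set \<Rightarrow> 'i opr \<Rightarrow> complex" where
  "opr_trace S T = (\<Sum>i\<in>S. T i i)"

definition opr_positive :: "'i set \<Rightarrow> 'i opr \<Rightarrow> bool" where
  "opr_positive S T \<longleftrightarrow> (\<forall>v. (\<Sum>i\<in>S. \<Sum>j\<in>S. cnj (v i) * T i j * v j) \<in> \<real>\<^sub>\<ge>\<^sub>0)"

definition density :: "'i set \<Rightarrow> 'i opr \<Rightarrow> bool" where
  "density S \<rho> \<longleftrightarrow> \<rho> \<in> oprs S \<and> opr_positive S \<rho> \<and> opr_trace S \<rho> = 1"

definition opr_sqrt :: "'i set \<Rightarrow> 'i opr \<Rightarrow> 'i opr" where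
  "opr_sqrt S T = (THE R. R \<in> oprs S \<and> opr_positive S R \<and>
     (\<forall>i\<in>S. \<forall>j\<in>S. opr_mult S R R i j = T i j))"

definition trace_norm :: "'i set \<Rightarrow> 'i opr \<Rightarrow> real" where
  "trace_norm S T = Re (opr_trace S (opr_sqrt S (opr_mult S (opr_adjoint T) T)))"

definition trace_dist :: "'i set \<Rightarrow> 'i opr \<Rightarrow> 'i opr \<Rightarrow> real" where
  "trace_dist S \<rho> \<tau> = trace_norm S (\<lambda>i j. \<rho> i j - \<tau> i j) / 2"

definition tensor_id :: "('i opr \<Rightarrow> 'i opr) \<Rightarrow> ('i \<times> 'r) opr \<Rightarrow> ('i \<times> 'r) opr" where
  "tensor_id E \<rho> = (\<lambda>(i, r) (j, s). E (\<lambda>k l. \<rho> (k, r) (l, s)) i j)"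

text \<open>Complete positivity quantifies over all finite ancilla dimensions \<open>d\<close>.\<close>

definition cptp :: "'i set \<Rightarrow> ('i opr \<Rightarrow> 'i opr) \<Rightarrow> bool" where
  "cptp S E \<longleftrightarrow>
     (\<forall>\<rho>\<in>oprs S. E \<rho> \<in> oprs S) \<and>
     (\<forall>\<rho>\<in>oprs S. \<forall>\<tau>\<in>oprs S. E (\<lambda>i j. \<rho> i j + \<tau> i j) = (\<lambda>i j. E \<rho> i j + E \<tau> i j)) \<and>
     (\<forall>\<rho>\<in>oprs S. \<forall>z. E (\<lambda>i j. z * \<rho> i j) = (\<lambda>i j. z * E \<rho> i j)) \<and>
     (\<forall>d::nat. \<forall>\<rho>\<in>oprs (S \<times> {..<d}). opr_positive (S \<times> {..<d}) \<rho> \<longrightarrow>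
        opr_positive (S \<times> {..<d}) (tensor_id E \<rho>)) \<and>
     (\<forall>\<rho>\<in>oprs S. opr_trace S (E \<rho>) = opr_trace S \<rho>)"


section \<open>Two-party protocols with the qubit commitment resource\<close>

datatype party = Alice | Bob

fun other :: "party \<Rightarrow> party" where
  "other Alice = Bob"
| "other Bob = Alice"

text \<open>
  A basis label of a party's system is the list of the values of her/his registers. A label of the
  resource memory is the list of the values of its \<open>n\<close> qubits. The transcript is the list of
  all values sent over the classical channel.
\<close>

type_synonym reg = "nat list"
type_synonym mem = "nat list"
type_synonym transcript = "nat list"

text \<open>
  A protocol is a tree; its nodes are reached by the possible transcripts, so everything a node
  prescribes is conditioned on the classical communication.

  \<^item> \<open>AliceOp S T V\<close>: on input \<open>x\<close> Alice applies the isometry \<open>V x\<close> from the space of \<open>S\<close> to the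
    space of \<open>T\<close> (the matrix entry \<open>V x a' a\<close> is the amplitude from \<open>a\<close> to \<open>a'\<close>). \<open>BobOp\<close> has no
    such input.
  \<^item> \<open>Send p\<close>: party \<open>p\<close> sends her/his first register over the quantum channel.
  \<^item> \<open>Announce p P\<close>: the first register of \<open>p\<close> is measured in the canonical basis, the outcome
    \<open>m\<close> is sent over the classical channel and the protocol continues with \<open>P m\<close>.
  \<^item> \<open>Commit p i\<close>: \<open>p\<close> commits to her/his first register, a qubit, which moves to memory slot \<open>i\<close>.
  \<^item> \<open>Open p i\<close>: \<open>p\<close> opens slot \<open>i\<close>, whose qubit is transferred to the other party.

  As the local isometries are arbitrary, moving the first register covers moving any part.
\<close>

datatype protocol =
    Done
  | AliceOp "reg set" "reg set" "bool list \<Rightarrow> reg \<Rightarrow> reg \<Rightarrow> complex" protocol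
  | BobOp "reg set" "reg set" "reg \<Rightarrow> reg \<Rightarrow> complex" protocol
  | Send party protocol
  | Announce party "nat \<Rightarrow> protocol"
  | Commit party nat protocol
  | Open party nat protocol

definition bits :: "nat \<Rightarrow> bool list set" where
  "bits l = {x. length x = l}"

definition mem_labels :: "nat \<Rightarrow> mem set" where
  "mem_labels n = {c. length c = n \<and> set c \<subseteq> {0, 1}}"

subsection \<open>Well-formedness and label sets\<close>

definition isometry :: "reg set \<Rightarrow> reg set \<Rightarrow> (reg \<Rightarrow> reg \<Rightarrow> complex) \<Rightarrow> bool" where
  "isometry S T V \<longleftrightarrow>
     (\<forall>a\<in>S. \<forall>a'\<in>S. (\<Sum>b\<in>T. cnj (V b a) * V b a') = of_bool (a = a'))"

definition cons_labels :: "nat set \<Rightarrow> reg set \<Rightarrow> reg set" where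
  "cons_labels M S = {m # a |m a. m \<in> M \<and> a \<in> S}"

definition send_labels :: "party \<Rightarrow> (party \<Rightarrow> reg set) \<Rightarrow> party \<Rightarrow> reg set" where
  "send_labels p S = S(p := tl ` S p, other p := cons_labels (hd ` S p) (S (other p)))"

definition announce_labels :: "party \<Rightarrow> nat \<Rightarrow> (party \<Rightarrow> reg set) \<Rightarrow> party \<Rightarrow> reg set" where
  "announce_labels p m S = S(p := {a. m # a \<in> S p})"

definition commit_labels :: "party \<Rightarrow> (party \<Rightarrow> reg set) \<Rightarrow> party \<Rightarrow> reg set" where
  "commit_labels p S = S(p := tl ` S p)"

definition open_labels :: "party \<Rightarrow> (party \<Rightarrow> reg set) \<Rightarrow> party \<Rightarrow> reg set" where
  "open_labels p S = S(other p := cons_labels {0, 1} (S (other p)))"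

datatype slot = Fresh | Held party | Opened

text \<open>
  Each of the \<open>n\<close> slots is used at most once, so at most \<open>n\<close> qubits are committed in total, by
  both parties together. \<open>S p\<close> is the current label set of party \<open>p\<close>.
\<close>

primrec valid ::
  "nat \<Rightarrow> nat \<Rightarrow> protocol \<Rightarrow> (party \<Rightarrow> reg set) \<Rightarrow> (nat \<Rightarrow> slot) \<Rightarrow> bool" where
  "valid n l Done S st \<longleftrightarrow> True"
| "valid n l (AliceOp S1 T V P) S st \<longleftrightarrow>
     S1 = S Alice \<and> finite T \<and> (\<forall>x\<in>bits l. isometry S1 T (V x)) \<and>
     valid n l P (S(Alice := T)) st"
| "valid n l (BobOp S1 T V P) S st \<longleftrightarrow>
     S1 = S Bob \<and> finite T \<and> isometry S1 T V \<and> valid n l P (S(Bob := T)) st"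
| "valid n l (Send p P) S st \<longleftrightarrow> [] \<notin> S p \<and> valid n l P (send_labels p S) st"
| "valid n l (Announce p P) S st \<longleftrightarrow>
     [] \<notin> S p \<and> (\<forall>m\<in>hd ` S p. valid n l (P m) (announce_labels p m S) st)"
| "valid n l (Commit p i P) S st \<longleftrightarrow>
     i < n \<and> st i = Fresh \<and> [] \<notin> S p \<and> hd ` S p \<subseteq> {0, 1} \<and>
     valid n l P (commit_labels p S) (st(i := Held p))"
| "valid n l (Open p i P) S st \<longleftrightarrow>
     st i = Held p \<and> valid n l P (open_labels p S) (st(i := Opened))"

text \<open>
  At the end of a protocol each party holds a copy of the transcript next to the registers, so
  the label set of her/his final system consists of pairs of a transcript and a register label.
\<close>

primrec final_labels ::
  "protocol \<Rightarrow> (party \<Rightarrow> reg set) \<Rightarrow> party \<Rightarrow> (transcript \<times> reg) set" where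
  "final_labels Done S q = {[]} \<times> S q"
| "final_labels (AliceOp S1 T V P) S q = final_labels P (S(Alice := T)) q"
| "final_labels (BobOp S1 T V P) S q = final_labels P (S(Bob := T)) q"
| "final_labels (Send p P) S q = final_labels P (send_labels p S) q"
| "final_labels (Announce p P) S q =
     (\<Union>m\<in>hd ` S p. (\<lambda>(t, a). (m # t, a)) ` final_labels (P m) (announce_labels p m S) q)"
| "final_labels (Commit p i P) S q = final_labels P (commit_labels p S) q"
| "final_labels (Open p i P) S q = final_labels P (open_labels p S) q"

subsection \<open>Execution\<close>

text \<open>
  A (subnormalised) pure state of \<open>R \<otimes> A \<otimes> B \<otimes> C\<close>, where \<open>R\<close> is an additional register of Alice
  on which her operations are controlled. Slots of the memory that hold no qubit are in state
  \<open>|0\<rangle>\<close>.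
\<close>

type_synonym 'r wave = "'r \<Rightarrow> (party \<Rightarrow> reg) \<Rightarrow> mem \<Rightarrow> complex"

definition apply_local ::
  "party \<Rightarrow> reg set \<Rightarrow> reg set \<Rightarrow> ('r \<Rightarrow> reg \<Rightarrow> reg \<Rightarrow> complex) \<Rightarrow> 'r wave \<Rightarrow> 'r wave" where
  "apply_local p S T V \<psi> = (\<lambda>r s c.
     if s p \<in> T then \<Sum>a\<in>S. V r (s p) a * \<psi> r (s(p := a)) c else 0)"

definition apply_send :: "party \<Rightarrow> 'r wave \<Rightarrow> 'r wave" where
  "apply_send p \<psi> = (\<lambda>r s c. case s (other p) of
     [] \<Rightarrow> 0 | m # b \<Rightarrow> \<psi> r (s(p := m # s p, other p := b)) c)"

definition apply_announce :: "party \<Rightarrow> nat \<Rightarrow> 'r wave \<Rightarrow> 'r wave" where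
  "apply_announce p m \<psi> = (\<lambda>r s c. \<psi> r (s(p := m # s p)) c)"

definition apply_commit :: "party \<Rightarrow> nat \<Rightarrow> 'r wave \<Rightarrow> 'r wave" where
  "apply_commit p i \<psi> = (\<lambda>r s c. \<psi> r (s(p := c ! i # s p)) (c[i := 0]))"

definition apply_open :: "party \<Rightarrow> nat \<Rightarrow> 'r wave \<Rightarrow> 'r wave" where
  "apply_open p i \<psi> = (\<lambda>r s c. case s (other p) of
     [] \<Rightarrow> 0 | m # b \<Rightarrow> if c ! i = 0 then \<psi> r (s(other p := b)) (c[i := m]) else 0)"

text \<open>
  \<open>run inp P t \<psi>\<close> is the unnormalised final state conditioned on the transcript \<open>t\<close>; its squared
  norm is the probability of \<open>t\<close>. Alice's operations are coherently controlled: on the basis state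
  \<open>|r\<rangle>\<close> of \<open>R\<close> she acts as on input \<open>inp r\<close>.
\<close>

primrec run ::
  "('r \<Rightarrow> bool list) \<Rightarrow> protocol \<Rightarrow> transcript \<Rightarrow> 'r wave \<Rightarrow> 'r wave" where
  "run inp Done t \<psi> = (if t = [] then \<psi> else (\<lambda>_ _ _. 0))"
| "run inp (AliceOp S T V P) t \<psi> = run inp P t (apply_local Alice S T (\<lambda>r. V (inp r)) \<psi>)"
| "run inp (BobOp S T V P) t \<psi> = run inp P t (apply_local Bob S T (\<lambda>_. V) \<psi>)"
| "run inp (Send p P) t \<psi> = run inp P t (apply_send p \<psi>)"
| "run inp (Announce p P) t \<psi> = (case t of
     [] \<Rightarrow> (\<lambda>_ _ _. 0) | m # u \<Rightarrow> run inp (P m) u (apply_announce p m \<psi>))"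
| "run inp (Commit p i P) t \<psi> = run inp P t (apply_commit p i \<psi>)"
| "run inp (Open p i P) t \<psi> = run inp P t (apply_open p i \<psi>)"

type_synonym 'r joint_label = "('r \<times> transcript \<times> reg) \<times> (transcript \<times> reg) \<times> mem"

text \<open>
  The state \<open>\<Sum>t. |t\<rangle>\<langle>t| \<otimes> |t\<rangle>\<langle>t| \<otimes> |\<Psi> t\<rangle>\<langle>\<Psi> t|\<close>, where Alice and Bob each hold one copy
  of the transcript \<open>t\<close>.
\<close>

definition joint_opr :: "(transcript \<Rightarrow> 'r wave) \<Rightarrow> 'r joint_label opr" where
  "joint_opr \<Psi> = (\<lambda>((r, t, a), (u, b), c) ((r', t', a'), (u', b'), c').
     if u = t \<and> t' = t \<and> u' = t
     then \<Psi> t r (case_party a b) c * cnj (\<Psi> t r' (case_party a' b') c')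
     else 0)"


section \<open>String commitment\<close>

text \<open>The opening phase may depend on the whole transcript of the commit phase.\<close>

record commitment =
  init_labels :: "party \<Rightarrow> reg set"
  init_state :: "reg \<Rightarrow> reg \<Rightarrow> complex"
  commit_phase :: protocol
  opening_phase :: "transcript \<Rightarrow> protocol"

primrec graft :: "protocol \<Rightarrow> (transcript \<Rightarrow> protocol) \<Rightarrow> protocol" where
  "graft Done f = f []"
| "graft (AliceOp S T V P) f = AliceOp S T V (graft P f)"
| "graft (BobOp S T V P) f = BobOp S T V (graft P f)"
| "graft (Send p P) f = Send p (graft P f)"
| "graft (Announce p P) f = Announce p (\<lambda>m. graft (P m) (\<lambda>t. f (m # t)))"
| "graft (Commit p i P) f = Commit p i (graft P f)"
| "graft (Open p i P) f = Open p i (graft P f)"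

definition full_protocol :: "commitment \<Rightarrow> protocol" where
  "full_protocol \<Pi> = graft (commit_phase \<Pi>) (opening_phase \<Pi>)"

definition init_wave :: "nat \<Rightarrow> commitment \<Rightarrow> ('r \<Rightarrow> complex) \<Rightarrow> 'r wave" where
  "init_wave n \<Pi> \<phi> = (\<lambda>r s c.
     \<phi> r * init_state \<Pi> (s Alice) (s Bob) * of_bool (c = replicate n 0))"

text \<open>
  The last condition says that the opening phase reveals \<open>x\<close>: the final content of Bob's system
  determines the input of honest Alice.
\<close>

definition string_commitment :: "nat \<Rightarrow> nat \<Rightarrow> commitment \<Rightarrow> bool" where
  "string_commitment n l \<Pi> \<longleftrightarrow>
     (\<forall>p. finite (init_labels \<Pi> p)) \<and>
     (\<forall>a b. init_state \<Pi> a b \<noteq> 0 \<longrightarrow> a \<in> init_labels \<Pi> Alice \<and> b \<in> init_labels \<Pi> Bob) \<and>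
     (\<Sum>a\<in>init_labels \<Pi> Alice. \<Sum>b\<in>init_labels \<Pi> Bob. (cmod (init_state \<Pi> a b))\<^sup>2) = 1 \<and>
     valid n l (full_protocol \<Pi>) (init_labels \<Pi>) (\<lambda>_. Fresh) \<and>
     (\<exists>out. \<forall>x\<in>bits l. \<forall>t s c.
        run (\<lambda>_. x) (full_protocol \<Pi>) t (init_wave n \<Pi> (\<lambda>_::unit. 1)) () s c \<noteq> 0 \<longrightarrow>
        out t (s Bob) = x)"

definition party_labels :: "commitment \<Rightarrow> party \<Rightarrow> (transcript \<times> reg) set" where
  "party_labels \<Pi> = final_labels (commit_phase \<Pi>) (init_labels \<Pi>)"

text \<open>The state \<open>\<rho>\<^sup>x\<close> on \<open>ABC\<close> after the commit phase (the register \<open>R\<close> is trivial).\<close>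

definition rho_input :: "nat \<Rightarrow> commitment \<Rightarrow> bool list \<Rightarrow> unit joint_label opr" where
  "rho_input n \<Pi> x =
     joint_opr (\<lambda>t. run (\<lambda>_. x) (commit_phase \<Pi>) t (init_wave n \<Pi> (\<lambda>_. 1)))"

definition rho_XABC :: "nat \<Rightarrow> nat \<Rightarrow> commitment \<Rightarrow> (bool list \<times> unit joint_label) opr" where
  "rho_XABC n l \<Pi> = (\<lambda>(x, i) (y, j). of_bool (x = y) * rho_input n \<Pi> x i j / 2 ^ l)"

definition rho_XB ::
  "nat \<Rightarrow> nat \<Rightarrow> commitment \<Rightarrow> (bool list \<times> transcript \<times> reg) opr" where
  "rho_XB n l \<Pi> = (\<lambda>(x, b) (y, b').
     \<Sum>a\<in>party_labels \<Pi> Alice. \<Sum>c\<in>mem_labels n.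
       rho_XABC n l \<Pi> (x, ((), a), b, c) (y, ((), a), b', c))"

text \<open>
  The state \<open>\<rho>\<^bsup>\<X>\<^esup>\<close> on \<open>A'BC\<close> with \<open>A' = XX'A\<close>. Here \<open>R = XX'\<close> and the control is on \<open>X\<close>.
\<close>

definition rho_superposed ::
  "nat \<Rightarrow> commitment \<Rightarrow> bool list set \<Rightarrow> (bool list \<times> bool list) joint_label opr" where
  "rho_superposed n \<Pi> \<X> =
     joint_opr (\<lambda>t. run fst (commit_phase \<Pi>) t (init_wave n \<Pi>
       (\<lambda>(x, x'). of_bool (x = x' \<and> x \<in> \<X>) / complex_of_real (sqrt (real (card \<X>))))))"

definition primed_labels ::
  "nat \<Rightarrow> commitment \<Rightarrow> ((bool list \<times> bool list) \<times> transcript \<times> reg) set" where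
  "primed_labels l \<Pi> = (bits l \<times> bits l) \<times> party_labels \<Pi> Alice"

definition weakly_hiding :: "nat \<Rightarrow> nat \<Rightarrow> commitment \<Rightarrow> real \<Rightarrow> bool" where
  "weakly_hiding n l \<Pi> \<epsilon> \<longleftrightarrow>
     (\<exists>\<sigma>. density (party_labels \<Pi> Bob) \<sigma> \<and>
        trace_dist (bits l \<times> party_labels \<Pi> Bob) (rho_XB n l \<Pi>)
          (\<lambda>(x, b) (y, b'). of_bool (x = y) * \<sigma> b b' / 2 ^ l) \<le> \<epsilon>)"

definition weakly_binding :: "nat \<Rightarrow> nat \<Rightarrow> commitment \<Rightarrow> real \<Rightarrow> bool" where
  "weakly_binding n l \<Pi> \<Delta> \<longleftrightarrow>
     (\<forall>\<X>\<^sub>0 \<X>\<^sub>1 E. \<X>\<^sub>0 \<subseteq> bits l \<longrightarrow> \<X>\<^sub>1 \<subseteq> bits l \<longrightarrow> \<X>\<^sub>0 \<noteq> {} \<longrightarrow> \<X>\<^sub>1 \<noteq> {} \<longrightarrow>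
        \<X>\<^sub>0 \<inter> \<X>\<^sub>1 = {} \<longrightarrow> cptp (primed_labels l \<Pi>) E \<longrightarrow>
        trace_dist (primed_labels l \<Pi> \<times> party_labels \<Pi> Bob \<times> mem_labels n)
          (tensor_id E (rho_superposed n \<Pi> \<X>\<^sub>0)) (rho_superposed n \<Pi> \<X>\<^sub>1) \<ge> 1 - \<Delta>)"

end

theory Submission
  imports Defs "HOL-Analysis.Function_Topology" "HOL-Analysis.Topology_Euclidean_Space"
begin

text \<open>
  Split the strings by a nontrivial Walsh character into halves \<open>X\<^sub>0\<close> and \<open>X\<^sub>1\<close>. If Bob and the memory
  together can hardly distinguish the two averaged states, then by Uhlmann's theorem a unitary of
  Alice maps the superposition over \<open>X\<^sub>0\<close> close to the one over \<open>X\<^sub>1\<close>, and binding fails.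

  Some character is good. The Powers--Stormer inequality, applied to the hiding condition, yields
  for each \<open>x\<close> a vector \<open>\<surd>\<sigma> W\<^sub>x\<close> with a contraction \<open>W\<^sub>x\<close> which overlaps with the purified state on
  input \<open>x\<close> by \<open>F\<^sub>x\<close>, where \<open>1 - F\<^sub>x\<close> is at most \<open>\<epsilon>\<close> on average. Replacing the states of both
  halves costs \<open>2 \<surd>(2 \<epsilon>)\<close> in trace distance. The replaced states allow the factor \<open>\<surd>\<sigma>\<close> to be split
  off by the Cauchy--Schwarz inequality, and by Parseval's identity for the characters some
  nontrivial one leaves a trace distance of at most \<open>2\<^sup>n \<surd>(2 / 2\<^sup>l)\<close>.
\<close>

no_syntax \<comment> \<open>frees the symbol \<open>\<Pi>\<close>, which names the commitment\<close>
  "_Pi" :: "pttrn \<Rightarrow> 'a set \<Rightarrow> 'b set \<Rightarrow> ('a \<Rightarrow> 'b) set"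
    (\<open>(\<open>indent=3 notation=\<open>binder \<Pi>\<in>\<close>\<close>\<Pi> _\<in>_./ _)\<close> 10)


section \<open>Matrices over finite index sets\<close>

text \<open>The obstacle is the memory. Hiding constrains Bob's system alone, but the attack has to
  imitate a state of Bob together with the memory, where the inputs may well be distinguishable. The
  price is the dimension \<open>2 ^ n\<close> of the memory, paid as two factors
  \<open>sqrt (2 ^ n)\<close> in a Cauchy-Schwarz estimate: one is the Hilbert-Schmidt norm of
  \<surd>\<sigma> tensored with the identity of the memory, the other bounds what is left after
  \<surd>\<sigma> has been split off. Splitting \<surd>\<sigma> off the original states would leave
  an inverse of \<surd>\<sigma>, of uncontrolled size; the contractions \<open>W x\<close> keep the
  remaining factor bounded. The factor 2 inside the root \<open>sqrt (2 / 2 ^ l)\<close> pays for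
  discarding the trivial character, which splits nothing.

  Powers-Stormer is used at both ends, for the overlap gained from hiding and for the overlap
  reached by the attack, so everything is phrased with overlaps of square roots. The spectral
  theorem and the polar decomposition are obtained by maximising traces over the compact set of
  unitaries.\<close>

definition mats :: "'i set \<Rightarrow> 'k set \<Rightarrow> ('i \<Rightarrow> 'k \<Rightarrow> complex) set" where
  "mats I K = {A. \<forall>i k. A i k \<noteq> 0 \<longrightarrow> i \<in> I \<and> k \<in> K}"

definition mmul :: "'j set \<Rightarrow> ('i \<Rightarrow> 'j \<Rightarrow> complex) \<Rightarrow> ('j \<Rightarrow> 'k \<Rightarrow> complex) \<Rightarrow> 'i \<Rightarrow> 'k \<Rightarrow> complex" where
  "mmul J A B = (\<lambda>i k. \<Sum>j\<in>J. A i j * B j k)"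

definition adj :: "('i \<Rightarrow> 'k \<Rightarrow> complex) \<Rightarrow> 'k \<Rightarrow> 'i \<Rightarrow> complex" where
  "adj A = (\<lambda>k i. cnj (A i k))"

definition idm :: "'i set \<Rightarrow> 'i \<Rightarrow> 'i \<Rightarrow> complex" where
  "idm S = (\<lambda>i j. of_bool (i = j \<and> i \<in> S))"

lemma opr_mult_eq_mmul: "opr_mult = mmul"
  by (intro ext) (simp add: opr_mult_def mmul_def)

lemma oprs_eq_mats: "oprs S = mats S S"
  by (simp add: oprs_def mats_def)

lemma matsD1: "A \<in> mats I K \<Longrightarrow> i \<notin> I \<Longrightarrow> A i k = 0"
  and matsD2: "A \<in> mats I K \<Longrightarrow> k \<notin> K \<Longrightarrow> A i k = 0"
  by (auto simp: mats_def)

lemma matsI: "(\<And>i k. i \<notin> I \<or> k \<notin> K \<Longrightarrow> A i k = 0) \<Longrightarrow> A \<in> mats I K"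
  by (auto simp: mats_def)

lemma mats_eqI:
  assumes "A \<in> mats I K" "B \<in> mats I K" "\<And>i k. i \<in> I \<Longrightarrow> k \<in> K \<Longrightarrow> A i k = B i k"
  shows "A = B"
proof (intro ext)
  fix i k show "A i k = B i k"
    using assms(3)[of i k] matsD1[OF assms(1), of i k] matsD1[OF assms(2), of i k]
      matsD2[OF assms(1), of k i] matsD2[OF assms(2), of k i] by metis
qed

lemma mats_mmul [intro]: "A \<in> mats I J \<Longrightarrow> B \<in> mats J' K \<Longrightarrow> mmul J'' A B \<in> mats I K"
  by (rule matsI, elim disjE) (simp_all add: mmul_def matsD1[of A I J] matsD2[of B J' K])

lemma mats_adj [intro]: "A \<in> mats I K \<Longrightarrow> adj A \<in> mats K I"
  by (auto simp: mats_def adj_def)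

lemma mats_idm [intro]: "idm S \<in> mats S S"
  by (auto simp: mats_def idm_def split: if_splits)

lemma adj_adj [simp]: "adj (adj A) = A"
  by (simp add: adj_def)

lemma adj_idm [simp]: "adj (idm S) = idm S"
  by (intro ext) (auto simp: adj_def idm_def)

lemma adj_mmul: "adj (mmul J A B) = mmul J (adj B) (adj A)"
  by (intro ext) (simp add: adj_def mmul_def mult.commute)

lemma mmul_assoc: "mmul K (mmul J A B) C = mmul J A (mmul K B C)"
  by (intro ext) (simp add: mmul_def sum_distrib_left sum_distrib_right mult.assoc, rule sum.swap)

lemma mmul_idm_left: "finite I \<Longrightarrow> A \<in> mats I K \<Longrightarrow> mmul I (idm I) A = A"
proof (intro ext)
  fix i k assume A: "finite I" "A \<in> mats I K"
  show "mmul I (idm I) A i k = A i k"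
    by (cases "i \<in> I") (use A matsD1[OF A(2)] in \<open>auto simp: mmul_def idm_def of_bool_def if_distrib[of "\<lambda>x. x * _"] cong: if_cong\<close>)
qed

lemma mmul_idm_right:
  assumes "finite K" "A \<in> mats I K" shows "mmul K A (idm K) = A"
proof -
  have "adj (mmul K A (idm K)) = adj A"
    unfolding adj_mmul adj_idm using assms by (intro mmul_idm_left) auto
  then show ?thesis by (metis adj_adj)
qed

lemma mmul_idm_square: "finite S \<Longrightarrow> A \<in> mats S S \<Longrightarrow> mmul S (idm S) A = A \<and> mmul S A (idm S) = A"
  by (simp add: mmul_idm_left mmul_idm_right)

lemma mmul_add_left: "mmul J (\<lambda>i j. A i j + B i j) C = (\<lambda>i k. mmul J A C i k + mmul J B C i k)"
  and mmul_add_right: "mmul J C (\<lambda>i j. A' i j + B' i j) = (\<lambda>i k. mmul J C A' i k + mmul J C B' i k)"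
  and mmul_diff_left: "mmul J (\<lambda>i j. A i j - B i j) C = (\<lambda>i k. mmul J A C i k - mmul J B C i k)"
  and mmul_diff_right: "mmul J C (\<lambda>i j. A' i j - B' i j) = (\<lambda>i k. mmul J C A' i k - mmul J C B' i k)"
  and mmul_scale_left: "mmul J (\<lambda>i j. z * A i j) C = (\<lambda>i k. z * mmul J A C i k)"
  and mmul_scale_right: "mmul J C (\<lambda>i j. z * A' i j) = (\<lambda>i k. z * mmul J C A' i k)"
  by (intro ext; simp add: mmul_def algebra_simps sum.distrib sum_subtractf sum_distrib_left)+

lemma trace_cyclic: "opr_trace I (mmul K A B) = opr_trace K (mmul I B A)"
  unfolding opr_trace_def mmul_def by (subst sum.swap) (simp add: mult.commute)

lemma opr_trace_add: "opr_trace S (\<lambda>i j. A i j + B i j) = opr_trace S A + opr_trace S B"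
  and opr_trace_diff: "opr_trace S (\<lambda>i j. A i j - B i j) = opr_trace S A - opr_trace S B"
  and opr_trace_scale: "opr_trace S (\<lambda>i j. z * A i j) = z * opr_trace S A"
  unfolding opr_trace_def by (rule sum.distrib, rule sum_subtractf, rule sum_distrib_left[symmetric])

section \<open>Quadratic forms, positivity and hermiticity\<close>

definition sesq :: "'i set \<Rightarrow> ('i \<Rightarrow> 'i \<Rightarrow> complex) \<Rightarrow> ('i \<Rightarrow> complex) \<Rightarrow> complex" where
  "sesq S T v = (\<Sum>i\<in>S. \<Sum>j\<in>S. cnj (v i) * T i j * v j)"

lemma opr_positive_sesq: "opr_positive S T \<longleftrightarrow> (\<forall>v. sesq S T v \<in> \<real>\<^sub>\<ge>\<^sub>0)"
  by (simp add: opr_positive_def sesq_def)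

lemma sesq_scale: "sesq S T (\<lambda>i. z * v i) = (cmod z)\<^sup>2 * sesq S T v"
  unfolding complex_norm_square by (simp add: sesq_def sum_distrib_left mult_ac)

lemma sesq_add: "sesq S (\<lambda>i j. A i j + B i j) v = sesq S A v + sesq S B v"
  and sesq_diff: "sesq S (\<lambda>i j. A i j - B i j) v = sesq S A v - sesq S B v"
  by (simp_all add: sesq_def algebra_simps sum.distrib sum_subtractf)

lemma sesq_scale_left: "sesq S (\<lambda>i j. z * A i j) v = z * sesq S A v"
  by (simp add: sesq_def sum_distrib_left mult_ac)

text \<open>The inner sums are the conjugated entries of \<open>adj A\<close> applied to
  \<open>v\<close>, so the form is the squared norm of that vector. Positivity of
  \<open>spec\<close> and of \<open>mmul K M (adj M)\<close> is proved through it.\<close>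

lemma sesq_mmul_adj:
  "sesq S (mmul K A (adj A)) v = (\<Sum>k\<in>K. (cmod (\<Sum>i\<in>S. cnj (v i) * A i k))\<^sup>2)"
proof -
  have "sesq S (mmul K A (adj A)) v
      = (\<Sum>i\<in>S. \<Sum>j\<in>S. \<Sum>k\<in>K. (cnj (v i) * A i k) * cnj (cnj (v j) * A j k))"
    by (simp add: sesq_def mmul_def adj_def sum_distrib_left sum_distrib_right mult_ac)
  also have "\<dots> = (\<Sum>k\<in>K. \<Sum>i\<in>S. \<Sum>j\<in>S. (cnj (v i) * A i k) * cnj (cnj (v j) * A j k))"
    by (subst sum.swap[of _ K], subst sum.swap[of _ K]) simp
  also have "\<dots> = (\<Sum>k\<in>K. (\<Sum>i\<in>S. cnj (v i) * A i k) * cnj (\<Sum>j\<in>S. cnj (v j) * A j k))"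
    by (simp add: sum_product)
  finally show ?thesis
    by (simp only: complex_norm_square[symmetric] of_real_sum)
qed

lemma sesq_zero_on: "(\<And>i. i \<in> S \<Longrightarrow> v i = 0) \<Longrightarrow> sesq S T v = 0"
  by (simp add: sesq_def)

text \<open>Polarisation with the vectors e_p + z e_q for z = 0, 1, -1, \<i>, -\<i>. Reality of the
  form is assumed instead of positivity because \<open>spectral\<close> applies this to a product of
  two Hermitian matrices.\<close>

lemma hermitian_if_sesq_real:
  assumes S: "finite S" and T: "\<And>v. Im (sesq S T v) = 0" and p: "p \<in> S" and q: "q \<in> S"
  shows "T q p = cnj (T p q)"
proof -
  define e where "e z = (\<lambda>i. of_bool (i = p) + z * of_bool (i = q))" for z :: complex
  have *: "(\<Sum>j\<in>S. f j * e z j) = f p + z * f q" for f z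
    using S p q by (simp add: e_def algebra_simps sum.distrib of_bool_def sum_distrib_left[symmetric] if_distrib[of "\<lambda>x. _ * x"] sum.delta cong: if_cong)
  have **: "(\<Sum>j\<in>S. cnj (e z j) * f j) = f p + cnj z * f q" for f z
    using arg_cong[OF *[of "\<lambda>j. cnj (f j)" z], of cnj] by (simp add: mult.commute)
  have e: "sesq S T (e z) = T p p + z * T p q + cnj z * T q p + z * cnj z * T q q" for z
  proof -
    have "sesq S T (e z) = (\<Sum>i\<in>S. cnj (e z i) * (\<Sum>j\<in>S. T i j * e z j))"
      by (simp add: sesq_def sum_distrib_left mult.assoc)
    also have "\<dots> = (\<Sum>i\<in>S. cnj (e z i) * (T i p + z * T i q))"
      by (simp only: *)
    also have "\<dots> = (T p p + z * T p q) + cnj z * (T q p + z * T q q)"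
      by (rule **)
    finally show ?thesis by (simp add: algebra_simps)
  qed
  have f: "Im (T p p) = 0" using T[of "e 0"] e[of 0] by simp
  show ?thesis
    using T[of "e 1"] T[of "e (-1)"] T[of "e \<i>"] T[of "e (-\<i>)"] f
    unfolding e by (simp add: complex_eq_iff)
qed

lemma opr_positive_hermitian:
  assumes "finite S" "opr_positive S T" "T \<in> mats S S" shows "adj T = T"
proof (rule mats_eqI)
  have "Im (sesq S T v) = 0" for v
    using assms(2) by (auto simp: opr_positive_sesq complex_nonneg_Reals_iff)
  then show "adj T i j = T i j" if "i \<in> S" "j \<in> S" for i j
    using hermitian_if_sesq_real[OF assms(1), of T i j] that by (simp add: adj_def)
qed (use assms in auto)


section \<open>Unitary matrices\<close>

definition unitary :: "'i set \<Rightarrow> ('i \<Rightarrow> 'i \<Rightarrow> complex) \<Rightarrow> bool" where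
  "unitary S U \<longleftrightarrow> U \<in> mats S S \<and> mmul S (adj U) U = idm S \<and> mmul S U (adj U) = idm S"

lemma unitary_mats: "unitary S U \<Longrightarrow> U \<in> mats S S"
  by (simp add: unitary_def)

lemma unitary_idm: "finite S \<Longrightarrow> unitary S (idm S)"
  unfolding unitary_def by (auto intro!: mmul_idm_left)

lemma unitary_adj: "unitary S U \<Longrightarrow> unitary S (adj U)"
  by (auto simp: unitary_def)

lemma unitary_cancel:
  assumes "finite S" "unitary S U" "A \<in> mats S K"
  shows "mmul S (adj U) (mmul S U A) = A" "mmul S U (mmul S (adj U) A) = A"
  using assms by (simp_all add: mmul_assoc[symmetric] unitary_def mmul_idm_left)

lemma unitary_mmul:
  assumes "finite S" "unitary S U" "unitary S V" shows "unitary S (mmul S U V)"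
proof -
  have "mmul S (adj (mmul S U V)) (mmul S U V) = mmul S (adj V) (mmul S (adj U) (mmul S U V))"
    "mmul S (mmul S U V) (adj (mmul S U V)) = mmul S U (mmul S V (mmul S (adj V) (adj U)))"
    by (simp_all add: adj_mmul mmul_assoc)
  then show ?thesis
    using assms unfolding unitary_cancel(1)[OF assms(1,2) unitary_mats[OF assms(3)]]
      unitary_cancel(2)[OF assms(1,3) mats_adj[OF unitary_mats[OF assms(2)]]]
    by (auto simp: unitary_def)
qed

section \<open>Compactness of the unitaries and existence of maximisers\<close>

lemma compact_fun_box:
  fixes K :: "'a \<Rightarrow> 'b::topological_space set"
  assumes "\<And>x. compact (K x)" shows "compact {f. \<forall>x. f x \<in> K x}"
proof -
  have "compactin (product_topology (\<lambda>_. euclidean) UNIV) (PiE UNIV K)"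
    using assms by (simp add: compactin_PiE)
  then show ?thesis
    by (simp add: euclidean_product_topology PiE_def Pi_def extensional_def)
qed

lemma continuous_entry: "continuous_on UNIV (\<lambda>U :: 'i \<Rightarrow> 'k \<Rightarrow> complex. U i k)"
  by (rule continuous_on_product_then_coordinatewise) simp

lemma unitary_entry_le:
  assumes "finite S" "unitary S U" shows "cmod (U i k) \<le> 1"
proof (cases "i \<in> S \<and> k \<in> S")
  case True
  have "mmul S (adj U) U k k = 1"
    using assms True by (simp add: unitary_def idm_def)
  then have "complex_of_real (\<Sum>j\<in>S. (cmod (U j k))\<^sup>2) = 1"
    unfolding of_real_sum complex_norm_square by (simp add: mmul_def adj_def mult.commute)
  then have "(\<Sum>j\<in>S. (cmod (U j k))\<^sup>2) = 1"
    using of_real_eq_1_iff by blast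
  then have "(cmod (U i k))\<^sup>2 \<le> 1"
    using True assms(1) member_le_sum[of i S "\<lambda>j. (cmod (U j k))\<^sup>2"] by auto
  then show ?thesis by (simp add: abs_square_le_1)
next
  case False
  then have "U i k = 0" using assms unfolding unitary_def mats_def by blast
  then show ?thesis by simp
qed

text \<open>A closed subset of a product of unit discs, compact by Tychonoff. With the product
  topology on functions this works for infinite label types too; closedness holds because each
  defining condition involves finitely many entries.\<close>

lemma compact_unitary:
  assumes "finite S" shows "compact {U. unitary S U}"
proof -
  have "compact {U :: 'a \<Rightarrow> 'a \<Rightarrow> complex. \<forall>i. U i \<in> {f. \<forall>k. f k \<in> cball 0 1}}"
    by (intro compact_fun_box compact_cball)
  moreover have "closed {U. unitary S U}"
  proof -
    have *: "{U. unitary S U} =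
      (\<Inter>i. \<Inter>k. {U. (i \<in> S \<and> k \<in> S) \<or> U i k = 0} \<inter> {U. (\<Sum>j\<in>S. cnj (U j i) * U j k) = idm S i k} \<inter>
        {U. (\<Sum>j\<in>S. U i j * cnj (U k j)) = idm S i k})"
      by (auto simp: unitary_def mats_def mmul_def adj_def fun_eq_iff)
    have "closed {U :: 'a \<Rightarrow> 'a \<Rightarrow> complex. (i \<in> S \<and> k \<in> S) \<or> U i k = 0}" for i k
      by (cases "i \<in> S \<and> k \<in> S") (auto intro!: closed_Collect_eq continuous_entry)
    then show ?thesis
      unfolding * by (intro closed_INT ballI closed_Int closed_Collect_eq continuous_intros continuous_entry) auto
  qed
  ultimately have "compact ({U. \<forall>i. U i \<in> {f. \<forall>k. f k \<in> cball 0 1}} \<inter> {U. unitary S U})"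
    by (rule compact_Int_closed)
  also have "{U. \<forall>i. U i \<in> {f. \<forall>k. f k \<in> cball 0 1}} \<inter> {U. unitary S U} = {U. unitary S U}"
    using unitary_entry_le[OF assms] by auto
  finally show ?thesis .
qed

text \<open>Replaces eigenvalue theory: \<open>polar\<close> and \<open>spectral\<close> take a
  maximiser of a suitable trace and read their conclusions off its variations.\<close>

lemma unitary_attains_sup:
  assumes "finite S" "continuous_on UNIV (f :: ('i \<Rightarrow> 'i \<Rightarrow> complex) \<Rightarrow> real)"
  obtains U where "unitary S U" "\<And>V. unitary S V \<Longrightarrow> f V \<le> f U"
  using continuous_attains_sup[OF compact_unitary[OF assms(1)], of f] unitary_idm[OF assms(1)]
    continuous_on_subset[OF assms(2)] by auto

text \<open>The variations \<open>1 + (z - 1) v v\<^sup>*\<close> with \<open>|z| = 1\<close> turn extremality among unitaries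
  into positivity.\<close>

definition rank1_unitary :: "'i set \<Rightarrow> ('i \<Rightarrow> complex) \<Rightarrow> complex \<Rightarrow> 'i \<Rightarrow> 'i \<Rightarrow> complex" where
  "rank1_unitary S v z = (\<lambda>i j. idm S i j + (z - 1) * (v i * cnj (v j)))"

text \<open>With Q the projection onto the unit vector \<open>v\<close>, the product of 1 + (z - 1)
  Q and 1 + (y - 1) Q is 1 + (z y - 1) Q, and the adjoint conjugates \<open>z\<close>. So
  \<open>z * cnj z = 1\<close> gives unitarity.\<close>

lemma unitary_rank1:
  assumes S: "finite S" and v: "\<And>i. i \<notin> S \<Longrightarrow> v i = 0" "(\<Sum>i\<in>S. (cmod (v i))\<^sup>2) = 1"
    and z: "cmod z = 1"
  shows "unitary S (rank1_unitary S v z)"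
proof -
  define Q where "Q = (\<lambda>i j. v i * cnj (v j))"
  have Q: "Q \<in> mats S S" using v(1) by (auto simp: mats_def Q_def)
  have 1: "(\<Sum>i\<in>S. cnj (v i) * v i) = 1"
    using arg_cong[OF v(2), of complex_of_real] unfolding of_real_sum complex_norm_square
    by (simp add: mult.commute)
  have QQ: "mmul S Q Q = Q"
  proof (intro ext)
    fix i j
    have "mmul S Q Q i j = v i * (\<Sum>k\<in>S. cnj (v k) * v k) * cnj (v j)"
      by (simp add: mmul_def Q_def sum_distrib_left sum_distrib_right mult_ac)
    then show "mmul S Q Q i j = Q i j" using 1 by (simp add: Q_def)
  qed
  have R: "rank1_unitary S v z = (\<lambda>i j. idm S i j + (z - 1) * Q i j)" for z
    by (simp add: rank1_unitary_def Q_def)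
  have A: "adj (rank1_unitary S v z) = rank1_unitary S v (cnj z)" for z
    by (intro ext) (auto simp: R adj_def idm_def Q_def)
  have M: "mmul S (rank1_unitary S v z) (rank1_unitary S v y) = rank1_unitary S v (z * y)" for y z
  proof (intro ext)
    fix i j
    have "mmul S (rank1_unitary S v z) (rank1_unitary S v y) i j
      = idm S i j + (y - 1) * Q i j + (z - 1) * Q i j + (z - 1) * ((y - 1) * Q i j)"
      unfolding R mmul_add_left mmul_add_right mmul_scale_left mmul_scale_right
      by (simp add: mmul_idm_square S Q QQ mats_idm)
    also have "\<dots> = rank1_unitary S v (z * y) i j"
      unfolding R by (simp add: algebra_simps)
    finally show "mmul S (rank1_unitary S v z) (rank1_unitary S v y) i j = rank1_unitary S v (z * y) i j" .
  qed
  have "z * cnj z = 1" using z complex_norm_square[of z] by simp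
  then have "mmul S (adj (rank1_unitary S v z)) (rank1_unitary S v z) = rank1_unitary S v 1"
    "mmul S (rank1_unitary S v z) (adj (rank1_unitary S v z)) = rank1_unitary S v 1"
    by (simp_all add: A M mult.commute)
  moreover have "rank1_unitary S v 1 = idm S" by (simp add: R)
  moreover have "rank1_unitary S v z \<in> mats S S"
    using Q by (auto simp: mats_def R idm_def)
  ultimately show ?thesis by (simp add: unitary_def)
qed

text \<open>The choice \<open>z = cnj q / cmod q\<close> rotates \<open>q\<close> onto the positive
  axis, and the hypothesis becomes \<open>cmod q \<le> Re q\<close>.\<close>

lemma nonneg_if_rotations:
  assumes "\<And>z. cmod z = 1 \<Longrightarrow> Re ((z - 1) * q) \<le> 0"
  shows "q \<in> \<real>\<^sub>\<ge>\<^sub>0"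
proof (cases "q = 0")
  case False
  have "cnj q * q = cmod q * cmod q"
    by (metis complex_norm_square mult.commute of_real_mult power2_eq_square)
  then have "(cnj q / cmod q - 1) * q = cmod q - q"
    using False by (simp add: field_simps)
  then have "Re (cmod q - q) \<le> 0"
    using assms[of "cnj q / cmod q"] False by (simp add: norm_divide)
  then have "Re q = cmod q"
    using complex_Re_le_cmod[of q] by simp
  then show ?thesis
    by (metis complex_nonneg_Reals_iff cmod_eq_Re complex_neq_0 cmod_power2 norm_ge_zero add_cancel_left_right power_eq_0_iff)
qed auto

text \<open>Passes from arbitrary vectors to those allowed in \<open>unitary_rank1\<close>. The
  scalar \<open>c\<close> and the vector \<open>w\<close> serve all matrices \<open>T\<close> at
  once.\<close>

lemma unit_vector_scaling:
  assumes S: "finite S" and "\<exists>i\<in>S. v i \<noteq> 0"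
  obtains c :: real and w where "\<And>i. i \<notin> S \<Longrightarrow> w i = 0" "(\<Sum>i\<in>S. (cmod (w i))\<^sup>2) = 1"
    "\<And>T. sesq S T v = c\<^sup>2 * sesq S T w"
proof -
  define c where "c = sqrt (\<Sum>i\<in>S. (cmod (v i))\<^sup>2)"
  have c2: "c\<^sup>2 = (\<Sum>i\<in>S. (cmod (v i))\<^sup>2)" by (simp add: c_def sum_nonneg)
  have c: "c > 0"
  proof -
    obtain i where "i \<in> S" "v i \<noteq> 0" using assms by auto
    then have "(\<Sum>i\<in>S. (cmod (v i))\<^sup>2) > 0"
      using S by (intro sum_pos2[of _ i]) auto
    then show ?thesis by (simp add: c_def)
  qed
  define w where "w i = (if i \<in> S then v i / c else 0)" for i
  have "(\<Sum>i\<in>S. (cmod (w i))\<^sup>2) = (\<Sum>i\<in>S. (cmod (v i))\<^sup>2) / c\<^sup>2"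
    using c by (simp add: w_def norm_divide power_divide sum_divide_distrib)
  then have 1: "(\<Sum>i\<in>S. (cmod (w i))\<^sup>2) = 1"
    using c c2 by (metis divide_self_if less_irrefl power_not_zero)
  have "sesq S T v = sesq S T (\<lambda>i. of_real c * w i)" for T
    using c by (simp add: sesq_def w_def)
  then have "sesq S T v = c\<^sup>2 * sesq S T w" for T
    using c by (simp add: sesq_scale)
  then show ?thesis using 1 by (intro that[of w c]) (auto simp: w_def)
qed

lemma opr_positive_unit:
  assumes S: "finite S" and T: "\<And>v. (\<And>i. i \<notin> S \<Longrightarrow> v i = 0) \<Longrightarrow> (\<Sum>i\<in>S. (cmod (v i))\<^sup>2) = 1 \<Longrightarrow> sesq S T v \<in> \<real>\<^sub>\<ge>\<^sub>0"
  shows "opr_positive S T"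
  unfolding opr_positive_sesq
proof
  fix v show "sesq S T v \<in> \<real>\<^sub>\<ge>\<^sub>0"
  proof (cases "\<forall>i\<in>S. v i = 0")
    case False
    then have ex: "\<exists>i\<in>S. v i \<noteq> 0" by blast
    obtain c :: real and w where w: "\<And>i. i \<notin> S \<Longrightarrow> w i = 0" "(\<Sum>i\<in>S. (cmod (w i))\<^sup>2) = 1"
      "\<And>T. sesq S T v = c\<^sup>2 * sesq S T w"
      by (rule unit_vector_scaling[OF S ex]) (rule that)
    show ?thesis
      unfolding w(3) by (rule nonneg_Reals_mult_I[OF _ T[OF w(1,2)]]) (simp flip: of_real_power)
  qed (simp add: sesq_zero_on)
qed

text \<open>The variation changes the trace by exactly (z - 1) times the quadratic form, with no
  higher-order term, so maximality gives precisely the hypothesis of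
  \<open>nonneg_if_rotations\<close>.\<close>

lemma trace_rank1:
  assumes "finite S" "A \<in> mats S S"
  shows "opr_trace S (mmul S (rank1_unitary S v z) A) = opr_trace S A + (z - 1) * sesq S A v"
proof -
  have "rank1_unitary S v z = (\<lambda>i j. idm S i j + (z - 1) * (v i * cnj (v j)))"
    by (simp add: rank1_unitary_def)
  moreover have "opr_trace S (mmul S (\<lambda>i j. v i * cnj (v j)) A) = sesq S A v"
    unfolding opr_trace_def mmul_def sesq_def by (subst sum.swap) (simp add: mult_ac)
  ultimately show ?thesis
    using assms by (simp add: mmul_add_left mmul_scale_left opr_trace_add opr_trace_scale mmul_idm_left)
qed

text \<open>\<open>U\<close> maximises the real part of the trace; varying it by
  \<open>rank1_unitary\<close> on the left forces \<open>mmul S U Z\<close> to be positive, for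
  singular \<open>Z\<close> as well. The maximality stays in the conclusion because it yields the
  dual formula for the trace norm.\<close>

lemma polar:
  assumes S: "finite S" and Z: "Z \<in> mats S S"
  obtains U where "unitary S U" "opr_positive S (mmul S U Z)"
    "\<And>V. unitary S V \<Longrightarrow> Re (opr_trace S (mmul S V Z)) \<le> Re (opr_trace S (mmul S U Z))"
proof -
  have cont: "continuous_on UNIV (\<lambda>U. Re (opr_trace S (mmul S U Z)))"
    unfolding opr_trace_def mmul_def by (intro continuous_intros continuous_entry)
  obtain U where U: "unitary S U"
    and mx: "\<And>V. unitary S V \<Longrightarrow> Re (opr_trace S (mmul S V Z)) \<le> Re (opr_trace S (mmul S U Z))"
    by (rule unitary_attains_sup[OF S cont]) (rule that)
  have P: "mmul S U Z \<in> mats S S" using unitary_mats[OF U] Z by auto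
  have "opr_positive S (mmul S U Z)"
  proof (rule opr_positive_unit[OF S], rule nonneg_if_rotations)
    fix v z assume v: "\<And>i. i \<notin> S \<Longrightarrow> v i = 0" "(\<Sum>i\<in>S. (cmod (v i))\<^sup>2) = 1" and z: "cmod z = 1"
    have "unitary S (mmul S (rank1_unitary S v z) U)"
      using unitary_mmul[OF S unitary_rank1[OF S v z] U] by simp
    from mx[OF this] show "Re ((z - 1) * sesq S (mmul S U Z) v) \<le> 0"
      by (simp add: mmul_assoc trace_rank1 S P)
  qed
  then show ?thesis using that U mx by blast
qed

section \<open>Spectral decompositions and functions of Hermitian matrices\<close>

definition diagm :: "'i set \<Rightarrow> ('i \<Rightarrow> real) \<Rightarrow> 'i \<Rightarrow> 'i \<Rightarrow> complex" where
  "diagm S d = (\<lambda>i j. of_real (d i) * idm S i j)"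

text \<open>The columns of \<open>E\<close> are the eigenvectors and \<open>d\<close> lists the
  eigenvalues. A function of the matrix is formed by composing it with \<open>d\<close>, so square
  roots, signs and inverses share one calculus.\<close>

definition spec :: "'i set \<Rightarrow> ('i \<Rightarrow> 'i \<Rightarrow> complex) \<Rightarrow> ('i \<Rightarrow> real) \<Rightarrow> 'i \<Rightarrow> 'i \<Rightarrow> complex" where
  "spec S E d = mmul S E (mmul S (diagm S d) (adj E))"

lemma mats_diagm [intro]: "diagm S d \<in> mats S S"
  by (auto simp: diagm_def idm_def mats_def)

lemma adj_diagm: "adj (diagm S d) = diagm S d"
  by (intro ext) (auto simp: diagm_def adj_def idm_def)

lemma diagm_mmul_apply:
  "finite S \<Longrightarrow> A \<in> mats S K \<Longrightarrow> mmul S (diagm S d) A i k = of_real (d i) * A i k"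
  using fun_cong[OF fun_cong[OF mmul_idm_left[of S A K]], of i k]
  by (simp add: mmul_def diagm_def mult.assoc flip: sum_distrib_left)

lemma mmul_diagm_apply:
  assumes "finite S" "A \<in> mats K S" shows "mmul S A (diagm S d) i k = A i k * of_real (d k)"
proof -
  have "mmul S A (diagm S d) = adj (mmul S (diagm S d) (adj A))"
    by (simp add: adj_mmul adj_diagm)
  then show ?thesis
    using diagm_mmul_apply[OF assms(1) mats_adj[OF assms(2)], of d k i] by (simp add: adj_def)
qed

lemma diagm_mmul: "finite S \<Longrightarrow> mmul S (diagm S d) (diagm S d') = diagm S (\<lambda>k. d k * d' k)"
  by (intro ext) (simp add: diagm_mmul_apply[OF _ mats_diagm], simp add: diagm_def)

lemma mats_spec: "unitary S E \<Longrightarrow> spec S E d \<in> mats S S"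
  unfolding spec_def using unitary_mats by blast

lemma adj_spec: "adj (spec S E d) = spec S E d"
  by (simp add: spec_def adj_mmul adj_diagm mmul_assoc)

lemma spec_apply:
  assumes "finite S" "unitary S E"
  shows "spec S E d i j = (\<Sum>k\<in>S. of_real (d k) * E i k * cnj (E j k))"
  unfolding spec_def mmul_def[of S E]
  using diagm_mmul_apply[OF assms(1) mats_adj[OF unitary_mats[OF assms(2)]], of d]
  by (simp add: adj_def mult_ac)

lemma spec_mmul:
  assumes S: "finite S" and E: "unitary S E"
  shows "mmul S (spec S E d) (spec S E d') = spec S E (\<lambda>k. d k * d' k)"
proof -
  have *: "mmul S (diagm S d') (adj E) \<in> mats S S" using unitary_mats[OF E] by blast
  have "mmul S (spec S E d) (spec S E d')
    = mmul S E (mmul S (diagm S d) (mmul S (diagm S d') (adj E)))"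
    by (simp add: spec_def mmul_assoc unitary_cancel(1)[OF S E *])
  then show ?thesis by (simp add: spec_def mmul_assoc[symmetric] diagm_mmul S)
qed

lemma spec_eigen:
  assumes S: "finite S" and E: "unitary S E"
  shows "mmul S (spec S E d) E = mmul S E (diagm S d)"
  using E by (simp add: spec_def mmul_assoc unitary_def mmul_idm_right[OF S mats_diagm])

lemma trace_spec:
  assumes "finite S" "unitary S E"
  shows "opr_trace S (mmul S A (spec S E d)) = (\<Sum>k\<in>S. of_real (d k) * sesq S A (\<lambda>i. E i k))"
proof -
  have "opr_trace S (mmul S A (spec S E d))
    = (\<Sum>i\<in>S. \<Sum>j\<in>S. \<Sum>k\<in>S. of_real (d k) * (cnj (E i k) * A i j * E j k))"
    by (simp add: opr_trace_def mmul_def[of S A] spec_apply[OF assms] sum_distrib_left mult_ac)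
  also have "\<dots> = (\<Sum>k\<in>S. \<Sum>i\<in>S. \<Sum>j\<in>S. of_real (d k) * (cnj (E i k) * A i j * E j k))"
    by (subst sum.swap[of _ S S], subst sum.swap[of _ S S]) simp
  finally show ?thesis by (simp add: sesq_def sum_distrib_left)
qed

lemma unitary_column:
  assumes "unitary S E" "k \<in> S" shows "(\<Sum>i\<in>S. (cmod (E i k))\<^sup>2) = 1"
proof -
  have "mmul S (adj E) E k k = 1" using assms by (simp add: unitary_def idm_def)
  then have "complex_of_real (\<Sum>i\<in>S. (cmod (E i k))\<^sup>2) = 1"
    unfolding of_real_sum complex_norm_square by (simp add: mmul_def adj_def mult.commute)
  then show ?thesis using of_real_eq_1_iff by blast
qed

lemma sesq_spec:
  assumes S: "finite S" and E: "unitary S E" and k: "k \<in> S"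
  shows "sesq S (spec S E d) (\<lambda>i. E i k) = of_real (d k)"
proof -
  have "sesq S (spec S E d) (\<lambda>i. E i k) = mmul S (adj E) (mmul S (spec S E d) E) k k"
    by (simp add: sesq_def mmul_def adj_def sum_distrib_left mult.assoc)
  also have "\<dots> = diagm S d k k"
    unfolding spec_eigen[OF S E] using E by (simp add: unitary_cancel(1)[OF S E mats_diagm])
  finally show ?thesis using k by (simp add: diagm_def idm_def)
qed

lemma opr_positive_spec:
  assumes S: "finite S" and E: "unitary S E"
  shows "opr_positive S (spec S E d) \<longleftrightarrow> (\<forall>k\<in>S. d k \<ge> 0)"
proof
  assume "opr_positive S (spec S E d)"
  then have "sesq S (spec S E d) (\<lambda>i. E i k) \<in> \<real>\<^sub>\<ge>\<^sub>0" for k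
    by (auto simp: opr_positive_sesq)
  then show "\<forall>k\<in>S. d k \<ge> 0" by (metis sesq_spec[OF S E] nonneg_Reals_of_real_iff)
next
  assume d: "\<forall>k\<in>S. d k \<ge> 0"
  have "spec S E d = mmul S (\<lambda>i k. of_real (sqrt (d k)) * E i k) (adj (\<lambda>i k. of_real (sqrt (d k)) * E i k))"
    using d by (intro ext) (auto simp: spec_apply[OF S E] mmul_def adj_def mult_ac simp flip: of_real_mult intro!: sum.cong)
  then show "opr_positive S (spec S E d)"
    unfolding opr_positive_sesq by (simp only: sesq_mmul_adj) (auto intro!: sum_nonneg simp flip: of_real_power of_real_sum)
qed

text \<open>Maximise the trace of D (adj V) H V over unitaries \<open>V\<close>, where
  \<open>D\<close> is diagonal with distinct entries. At a maximiser \<open>U\<close>, put G = (adj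
  U) H U. The rank-one variations show that D G has a real quadratic form and is therefore
  Hermitian; hence D and G commute, and the distinct entries of D make G diagonal.\<close>

lemma spectral:
  assumes S: "finite S" and H: "H \<in> mats S S" and herm: "adj H = H"
  obtains E d where "unitary S E" "H = spec S E d"
proof -
  obtain w :: "'a \<Rightarrow> nat" where w: "inj_on w S"
    using finite_imp_inj_to_nat_seg[OF S] by blast
  define D where "D = diagm S (\<lambda>i. real (w i))"
  have D: "D \<in> mats S S" "adj D = D" by (auto simp: D_def adj_diagm)
  have cont: "continuous_on UNIV (\<lambda>U. Re (opr_trace S (mmul S D (mmul S (adj U) (mmul S H U)))))"
    unfolding opr_trace_def mmul_def adj_def by (intro continuous_intros continuous_entry)
  obtain U where U: "unitary S U"
    and mx: "\<And>V. unitary S V \<Longrightarrow> Re (opr_trace S (mmul S D (mmul S (adj V) (mmul S H V))))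
      \<le> Re (opr_trace S (mmul S D (mmul S (adj U) (mmul S H U))))"
    by (rule unitary_attains_sup[OF S cont]) (rule that)
  define G where "G = mmul S (adj U) (mmul S H U)"
  have G: "G \<in> mats S S" "adj G = G"
    using H unitary_mats[OF U] herm by (auto simp: G_def adj_mmul mmul_assoc)
  have unit: "Im (sesq S (mmul S D G) v) = 0"
    if v: "\<And>i. i \<notin> S \<Longrightarrow> v i = 0" "(\<Sum>i\<in>S. (cmod (v i))\<^sup>2) = 1" for v
  proof -
    define a where "a = sesq S (mmul S D G) v"
    define b where "b = sesq S D v * sesq S G v"
    have cnj_sesq: "cnj (sesq S A v) = sesq S (adj A) v" for A
      unfolding sesq_def by (subst sum.swap) (simp add: adj_def mult_ac)
    have b: "cnj b = b" by (simp add: b_def cnj_sesq D G)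
    have a': "sesq S (mmul S G D) v = cnj a"
      by (simp add: a_def cnj_sesq adj_mmul D G)
    \<comment> \<open>The variation changes the objective by 2 Re ((z - 1) (a - b)): the term with
      (z - 1) (cnj z - 1) becomes linear because \<open>z * cnj z = 1\<close>.\<close>
    have "a - b \<in> \<real>\<^sub>\<ge>\<^sub>0"
    proof (rule nonneg_if_rotations)
      fix z assume z: "cmod z = 1"
      define V where "V = rank1_unitary S v z"
      have V: "unitary S V" unfolding V_def using unitary_rank1[OF S v z] by simp
      have adjV: "adj V = rank1_unitary S v (cnj z)"
        by (intro ext) (auto simp: V_def rank1_unitary_def adj_def idm_def)
      have "mmul S D (mmul S (adj V) G) \<in> mats S S"
        using D G unitary_mats[OF V] by blast
      then have "opr_trace S (mmul S D (mmul S (adj V) (mmul S G V)))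
        = opr_trace S (mmul S D (mmul S (adj V) G)) + (z - 1) * sesq S (mmul S D (mmul S (adj V) G)) v"
        using trace_cyclic[of S S "mmul S D (mmul S (adj V) G)" V]
        by (simp add: mmul_assoc V_def trace_rank1 S)
      also have "opr_trace S (mmul S D (mmul S (adj V) G)) = opr_trace S (mmul S G D) + (cnj z - 1) * cnj a"
        using trace_cyclic[of S S D "mmul S (adj V) G"] D G
        by (simp add: mmul_assoc adjV trace_rank1 S mats_mmul a')
      also have "sesq S (mmul S D (mmul S (adj V) G)) v = a + (cnj z - 1) * b"
      proof -
        have "mmul S (adj V) G = (\<lambda>i j. G i j + (cnj z - 1) * mmul S (\<lambda>i j. v i * cnj (v j)) G i j)"
          using G by (simp add: adjV rank1_unitary_def mmul_add_left mmul_scale_left mmul_idm_left S)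
        moreover have "sesq S (mmul S D (mmul S (\<lambda>i j. v i * cnj (v j)) G)) v = b"
        proof -
          have "sesq S (mmul S D (mmul S (\<lambda>i j. v i * cnj (v j)) G)) v
            = (\<Sum>i\<in>S. \<Sum>j\<in>S. \<Sum>k\<in>S. \<Sum>l\<in>S. (cnj (v i) * D i k * v k) * (cnj (v l) * G l j * v j))"
            by (simp add: sesq_def mmul_def sum_distrib_left sum_distrib_right mult_ac)
          also have "\<dots> = (\<Sum>i\<in>S. \<Sum>k\<in>S. \<Sum>l\<in>S. \<Sum>j\<in>S. (cnj (v i) * D i k * v k) * (cnj (v l) * G l j * v j))"
            by (rule sum.cong[OF refl], rule trans[OF sum.swap], rule sum.cong[OF refl], rule sum.swap)
          also have "\<dots> = b"
            unfolding b_def sesq_def sum_distrib_right by (simp only: sum_distrib_left)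
          finally show ?thesis .
        qed
        ultimately show ?thesis
          by (simp add: a_def mmul_add_right mmul_scale_right sesq_add sesq_scale_left)
      qed
      finally have tr: "opr_trace S (mmul S D (mmul S (adj V) (mmul S G V)))
        = opr_trace S (mmul S G D) + (cnj z - 1) * cnj a + (z - 1) * (a + (cnj z - 1) * b)" .
      have "unitary S (mmul S U V)" by (rule unitary_mmul[OF S U V])
      from mx[OF this] have "Re (opr_trace S (mmul S D (mmul S (adj V) (mmul S G V)))) \<le> Re (opr_trace S (mmul S D G))"
        by (simp add: G_def adj_mmul mmul_assoc)
      then have le: "Re ((cnj z - 1) * cnj a + (z - 1) * (a + (cnj z - 1) * b)) \<le> 0"
        unfolding tr by (simp add: trace_cyclic[of S S D G])
      have zz: "z * cnj z = 1" using z complex_norm_square[of z] by simp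
      define q where "q = (z - 1) * (a - b)"
      have "(cnj z - 1) * cnj a + (z - 1) * (a + (cnj z - 1) * b) = q + cnj q + (z * cnj z - 1) * b"
        by (simp add: q_def b algebra_simps)
      then show "Re ((z - 1) * (a - b)) \<le> 0"
        using le zz by (simp flip: q_def)
    qed
    \<comment> \<open>\<open>b\<close> is a product of two real numbers, so reality of
      \<open>a - b\<close> passes to \<open>a\<close>.\<close>
    moreover have "Im b = 0" using arg_cong[OF b, of Im] by simp
    ultimately show ?thesis by (simp add: a_def complex_nonneg_Reals_iff)
  qed
  have "Im (sesq S (mmul S D G) v) = 0" for v
  proof (cases "\<exists>i\<in>S. v i \<noteq> 0")
    case True
    obtain c :: real and u where u: "\<And>i. i \<notin> S \<Longrightarrow> u i = 0" "(\<Sum>i\<in>S. (cmod (u i))\<^sup>2) = 1"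
      "\<And>T. sesq S T v = c\<^sup>2 * sesq S T u"
      by (rule unit_vector_scaling[OF S True]) (rule that)
    then show ?thesis using unit[OF u(1,2)] by (simp flip: of_real_power)
  qed (simp add: sesq_zero_on)
  note DG = hermitian_if_sesq_real[OF S this]
  define d where "d k = Re (G k k)" for k
  have "G = diagm S d"
  proof (rule mats_eqI[OF G(1) mats_diagm])
    fix p q assume pq: "p \<in> S" "q \<in> S"
    have Gs: "cnj (G p q) = G q p" for p q
      using fun_cong[OF fun_cong[OF G(2)], of q p] by (simp add: adj_def)
    have "of_real (w q) * G q p = of_real (w p) * G q p"
      using DG[OF pq] unfolding D_def diagm_mmul_apply[OF S G(1)] by (simp add: Gs)
    then have *: "w q = w p \<or> G q p = 0" by auto
    show "G p q = diagm S d p q"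
    proof (cases "p = q")
      case True
      have "Im (G p p) = 0" using arg_cong[OF Gs[of p p], of Im] by simp
      then show ?thesis using True pq by (simp add: diagm_def idm_def d_def complex_eq_iff)
    next
      case False
      then have "G q p = 0" using * w pq by (auto dest: inj_onD)
      then show ?thesis using False Gs[of q p] by (simp add: diagm_def idm_def)
    qed
  qed
  moreover have "H = mmul S U (mmul S G (adj U))"
  proof -
    have "mmul S U (mmul S G (adj U)) = mmul S (mmul S U (mmul S (adj U) H)) (mmul S U (adj U))"
      by (simp add: G_def mmul_assoc)
    then show ?thesis
      using U by (simp add: unitary_cancel(2)[OF S U H] unitary_def mmul_idm_right[OF S H])
  qed
  ultimately show ?thesis using that U by (simp add: spec_def)
qed

section \<open>Square roots and the trace norm\<close>

text \<open>The eigenbasis is part of the conclusion because \<open>sqrt_contraction\<close> forms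
  inverse square roots in the same basis.\<close>

lemma psd_sqrt_exists:
  assumes S: "finite S" and P: "P \<in> mats S S" "opr_positive S P"
  obtains E d where "unitary S E" "P = spec S E d" "\<And>k. k \<in> S \<Longrightarrow> d k \<ge> 0"
    "opr_positive S (spec S E (\<lambda>k. sqrt (d k)))"
    "mmul S (spec S E (\<lambda>k. sqrt (d k))) (spec S E (\<lambda>k. sqrt (d k))) = P"
proof -
  obtain E d where E: "unitary S E" and Pd: "P = spec S E d"
    by (rule spectral[OF S P(1) opr_positive_hermitian[OF S P(2,1)]]) (rule that)
  have d: "\<And>k. k \<in> S \<Longrightarrow> d k \<ge> 0"
    using P(2) opr_positive_spec[OF S E] by (auto simp: Pd)
  have "spec S E (\<lambda>k. sqrt (d k) * sqrt (d k)) = P"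
    unfolding Pd using d by (intro ext) (simp add: spec_apply[OF S E])
  then have "mmul S (spec S E (\<lambda>k. sqrt (d k))) (spec S E (\<lambda>k. sqrt (d k))) = P"
    by (simp add: spec_mmul[OF S E])
  moreover have "opr_positive S (spec S E (\<lambda>k. sqrt (d k)))"
    using d by (simp add: opr_positive_spec[OF S E])
  ultimately show ?thesis using that[OF E Pd d] by blast
qed

text \<open>The transition matrix \<open>G\<close> between the eigenbases intertwines the squared
  eigenvalues, so \<open>G i k\<close> vanishes unless \<open>e i * e i = d k * d k\<close>. For
  nonnegative eigenvalues this means \<open>e i = d k\<close>, and \<open>G\<close> intertwines the
  eigenvalues themselves. The definite description in \<open>opr_sqrt\<close> rests on this.\<close>

lemma psd_sqrt_unique:
  assumes S: "finite S" and R: "R \<in> mats S S" "opr_positive S R" and Q: "Q \<in> mats S S" "opr_positive S Q"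
    and eq: "mmul S R R = mmul S Q Q"
  shows "R = Q"
proof -
  obtain E d where E: "unitary S E" and Rd: "R = spec S E d"
    by (rule spectral[OF S R(1) opr_positive_hermitian[OF S R(2,1)]]) (rule that)
  obtain F e where F: "unitary S F" and Qe: "Q = spec S F e"
    by (rule spectral[OF S Q(1) opr_positive_hermitian[OF S Q(2,1)]]) (rule that)
  have d: "d k \<ge> 0" and e: "e k \<ge> 0" if "k \<in> S" for k
    using R(2) Q(2) that by (auto simp: Rd Qe opr_positive_spec[OF S E] opr_positive_spec[OF S F])
  define G where "G = mmul S (adj F) E"
  have G: "G \<in> mats S S" using unitary_mats[OF E] unitary_mats[OF F] by (auto simp: G_def)
  have move: "mmul S (adj F) (mmul S (spec S F e) E) = mmul S (diagm S e) G" for e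
  proof -
    have "mmul S (adj F) (mmul S (spec S F e) E)
      = mmul S (adj F) (mmul S F (mmul S (diagm S e) (mmul S (adj F) E)))"
      by (simp add: spec_def mmul_assoc)
    also have "\<dots> = mmul S (diagm S e) (mmul S (adj F) E)"
      using unitary_mats[OF E] unitary_mats[OF F] by (intro unitary_cancel(1)[OF S F]) blast
    finally show ?thesis by (simp add: G_def)
  qed
  have GG: "mmul S (diagm S (\<lambda>k. e k * e k)) G = mmul S G (diagm S (\<lambda>k. d k * d k))"
    using arg_cong[OF eq, of "\<lambda>A. mmul S (adj F) (mmul S A E)"]
    unfolding Rd Qe spec_mmul[OF S E] spec_mmul[OF S F] move spec_eigen[OF S E]
    by (simp add: G_def mmul_assoc)
  have sq: "complex_of_real (e i * e i) * G i k = G i k * complex_of_real (d k * d k)" for i k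
    using fun_cong[OF fun_cong[OF GG], of i k] unfolding diagm_mmul_apply[OF S G] mmul_diagm_apply[OF S G] .
  have "mmul S (diagm S e) G = mmul S G (diagm S d)"
  proof (rule mats_eqI[of _ S S])
    fix i k assume ik: "i \<in> S" "k \<in> S"
    have "G i k = 0 \<or> e i * e i = d k * d k"
      using sq[of i k] by (metis mult.commute mult_cancel_left of_real_eq_iff)
    then have "G i k = 0 \<or> e i = d k"
      using d[OF ik(2)] e[OF ik(1)] by (metis power2_eq_square power2_eq_iff_nonneg)
    then show "mmul S (diagm S e) G i k = mmul S G (diagm S d) i k"
      unfolding diagm_mmul_apply[OF S G] mmul_diagm_apply[OF S G] by auto
  qed (use G in auto)
  then have "mmul S (adj F) (mmul S Q E) = mmul S (adj F) (mmul S R E)"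
    unfolding Qe Rd move spec_eigen[OF S E] by (simp add: G_def mmul_assoc)
  then have "mmul S Q E = mmul S R E"
    using unitary_cancel(2)[OF S F] Q(1) R(1) unitary_mats[OF E] by (metis mats_mmul)
  then have "mmul S (mmul S Q E) (adj E) = mmul S (mmul S R E) (adj E)" by simp
  then show ?thesis
    using E mmul_idm_square[OF S Q(1)] mmul_idm_square[OF S R(1)] by (simp add: mmul_assoc unitary_def)
qed

lemma opr_sqrt_eqI:
  assumes S: "finite S" and R: "R \<in> mats S S" "opr_positive S R"
    and eq: "\<And>i j. i \<in> S \<Longrightarrow> j \<in> S \<Longrightarrow> mmul S R R i j = T i j"
  shows "opr_sqrt S T = R"
  unfolding opr_sqrt_def opr_mult_eq_mmul oprs_eq_mats
proof (rule the_equality)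
  fix Q assume Q: "Q \<in> mats S S \<and> opr_positive S Q \<and> (\<forall>i\<in>S. \<forall>j\<in>S. mmul S Q Q i j = T i j)"
  then have "mmul S Q Q = mmul S R R"
    using eq R by (intro mats_eqI[of _ S S]) auto
  then show "Q = R" using psd_sqrt_unique[OF S _ _ R] Q by blast
qed (use R eq in auto)

text \<open>\<open>mmul S U T\<close> is the positive square root of
  \<open>mmul S (adj T) T\<close>: being positive it is Hermitian, and \<open>U\<close> cancels in
  its square.\<close>

lemma trace_norm_polar:
  assumes S: "finite S" and T: "T \<in> mats S S" and U: "unitary S U" and P: "opr_positive S (mmul S U T)"
  shows "trace_norm S T = Re (opr_trace S (mmul S U T))"
proof -
  have PM: "mmul S U T \<in> mats S S" using unitary_mats[OF U] T by blast
  have "mmul S (mmul S U T) (mmul S U T) = mmul S (adj (mmul S U T)) (mmul S U T)"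
    by (simp add: opr_positive_hermitian[OF S P PM])
  also have "\<dots> = mmul S (adj T) T"
    by (simp add: adj_mmul mmul_assoc unitary_cancel(1)[OF S U T])
  finally have "opr_sqrt S (mmul S (adj T) T) = mmul S U T"
    by (intro opr_sqrt_eqI[OF S PM P]) simp
  then show ?thesis
    by (simp add: trace_norm_def opr_mult_eq_mmul opr_adjoint_def adj_def)
qed

text \<open>With \<open>trace_norm_upper\<close> this is the duality between the trace norm and the
  unitaries. Upper bounds on trace norms are later proved by testing with an optimal
  \<open>U\<close>.\<close>

lemma trace_norm_attained:
  assumes S: "finite S" and T: "T \<in> mats S S"
  obtains U where "unitary S U" "trace_norm S T = Re (opr_trace S (mmul S U T))"
proof -
  obtain U where U: "unitary S U" "opr_positive S (mmul S U T)"
    "\<And>V. unitary S V \<Longrightarrow> Re (opr_trace S (mmul S V T)) \<le> Re (opr_trace S (mmul S U T))"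
    by (rule polar[OF S T]) (rule that)
  then show ?thesis using that[OF U(1)] trace_norm_polar[OF S T U(1,2)] by blast
qed

lemma trace_norm_upper:
  assumes S: "finite S" and T: "T \<in> mats S S" and V: "unitary S V"
  shows "Re (opr_trace S (mmul S V T)) \<le> trace_norm S T"
proof -
  obtain U where U: "unitary S U" "opr_positive S (mmul S U T)"
    "\<And>V. unitary S V \<Longrightarrow> Re (opr_trace S (mmul S V T)) \<le> Re (opr_trace S (mmul S U T))"
    by (rule polar[OF S T]) (rule that)
  then show ?thesis using trace_norm_polar[OF S T U(1,2)] V by simp
qed


section \<open>The Hilbert--Schmidt norm and contractions\<close>

definition hsn :: "'i set \<Rightarrow> 'k set \<Rightarrow> ('i \<Rightarrow> 'k \<Rightarrow> complex) \<Rightarrow> real" where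
  "hsn I K A = sqrt (\<Sum>i\<in>I. \<Sum>k\<in>K. (cmod (A i k))\<^sup>2)"

lemma hsn_nonneg [simp]: "hsn I K A \<ge> 0"
  by (simp add: hsn_def sum_nonneg)

lemma hsn_sq: "(hsn I K A)\<^sup>2 = (\<Sum>i\<in>I. \<Sum>k\<in>K. (cmod (A i k))\<^sup>2)"
  by (simp add: hsn_def sum_nonneg)

lemma hsn_sq_trace: "complex_of_real ((hsn I K A)\<^sup>2) = opr_trace I (mmul K A (adj A))"
  unfolding hsn_sq of_real_sum complex_norm_square by (simp add: opr_trace_def mmul_def adj_def)

lemma hsn_adj: "hsn K I (adj A) = hsn I K A"
  unfolding hsn_def by (subst sum.swap) (simp add: adj_def)

lemma norm_sum_mult_le:
  fixes f g :: "'a \<Rightarrow> complex"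
  shows "cmod (\<Sum>i\<in>A. f i * g i) \<le> sqrt (\<Sum>i\<in>A. (cmod (f i))\<^sup>2) * sqrt (\<Sum>i\<in>A. (cmod (g i))\<^sup>2)"
proof -
  have "cmod (\<Sum>i\<in>A. f i * g i) \<le> (\<Sum>i\<in>A. \<bar>cmod (f i)\<bar> * \<bar>cmod (g i)\<bar>)"
    by (rule order_trans[OF norm_sum]) (simp add: norm_mult)
  also have "\<dots> \<le> sqrt (\<Sum>i\<in>A. (cmod (f i))\<^sup>2) * sqrt (\<Sum>i\<in>A. (cmod (g i))\<^sup>2)"
    using L2_set_mult_ineq[of "\<lambda>i. cmod (f i)" "\<lambda>i. cmod (g i)" A] by (simp add: L2_set_def)
  finally show ?thesis .
qed

lemma trace_mmul_le_hsn:
  "cmod (opr_trace I (mmul K A B)) \<le> hsn I K A * hsn K I B"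
proof -
  have "cmod (\<Sum>(i, k)\<in>I \<times> K. A i k * B k i)
    \<le> sqrt (\<Sum>(i, k)\<in>I \<times> K. (cmod (A i k))\<^sup>2) * sqrt (\<Sum>(i, k)\<in>I \<times> K. (cmod (B k i))\<^sup>2)"
    using norm_sum_mult_le[of "\<lambda>(i, k). A i k" "\<lambda>(i, k). B k i" "I \<times> K"] by (simp add: case_prod_beta)
  also have "\<dots> = hsn I K A * hsn I K (adj B)"
    by (simp add: hsn_def adj_def sum.cartesian_product)
  finally show ?thesis
    using hsn_adj[of I K B] by (simp add: opr_trace_def mmul_def sum.cartesian_product)
qed

section \<open>Contractions and their traces\<close>

definition contraction :: "'i set \<Rightarrow> 'k set \<Rightarrow> ('i \<Rightarrow> 'k \<Rightarrow> complex) \<Rightarrow> bool" where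
  "contraction I K W \<longleftrightarrow>
     (\<forall>v. (\<Sum>i\<in>I. (cmod (\<Sum>k\<in>K. W i k * v k))\<^sup>2) \<le> (\<Sum>k\<in>K. (cmod (v k))\<^sup>2))"

lemma contraction_mmul:
  assumes "contraction I J A" "contraction J K B" shows "contraction I K (mmul J A B)"
  unfolding contraction_def
proof
  fix v
  have "(\<Sum>i\<in>I. (cmod (\<Sum>k\<in>K. mmul J A B i k * v k))\<^sup>2)
    = (\<Sum>i\<in>I. (cmod (\<Sum>j\<in>J. A i j * (\<Sum>k\<in>K. B j k * v k)))\<^sup>2)"
  proof -
    have "(\<Sum>k\<in>K. mmul J A B i k * v k) = (\<Sum>j\<in>J. A i j * (\<Sum>k\<in>K. B j k * v k))" for i
      unfolding mmul_def sum_distrib_left sum_distrib_right by (subst sum.swap) (simp add: mult.assoc)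
    then show ?thesis by simp
  qed
  also have "\<dots> \<le> (\<Sum>j\<in>J. (cmod (\<Sum>k\<in>K. B j k * v k))\<^sup>2)"
    using assms(1) by (simp add: contraction_def)
  also have "\<dots> \<le> (\<Sum>k\<in>K. (cmod (v k))\<^sup>2)"
    using assms(2) by (simp add: contraction_def)
  finally show "(\<Sum>i\<in>I. (cmod (\<Sum>k\<in>K. mmul J A B i k * v k))\<^sup>2) \<le> (\<Sum>k\<in>K. (cmod (v k))\<^sup>2)" .
qed

text \<open>The contraction acts on each column of \<open>B\<close> separately.\<close>

lemma contraction_hsn: "contraction I J A \<Longrightarrow> hsn I K (mmul J A B) \<le> hsn J K B"
  unfolding hsn_def by (subst (1 2) sum.swap) (auto simp: contraction_def mmul_def intro!: sum_mono)

text \<open>For u = (adj W) v, the squared norm of u is the inner product of v with W u, hence at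
  most |v| |W u| \<le> |v| |u|.\<close>

lemma contraction_adj:
  assumes W: "contraction I K W" shows "contraction K I (adj W)"
  unfolding contraction_def
proof
  fix v
  define u where "u k = (\<Sum>i\<in>I. adj W k i * v i)" for k
  define a where "a = (\<Sum>k\<in>K. (cmod (u k))\<^sup>2)"
  define b where "b = (\<Sum>i\<in>I. (cmod (v i))\<^sup>2)"
  have ab: "a \<ge> 0" "b \<ge> 0" by (simp_all add: a_def b_def sum_nonneg)
  have "complex_of_real a = (\<Sum>k\<in>K. u k * cnj (u k))"
    unfolding a_def of_real_sum complex_norm_square ..
  also have "\<dots> = (\<Sum>k\<in>K. \<Sum>i\<in>I. cnj (v i) * (W i k * u k))"
    by (simp add: u_def adj_def sum_distrib_left mult_ac)
  also have "\<dots> = (\<Sum>i\<in>I. cnj (v i) * (\<Sum>k\<in>K. W i k * u k))"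
    by (subst sum.swap) (simp add: sum_distrib_left)
  finally have "a = cmod (\<Sum>i\<in>I. cnj (v i) * (\<Sum>k\<in>K. W i k * u k))"
    using ab(1) by (metis norm_of_real abs_of_nonneg)
  also have "\<dots> \<le> sqrt b * sqrt (\<Sum>i\<in>I. (cmod (\<Sum>k\<in>K. W i k * u k))\<^sup>2)"
    using norm_sum_mult_le[of "\<lambda>i. cnj (v i)"] by (simp add: b_def)
  also have "\<dots> \<le> sqrt b * sqrt a"
    using W ab by (intro mult_left_mono real_sqrt_le_mono) (auto simp: contraction_def a_def)
  finally have "sqrt a * sqrt a \<le> sqrt b * sqrt a" using ab by simp
  then have "sqrt a \<le> sqrt b \<or> a = 0"
    using ab by (auto simp: mult_le_cancel_right simp del: real_sqrt_mult_self)
  then have "a \<le> b"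
    using ab by auto
  then show "(\<Sum>k\<in>K. (cmod (\<Sum>i\<in>I. adj W k i * v i))\<^sup>2) \<le> (\<Sum>i\<in>I. (cmod (v i))\<^sup>2)"
    by (simp add: a_def b_def u_def)
qed

lemma unitary_contraction:
  assumes S: "finite S" and U: "unitary S U" shows "contraction S S U"
  unfolding contraction_def
proof
  fix v
  have "complex_of_real (\<Sum>i\<in>S. (cmod (\<Sum>k\<in>S. U i k * v k))\<^sup>2)
    = (\<Sum>k\<in>S. (cmod (\<Sum>i\<in>S. cnj (cnj (v i)) * cnj (adj U i k)))\<^sup>2)"
    by (simp add: adj_def mult.commute)
  also have "\<dots> = (\<Sum>k\<in>S. (cmod (\<Sum>i\<in>S. cnj (v i) * adj U i k))\<^sup>2)"
    by (simp only: complex_cnj_mult[symmetric] cnj_sum[symmetric] complex_mod_cnj)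
  also have "\<dots> = sesq S (mmul S (adj U) (adj (adj U))) v"
    by (rule sesq_mmul_adj[symmetric])
  also have "\<dots> = sesq S (idm S) v" using U by (simp add: unitary_def)
  also have "\<dots> = (\<Sum>i\<in>S. cnj (v i) * v i)"
    using S by (simp add: sesq_def idm_def of_bool_def if_distrib[of "\<lambda>x. _ * x"] if_distrib[of "\<lambda>x. x * _"] cong: if_cong)
  also have "\<dots> = complex_of_real (\<Sum>i\<in>S. (cmod (v i))\<^sup>2)"
    unfolding of_real_sum complex_norm_square by (simp add: mult.commute)
  finally have "(\<Sum>i\<in>S. (cmod (\<Sum>k\<in>S. U i k * v k))\<^sup>2) = (\<Sum>i\<in>S. (cmod (v i))\<^sup>2)"
    unfolding of_real_eq_iff .
  then show "(\<Sum>i\<in>S. (cmod (\<Sum>k\<in>S. U i k * v k))\<^sup>2) \<le> (\<Sum>i\<in>S. (cmod (v i))\<^sup>2)" by simp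
qed

text \<open>In the eigenbasis of \<open>P\<close> only the diagonal entries of \<open>L\<close>
  contribute, and these have modulus at most 1.\<close>

lemma trace_contraction_psd_le:
  assumes S: "finite S" and P: "P \<in> mats S S" "opr_positive S P" and L: "contraction S S L"
  shows "Re (opr_trace S (mmul S L P)) \<le> Re (opr_trace S P)"
proof -
  obtain E d where E: "unitary S E" and Pd: "P = spec S E d"
    by (rule spectral[OF S P(1) opr_positive_hermitian[OF S P(2,1)]]) (rule that)
  have d: "d k \<ge> 0" if "k \<in> S" for k
    using P(2) that by (auto simp: Pd opr_positive_spec[OF S E])
  have le: "Re (sesq S L (\<lambda>i. E i k)) \<le> 1" if k: "k \<in> S" for k
  proof -
    have "sesq S L (\<lambda>i. E i k) = (\<Sum>i\<in>S. cnj (E i k) * (\<Sum>j\<in>S. L i j * E j k))"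
      by (simp add: sesq_def sum_distrib_left mult.assoc)
    then have "cmod (sesq S L (\<lambda>i. E i k))
      \<le> sqrt (\<Sum>i\<in>S. (cmod (cnj (E i k)))\<^sup>2) * sqrt (\<Sum>i\<in>S. (cmod (\<Sum>j\<in>S. L i j * E j k))\<^sup>2)"
      by (simp only: norm_sum_mult_le)
    also have "\<dots> \<le> 1 * sqrt 1"
    proof (rule mult_mono)
      show "sqrt (\<Sum>i\<in>S. (cmod (\<Sum>j\<in>S. L i j * E j k))\<^sup>2) \<le> sqrt 1"
        using L[unfolded contraction_def, rule_format, of "\<lambda>j. E j k"] unitary_column[OF E k]
        by (intro real_sqrt_le_mono) simp
    qed (simp_all add: unitary_column[OF E k] sum_nonneg)
    finally show ?thesis using complex_Re_le_cmod[of "sesq S L (\<lambda>i. E i k)"] by simp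
  qed
  have "Re (opr_trace S (mmul S L P)) = (\<Sum>k\<in>S. d k * Re (sesq S L (\<lambda>i. E i k)))"
    by (simp add: Pd trace_spec[OF S E])
  also have "\<dots> \<le> (\<Sum>k\<in>S. d k)"
    using d le by (intro sum_mono) (simp add: mult_left_le)
  also have "\<dots> = Re (opr_trace S P)"
  proof -
    have "opr_trace S P = opr_trace S (mmul S (diagm S d) (mmul S (adj E) E))"
      using trace_cyclic[of S S E "mmul S (diagm S d) (adj E)"] by (simp add: Pd spec_def mmul_assoc)
    also have "\<dots> = opr_trace S (diagm S d)"
      using E by (simp add: unitary_def mmul_idm_right[OF S mats_diagm])
    finally show ?thesis by (simp add: opr_trace_def diagm_def idm_def)
  qed
  finally show ?thesis .
qed

text \<open>Factor L Z as L (adj U) times the positive matrix U Z. The lemma exists because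
  Uhlmann's argument produces only a contraction, whereas Alice's attack has to be a physical
  operation.\<close>

lemma unitary_dominates_contraction:
  assumes S: "finite S" and Z: "Z \<in> mats S S" and L: "contraction S S L"
  obtains U where "unitary S U" "Re (opr_trace S (mmul S L Z)) \<le> Re (opr_trace S (mmul S U Z))"
proof -
  obtain U where U: "unitary S U" "opr_positive S (mmul S U Z)"
    "\<And>V. unitary S V \<Longrightarrow> Re (opr_trace S (mmul S V Z)) \<le> Re (opr_trace S (mmul S U Z))"
    by (rule polar[OF S Z]) (rule that)
  have "mmul S L Z = mmul S (mmul S L (adj U)) (mmul S U Z)"
    by (simp add: mmul_assoc unitary_cancel(1)[OF S U(1) Z])
  moreover have "contraction S S (mmul S L (adj U))"
    using L unitary_contraction[OF S unitary_adj[OF U(1)]] by (rule contraction_mmul)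
  ultimately show ?thesis
    using that[OF U(1)] trace_contraction_psd_le[OF S _ U(2)] unitary_mats[OF U(1)] Z by (metis mats_mmul)
qed

text \<open>A symmetrised difference of squares: with D = A - B and C = A + B, the matrix is the
  mean of D (adj C) and C (adj D). When \<open>A\<close> and \<open>B\<close> purify two states,
  this bounds the distance of the states by the overlap of the purifications.\<close>

lemma trace_diff_squares_le:
  assumes S: "finite S" and U: "unitary S U"
  shows "Re (opr_trace S (mmul S U (\<lambda>i j. mmul K A (adj A) i j - mmul K B (adj B) i j)))
    \<le> hsn S K (\<lambda>i k. A i k - B i k) * hsn S K (\<lambda>i k. A i k + B i k)"
proof -
  define D where "D = (\<lambda>i k. A i k - B i k)"
  define C where "C = (\<lambda>i k. A i k + B i k)"
  have AB: "(\<lambda>i j. mmul K A (adj A) i j - mmul K B (adj B) i j)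
    = (\<lambda>i j. 1/2 * (mmul K D (adj C) i j + mmul K C (adj D) i j))"
    by (intro ext) (simp add: D_def C_def mmul_def adj_def algebra_simps sum.distrib sum_subtractf)
  have le: "Re (opr_trace S (mmul S U (mmul K X (adj Y)))) \<le> hsn S K X * hsn S K Y" for X Y
  proof -
    have "Re (opr_trace S (mmul S U (mmul K X (adj Y)))) \<le> hsn S K (mmul S U X) * hsn K S (adj Y)"
      unfolding mmul_assoc[symmetric] by (rule order_trans[OF complex_Re_le_cmod trace_mmul_le_hsn])
    also have "\<dots> \<le> hsn S K X * hsn S K Y"
      unfolding hsn_adj by (intro mult_right_mono contraction_hsn unitary_contraction[OF S U]) simp
    finally show ?thesis .
  qed
  have "Re (opr_trace S (mmul S U (\<lambda>i j. mmul K A (adj A) i j - mmul K B (adj B) i j)))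
    = (Re (opr_trace S (mmul S U (mmul K D (adj C)))) + Re (opr_trace S (mmul S U (mmul K C (adj D))))) / 2"
    unfolding AB mmul_scale_right mmul_add_right opr_trace_scale opr_trace_add by simp
  also have "\<dots> \<le> hsn S K D * hsn S K C"
    using le[of D C] le[of C D] by (simp add: mult.commute)
  finally show ?thesis by (simp add: D_def C_def)
qed

text \<open>The trace norm is tested against the sign of \<open>R - Q\<close>.\<close>

lemma powers_stormer:
  assumes S: "finite S" and R: "R \<in> mats S S" "opr_positive S R" and Q: "Q \<in> mats S S" "opr_positive S Q"
  shows "Re (opr_trace S (mmul S R R)) + Re (opr_trace S (mmul S Q Q)) - 2 * Re (opr_trace S (mmul S R Q))
    \<le> trace_norm S (\<lambda>i j. mmul S R R i j - mmul S Q Q i j)"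
proof -
  define D where "D = (\<lambda>i j. R i j - Q i j)"
  have herm: "adj R = R" "adj Q = Q" using opr_positive_hermitian[OF S] R Q by auto
  have D: "D \<in> mats S S" "adj D = D"
    using R Q herm by (auto simp: D_def mats_def adj_def fun_eq_iff) metis+
  obtain E d where E: "unitary S E" and Dd: "D = spec S E d"
    by (rule spectral[OF S D]) (rule that)
  \<comment> \<open>The sign of 0 is set to 1, so that the sign matrix is unitary.\<close>
  define s :: "'a \<Rightarrow> real" where "s k = (if d k \<ge> 0 then 1 else -1)" for k
  define M where "M = (\<lambda>i j. mmul S R R i j - mmul S Q Q i j)"
  have M: "M \<in> mats S S"
    using mats_mmul[OF R(1) R(1), of S] mats_mmul[OF Q(1) Q(1), of S] by (simp add: M_def mats_def) metis
  have sU: "unitary S (spec S E s)"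
  proof -
    have "spec S E (\<lambda>k. s k * s k) = mmul S E (mmul S (idm S) (adj E))"
      by (simp add: s_def spec_def diagm_def if_distrib cong: if_cong)
    also have "\<dots> = idm S"
      using E mmul_idm_left[OF S mats_adj[OF unitary_mats[OF E]]] by (simp add: unitary_def)
    finally show ?thesis
      using mats_spec[OF E] by (simp add: unitary_def adj_spec spec_mmul[OF S E])
  qed
  \<comment> \<open>Let \<open>a\<close> and \<open>b\<close> be the forms of R and Q at the k-th
    eigenvector of R - Q. The form of R^2 - Q^2 there is d k (a + b), where a - b = d k; positivity
    of \<open>a\<close> and \<open>b\<close> gives a + b \<ge> |d k|.\<close>
  have key: "s k * Re (sesq S M (\<lambda>i. E i k)) \<ge> (d k)\<^sup>2" if k: "k \<in> S" for k
  proof -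
    define v where "v = (\<lambda>i. E i k)"
    define x where "x j = (\<Sum>i\<in>S. cnj (v i) * R i j)" for j
    define y where "y j = (\<Sum>i\<in>S. cnj (v i) * Q i j)" for j
    define a where "a = Re (sesq S R v)"
    define b where "b = Re (sesq S Q v)"
    have "sesq S R v \<in> \<real>\<^sub>\<ge>\<^sub>0" "sesq S Q v \<in> \<real>\<^sub>\<ge>\<^sub>0" using R Q by (auto simp: opr_positive_sesq)
    then have ab: "sesq S R v = of_real a" "a \<ge> 0" "sesq S Q v = of_real b" "b \<ge> 0"
      by (auto simp: a_def b_def complex_nonneg_Reals_iff complex_eq_iff)
    have "sesq S D v = of_real (d k)" unfolding v_def Dd by (rule sesq_spec[OF S E k])
    then have dab: "d k = a - b"
      unfolding D_def sesq_diff ab by (metis of_real_diff of_real_eq_iff)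
    have xy: "x j - y j = d k * cnj (v j)" for j
    proof -
      have "x j - y j = mmul S (adj E) D k j"
        by (simp add: x_def y_def v_def D_def mmul_def adj_def algebra_simps sum_subtractf)
      also have "\<dots> = mmul S (diagm S d) (adj E) k j"
        unfolding Dd spec_def using unitary_mats[OF E] by (subst unitary_cancel(1)[OF S E]) auto
      also have "\<dots> = d k * cnj (v j)"
        using k diagm_mmul_apply[OF S mats_adj[OF unitary_mats[OF E]]] by (simp add: adj_def v_def)
      finally show ?thesis .
    qed
    have vx: "(\<Sum>j\<in>S. x j * v j) = of_real a" "(\<Sum>j\<in>S. y j * v j) = of_real b"
      unfolding ab(1,3)[symmetric] sesq_def x_def y_def sum_distrib_right by (rule sum.swap)+
    have "sesq S M v = sesq S (mmul S R (adj R)) v - sesq S (mmul S Q (adj Q)) v"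
      unfolding M_def sesq_diff herm ..
    also have "\<dots> = complex_of_real (\<Sum>j\<in>S. (cmod (x j))\<^sup>2 - (cmod (y j))\<^sup>2)"
      unfolding sesq_mmul_adj by (simp add: x_def y_def sum_subtractf)
    finally have "Re (sesq S M v) = (\<Sum>j\<in>S. (cmod (x j))\<^sup>2 - (cmod (y j))\<^sup>2)"
      by (metis Re_complex_of_real)
    also have "\<dots> = (\<Sum>j\<in>S. Re ((x j + y j) * cnj (x j - y j)))"
      by (intro sum.cong refl, simp only: cmod_power2) (simp add: power2_eq_square algebra_simps)
    also have "\<dots> = Re (of_real (d k) * ((\<Sum>j\<in>S. x j * v j) + (\<Sum>j\<in>S. y j * v j)))"
      unfolding xy by (simp add: sum.distrib[symmetric] sum_distrib_left algebra_simps)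
    also have "\<dots> = d k * (a + b)" unfolding vx by simp
    finally have "s k * Re (sesq S M v) = \<bar>d k\<bar> * (a + b)"
      by (simp add: s_def)
    also have "\<dots> \<ge> \<bar>d k\<bar> * \<bar>d k\<bar>"
      using dab ab by (intro mult_left_mono) auto
    finally show ?thesis by (simp add: v_def power2_eq_square)
  qed
  have "opr_trace S (mmul S D D) = (\<Sum>k\<in>S. of_real (d k) * of_real (d k))"
    using trace_spec[OF S E, of D d] sesq_spec[OF S E] by (simp add: Dd)
  then have "Re (opr_trace S (mmul S D D)) = (\<Sum>k\<in>S. (d k)\<^sup>2)"
    by (simp add: power2_eq_square)
  also have "\<dots> \<le> (\<Sum>k\<in>S. s k * Re (sesq S M (\<lambda>i. E i k)))"
    by (intro sum_mono key)
  also have "\<dots> = Re (opr_trace S (mmul S M (spec S E s)))"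
    by (simp add: trace_spec[OF S E])
  also have "\<dots> \<le> trace_norm S M"
    unfolding trace_cyclic[of S S M] by (rule trace_norm_upper[OF S M sU])
  finally have "Re (opr_trace S (mmul S D D)) \<le> trace_norm S M" .
  moreover have "opr_trace S (mmul S D D)
    = opr_trace S (mmul S R R) + opr_trace S (mmul S Q Q) - 2 * opr_trace S (mmul S R Q)"
    unfolding D_def mmul_diff_left mmul_diff_right opr_trace_diff
    by (simp add: trace_cyclic[of S S Q R])
  ultimately show ?thesis by (simp add: M_def)
qed

text \<open>The polar decomposition \<open>M = \<surd>(M M\<^sup>*) W\<close>; on the kernel of \<open>M M\<^sup>*\<close> the junk value
  \<open>1 / 0 = 0\<close> makes \<open>W\<close> vanish.\<close>

lemma sqrt_contraction:
  assumes I: "finite I" and K: "finite K" and M: "M \<in> mats I K"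
  obtains R W where "R \<in> mats I I" "opr_positive I R" "mmul I R R = mmul K M (adj M)"
    "W \<in> mats I K" "contraction I K W" "mmul K M (adj W) = R"
proof -
  have P: "mmul K M (adj M) \<in> mats I I" "opr_positive I (mmul K M (adj M))"
    using M unfolding opr_positive_sesq
    by (auto simp: sesq_mmul_adj intro!: sum_nonneg simp flip: of_real_power of_real_sum)
  obtain E d where E: "unitary I E" and Pd: "mmul K M (adj M) = spec I E d"
    and d: "\<And>k. k \<in> I \<Longrightarrow> d k \<ge> 0" and R: "opr_positive I (spec I E (\<lambda>k. sqrt (d k)))"
    "mmul I (spec I E (\<lambda>k. sqrt (d k))) (spec I E (\<lambda>k. sqrt (d k))) = mmul K M (adj M)"
    by (rule psd_sqrt_exists[OF I P]) (rule that)
  define J where "J = spec I E (\<lambda>k. 1 / sqrt (d k))"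
  define W where "W = mmul I J M"
  have J: "J \<in> mats I I" "adj J = J" by (simp_all add: J_def mats_spec[OF E] adj_spec)
  have "mmul K M (adj W) = mmul I (mmul K M (adj M)) J"
    by (simp add: W_def adj_mmul J mmul_assoc)
  also have "\<dots> = spec I E (\<lambda>k. sqrt (d k))"
    unfolding Pd J_def spec_mmul[OF I E]
    using d by (intro ext) (simp add: spec_apply[OF I E] real_div_sqrt)
  finally have MW: "mmul K M (adj W) = spec I E (\<lambda>k. sqrt (d k))" .
  have "contraction K I (adj W)"
    unfolding contraction_def
  proof
    fix v
    \<comment> \<open>\<open>\<pi> k\<close> is 1 unless \<open>d k = 0\<close>, where it is 0. So W
      (adj W) is a projection, which makes \<open>adj W\<close> a contraction.\<close>
    define \<pi> where "\<pi> k = (1 / sqrt (d k)) * sqrt (d k)" for k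
    have "mmul K W (adj W) = mmul I J (spec I E (\<lambda>k. sqrt (d k)))"
      by (simp add: MW[symmetric] W_def mmul_assoc)
    then have WW: "mmul K W (adj W) = spec I E \<pi>"
      unfolding J_def spec_mmul[OF I E] \<pi>_def .
    define w where "w k = (\<Sum>i\<in>I. cnj (v i) * E i k)" for k
    have ses: "sesq I (spec I E d) v = (\<Sum>k\<in>I. of_real (d k * (cmod (w k))\<^sup>2))" for d
    proof -
      have "sesq I (spec I E d) v = (\<Sum>i\<in>I. \<Sum>j\<in>I. \<Sum>k\<in>I. of_real (d k) * ((cnj (v i) * E i k) * cnj (cnj (v j) * E j k)))"
        by (simp add: sesq_def spec_apply[OF I E] sum_distrib_left sum_distrib_right mult_ac)
      also have "\<dots> = (\<Sum>k\<in>I. \<Sum>i\<in>I. \<Sum>j\<in>I. of_real (d k) * ((cnj (v i) * E i k) * cnj (cnj (v j) * E j k)))"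
        by (rule trans[OF _ sum.swap], rule sum.cong[OF refl], rule sum.swap)
      also have "\<dots> = (\<Sum>k\<in>I. of_real (d k) * (w k * cnj (w k)))"
        unfolding w_def cnj_sum sum_product by (simp only: sum_distrib_left)
      finally show ?thesis by (simp only: of_real_mult complex_norm_square)
    qed
    have "complex_of_real (\<Sum>k\<in>K. (cmod (\<Sum>i\<in>I. cnj (v i) * W i k))\<^sup>2) = sesq I (spec I E \<pi>) v"
      unfolding WW[symmetric] sesq_mmul_adj ..
    also have "\<dots> = complex_of_real (\<Sum>k\<in>I. \<pi> k * (cmod (w k))\<^sup>2)"
      by (simp only: ses of_real_sum)
    finally have "(\<Sum>k\<in>K. (cmod (\<Sum>i\<in>I. cnj (v i) * W i k))\<^sup>2) = (\<Sum>k\<in>I. \<pi> k * (cmod (w k))\<^sup>2)"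
      using of_real_eq_iff by blast
    also have "\<dots> \<le> (\<Sum>k\<in>I. (cmod (w k))\<^sup>2)"
      by (intro sum_mono) (auto simp: \<pi>_def mult_left_le_one_le)
    also have "\<dots> = (\<Sum>k\<in>I. (cmod (\<Sum>i\<in>I. adj E k i * v i))\<^sup>2)"
    proof -
      have "(\<Sum>i\<in>I. adj E k i * v i) = cnj (w k)" for k by (simp add: w_def adj_def mult.commute)
      then show ?thesis by simp
    qed
    also have "\<dots> \<le> (\<Sum>i\<in>I. (cmod (v i))\<^sup>2)"
      using unitary_contraction[OF I unitary_adj[OF E]] by (simp add: contraction_def)
    finally show "(\<Sum>k\<in>K. (cmod (\<Sum>i\<in>I. adj W k i * v i))\<^sup>2) \<le> (\<Sum>i\<in>I. (cmod (v i))\<^sup>2)"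
    proof -
      assume *: "(\<Sum>k\<in>K. (cmod (\<Sum>i\<in>I. cnj (v i) * W i k))\<^sup>2) \<le> (\<Sum>i\<in>I. (cmod (v i))\<^sup>2)"
      have eq: "(\<Sum>i\<in>I. adj W k i * v i) = cnj (\<Sum>i\<in>I. cnj (v i) * W i k)" for k
        by (simp add: adj_def mult.commute)
      show ?thesis using * unfolding eq complex_mod_cnj .
    qed
  qed
  from contraction_adj[OF this] have "contraction I K W" by simp
  then show ?thesis
    using that[OF mats_spec[OF E] R] MW M J by (auto simp: W_def)
qed

section \<open>Walsh characters\<close>

text \<open>The sign (-1)^(x . y). The recursion is driven by the first argument and reads the
  second by \<open>hd\<close> and \<open>tl\<close>, so \<open>chi_pm\<close> and
  \<open>chi_False\<close> hold for lists of any length.\<close>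

primrec chi :: "bool list \<Rightarrow> bool list \<Rightarrow> real" where
  "chi [] y = 1"
| "chi (x # xs) y = (if x \<and> hd y then -1 else 1) * chi xs (tl y)"

lemma bits_0: "bits 0 = {[]}"
  by (auto simp: bits_def)

lemma bits_Suc: "bits (Suc l) = (#) True ` bits l \<union> (#) False ` bits l"
proof -
  have "x \<in> (#) True ` {x. length x = l} \<union> (#) False ` {x. length x = l}" if "length x = Suc l" for x
    using that by (cases x) (auto simp: image_iff)
  then show ?thesis by (auto simp: bits_def)
qed

lemma finite_bits [simp]: "finite (bits l)"
  by (induction l) (simp_all add: bits_0 bits_Suc)

lemma sum_bits_Suc: "(\<Sum>x\<in>bits (Suc l). f x) = (\<Sum>x\<in>bits l. f (True # x)) + (\<Sum>x\<in>bits l. f (False # x))"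
proof -
  have "(\<Sum>x\<in>bits (Suc l). f x) = (\<Sum>x\<in>(#) True ` bits l. f x) + (\<Sum>x\<in>(#) False ` bits l. f x)"
    unfolding bits_Suc by (intro sum.union_disjoint) auto
  then show ?thesis by (simp add: sum.reindex)
qed

lemma card_bits: "card (bits l) = 2 ^ l"
proof (induction l)
  case (Suc l)
  then show ?case using sum_bits_Suc[of "\<lambda>_. 1 :: nat" l] by simp
qed (simp add: bits_0)

lemma chi_pm: "chi a x = 1 \<or> chi a x = -1"
  by (induction a arbitrary: x) auto

lemma chi_commute: "length a = length x \<Longrightarrow> chi a x = chi x a"
  by (induction a x rule: list_induct2) auto

lemma chi_False: "chi (replicate l False) x = 1"
  by (induction l arbitrary: x) auto

lemma chi_orthogonal:
  "x \<in> bits l \<Longrightarrow> y \<in> bits l \<Longrightarrow> (\<Sum>a\<in>bits l. chi a x * chi a y) = of_bool (x = y) * 2 ^ l"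
proof (induction l arbitrary: x y)
  case (Suc l)
  obtain p x' q y' where xy: "x = p # x'" "y = q # y'" "x' \<in> bits l" "y' \<in> bits l"
    using Suc.prems by (auto simp: bits_Suc)
  show ?case
    using Suc.IH[OF xy(3,4)] by (cases p; cases q) (auto simp: xy(1,2) sum_bits_Suc sum_negf)
qed (simp add: bits_0)

text \<open>Orthogonality to the trivial character, after exchanging the arguments of
  \<open>chi\<close>. It makes the two halves equally large.\<close>

lemma chi_balanced:
  assumes "a \<in> bits l" "a \<noteq> replicate l False" shows "(\<Sum>x\<in>bits l. chi a x) = 0"
proof -
  have z: "replicate l False \<in> bits l" by (simp add: bits_def)
  have "(\<Sum>x\<in>bits l. chi a x) = (\<Sum>x\<in>bits l. chi x a * chi x (replicate l False))"
  proof (intro sum.cong refl)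
    fix x assume "x \<in> bits l"
    then have "chi x (replicate l False) = 1" "chi a x = chi x a"
      using chi_commute[of x "replicate l False"] chi_commute[of a x] assms by (simp_all add: chi_False bits_def)
    then show "chi a x = chi x a * chi x (replicate l False)" by simp
  qed
  then show ?thesis using chi_orthogonal[OF assms(1) z] assms(2) by simp
qed

lemma chi_parseval:
  "(\<Sum>a\<in>bits l. (cmod (\<Sum>x\<in>bits l. of_real (chi a x) * f x))\<^sup>2) = 2 ^ l * (\<Sum>x\<in>bits l. (cmod (f x))\<^sup>2)"
proof -
  have "complex_of_real (\<Sum>a\<in>bits l. (cmod (\<Sum>x\<in>bits l. of_real (chi a x) * f x))\<^sup>2)
    = (\<Sum>a\<in>bits l. \<Sum>x\<in>bits l. \<Sum>y\<in>bits l. of_real (chi a x * chi a y) * (f x * cnj (f y)))"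
    unfolding of_real_sum complex_norm_square by (simp add: sum_product mult_ac)
  also have "\<dots> = (\<Sum>x\<in>bits l. \<Sum>y\<in>bits l. \<Sum>a\<in>bits l. of_real (chi a x * chi a y) * (f x * cnj (f y)))"
    by (rule trans[OF sum.swap], rule sum.cong[OF refl], rule sum.swap)
  also have "\<dots> = (\<Sum>x\<in>bits l. \<Sum>y\<in>bits l. of_real (\<Sum>a\<in>bits l. chi a x * chi a y) * (f x * cnj (f y)))"
    by (simp only: of_real_sum sum_distrib_right)
  also have "\<dots> = (\<Sum>x\<in>bits l. 2 ^ l * (f x * cnj (f x)))"
    by (intro sum.cong refl) (simp add: chi_orthogonal of_bool_def if_distrib[of "\<lambda>u. u * _"] if_distrib[of complex_of_real] cong: if_cong)
  also have "\<dots> = complex_of_real (2 ^ l * (\<Sum>x\<in>bits l. (cmod (f x))\<^sup>2))"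
    unfolding of_real_mult of_real_sum complex_norm_square by (simp add: sum_distrib_left)
  finally show ?thesis unfolding of_real_eq_iff .
qed

text \<open>Averaging. Parseval in each matrix entry bounds the sum over all characters by N * (N *
  c) with N = 2 ^ l. Hence one of the N - 1 nontrivial ones has value at most N^2 c / (N - 1), which
  is at most 2 N c since N \<ge> 2.\<close>

lemma exists_good_character:
  assumes l: "l \<ge> 1" and Y: "\<And>x. x \<in> bits l \<Longrightarrow> (hsn I K (Y x))\<^sup>2 \<le> c"
  obtains a where "a \<in> bits l" "a \<noteq> replicate l False"
    "(hsn I K (\<lambda>i k. \<Sum>x\<in>bits l. of_real (chi a x) * Y x i k))\<^sup>2 \<le> 2 ^ (l + 1) * c"
proof -
  define g where "g a = (hsn I K (\<lambda>i k. \<Sum>x\<in>bits l. of_real (chi a x) * Y x i k))\<^sup>2" for a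
  define N :: real where "N = 2 ^ l"
  let ?A = "bits l - {replicate l False}"
  have N: "N \<ge> 2" using l power_increasing[of 1 l "2::real"] by (simp add: N_def)
  have c: "c \<ge> 0"
    using Y[of "replicate l False"] by (auto simp: bits_def intro: order_trans[OF zero_le_power2])
  have "(\<Sum>a\<in>bits l. g a) = (\<Sum>i\<in>I. \<Sum>k\<in>K. \<Sum>a\<in>bits l. (cmod (\<Sum>x\<in>bits l. of_real (chi a x) * Y x i k))\<^sup>2)"
    unfolding g_def hsn_sq by (rule trans[OF sum.swap], rule sum.cong[OF refl], rule sum.swap)
  also have "\<dots> = N * (\<Sum>x\<in>bits l. (hsn I K (Y x))\<^sup>2)"
    unfolding chi_parseval hsn_sq N_def sum_distrib_left
    by (rule sym, rule trans[OF sum.swap], rule sum.cong[OF refl], rule sum.swap)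
  also have "\<dots> \<le> N * (\<Sum>x\<in>bits l. c)"
    using N by (intro mult_left_mono sum_mono Y) auto
  finally have tot: "(\<Sum>a\<in>bits l. g a) \<le> N * (N * c)"
    by (simp add: card_bits N_def)
  have sub: "(\<Sum>a\<in>?A. g a) \<le> (\<Sum>a\<in>bits l. g a)"
    by (rule sum_mono2) (auto simp: g_def)
  have "\<exists>a\<in>?A. g a \<le> 2 * N * c"
  proof (rule ccontr)
    assume "\<not> ?thesis"
    then have gt: "\<And>a. a \<in> ?A \<Longrightarrow> 2 * N * c < g a" by (meson not_le)
    have "replicate l False \<in> bits l" by (simp add: bits_def)
    then have "card ?A = 2 ^ l - 1" by (simp add: card_bits card_Diff_singleton)
    then have cA: "real (card ?A) = N - 1" by (simp add: N_def of_nat_diff)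
    then have ne: "?A \<noteq> {}" using N by force
    have "(N - 1) * (2 * N * c) = (\<Sum>a\<in>?A. 2 * N * c)" by (simp only: sum_constant cA)
    also have "\<dots> < (\<Sum>a\<in>?A. g a)"
      using gt ne by (intro sum_strict_mono) auto
    finally have "(N - 1) * (2 * N * c) < N * (N * c)" using sub tot by simp
    moreover have "N * (N * c) \<le> (N - 1) * (2 * N * c)"
    proof -
      have "N * (N * c) \<le> (2 * (N - 1)) * (N * c)"
        using N c by (intro mult_right_mono) auto
      then show ?thesis by (simp add: algebra_simps)
    qed
    ultimately show False by simp
  qed
  then show ?thesis using that by (auto simp: g_def N_def mult.commute)
qed


section \<open>Block diagonal operators\<close>

lemma sum_Times: "(\<Sum>p\<in>A \<times> B. f p) = (\<Sum>a\<in>A. \<Sum>b\<in>B. f (a, b))"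
  by (simp add: sum.cartesian_product)

text \<open>A classical-quantum operator with one block for each classical value, cut off outside
  \<open>X\<close> so that it lies in \<open>mats\<close>.\<close>

definition blk :: "'x set \<Rightarrow> ('x \<Rightarrow> 'i \<Rightarrow> 'i \<Rightarrow> complex) \<Rightarrow> 'x \<times> 'i \<Rightarrow> 'x \<times> 'i \<Rightarrow> complex" where
  "blk X R = (\<lambda>(x, i) (y, j). of_bool (x = y \<and> x \<in> X) * R x i j)"

lemma mats_blk: "(\<And>x. x \<in> X \<Longrightarrow> R x \<in> mats S S) \<Longrightarrow> blk X R \<in> mats (X \<times> S) (X \<times> S)"
  by (auto simp: mats_def blk_def)

lemma blk_mmul:
  assumes "finite X" shows "mmul (X \<times> S) (blk X A) (blk X B) = blk X (\<lambda>x. mmul S (A x) (B x))"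
proof (intro ext, clarify)
  fix x i y j
  have "mmul (X \<times> S) (blk X A) (blk X B) (x, i) (y, j)
    = (\<Sum>z\<in>X. \<Sum>k\<in>S. of_bool (x = z \<and> z = y \<and> x \<in> X) * (A x i k * B x k j))"
    by (auto simp: mmul_def blk_def sum_Times intro!: sum.cong)
  also have "\<dots> = (\<Sum>z\<in>X. if z = x then of_bool (x = y \<and> x \<in> X) * mmul S (A x) (B x) i j else 0)"
    by (intro sum.cong refl) (auto simp: mmul_def)
  also have "\<dots> = blk X (\<lambda>x. mmul S (A x) (B x)) (x, i) (y, j)"
    using assms by (auto simp: blk_def)
  finally show "mmul (X \<times> S) (blk X A) (blk X B) (x, i) (y, j) = blk X (\<lambda>x. mmul S (A x) (B x)) (x, i) (y, j)" .
qed

lemma trace_blk: "opr_trace (X \<times> S) (blk X A) = (\<Sum>x\<in>X. opr_trace S (A x))"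
  by (simp add: opr_trace_def blk_def sum_Times)

lemma opr_positive_blk:
  assumes "finite X" and "\<And>x. x \<in> X \<Longrightarrow> opr_positive S (R x)" shows "opr_positive (X \<times> S) (blk X R)"
  unfolding opr_positive_sesq
proof
  fix v
  have "sesq (X \<times> S) (blk X R) v
    = (\<Sum>x\<in>X. \<Sum>i\<in>S. \<Sum>y\<in>X. \<Sum>j\<in>S. of_bool (x = y) * (cnj (v (x, i)) * R x i j * v (x, j)))"
    by (auto simp: sesq_def blk_def sum_Times intro!: sum.cong)
  also have "\<dots> = (\<Sum>x\<in>X. \<Sum>i\<in>S. \<Sum>y\<in>X. if y = x then \<Sum>j\<in>S. cnj (v (x, i)) * R x i j * v (x, j) else 0)"
    by (intro sum.cong refl) auto
  also have "\<dots> = (\<Sum>x\<in>X. sesq S (R x) (\<lambda>i. v (x, i)))"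
    using assms(1) by (simp add: sesq_def)
  also have "\<dots> \<in> \<real>\<^sub>\<ge>\<^sub>0"
    using assms(2) by (auto simp: opr_positive_sesq complex_nonneg_Reals_iff intro!: sum_nonneg)
  finally show "sesq (X \<times> S) (blk X R) v \<in> \<real>\<^sub>\<ge>\<^sub>0" .
qed

text \<open>In \<open>weakly_hiding\<close> the compared operators may have nonzero entries at
  labels outside \<open>bits l\<close>. The trace norm does not see them, which allows the passage
  to \<open>blk\<close>.\<close>

lemma trace_norm_cong:
  assumes "\<And>i j. i \<in> S \<Longrightarrow> j \<in> S \<Longrightarrow> T i j = T' i j"
  shows "trace_norm S T = trace_norm S T'"
proof -
  have *: "opr_mult S (opr_adjoint T) T i j = opr_mult S (opr_adjoint T') T' i j" if "i \<in> S" "j \<in> S" for i j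
    using assms that by (simp add: opr_mult_def opr_adjoint_def)
  have "opr_sqrt S (opr_mult S (opr_adjoint T) T) = opr_sqrt S (opr_mult S (opr_adjoint T') T')"
    unfolding opr_sqrt_def by (rule arg_cong[where f = The]) (auto simp: fun_eq_iff *)
  then show ?thesis by (simp add: trace_norm_def)
qed

lemma mats_scale: "A \<in> mats I K \<Longrightarrow> (\<lambda>i k. z * A i k) \<in> mats I K"
  by (auto simp: mats_def)

lemma opr_positive_scale:
  "c \<ge> 0 \<Longrightarrow> opr_positive S R \<Longrightarrow> opr_positive S (\<lambda>i j. of_real c * R i j)"
  by (auto simp: opr_positive_sesq sesq_scale_left)

lemma Re_trace_mmul_adj:
  "Re (opr_trace I (mmul K A (adj B))) = (\<Sum>i\<in>I. \<Sum>k\<in>K. Re (A i k * cnj (B i k)))"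
  by (simp add: opr_trace_def mmul_def adj_def)

lemma hsn_add_diff_sq:
  "(hsn I K (\<lambda>i k. A i k - B i k))\<^sup>2 = (hsn I K A)\<^sup>2 + (hsn I K B)\<^sup>2 - 2 * Re (opr_trace I (mmul K A (adj B)))"
  "(hsn I K (\<lambda>i k. A i k + B i k))\<^sup>2 = (hsn I K A)\<^sup>2 + (hsn I K B)\<^sup>2 + 2 * Re (opr_trace I (mmul K A (adj B)))"
proof -
  have *: "(cmod (a - b))\<^sup>2 = (cmod a)\<^sup>2 + (cmod b)\<^sup>2 - 2 * Re (a * cnj b)"
    "(cmod (a + b))\<^sup>2 = (cmod a)\<^sup>2 + (cmod b)\<^sup>2 + 2 * Re (a * cnj b)" for a b
    by (simp_all only: cmod_power2) (simp_all add: power2_eq_square algebra_simps)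
  show "(hsn I K (\<lambda>i k. A i k - B i k))\<^sup>2 = (hsn I K A)\<^sup>2 + (hsn I K B)\<^sup>2 - 2 * Re (opr_trace I (mmul K A (adj B)))"
    "(hsn I K (\<lambda>i k. A i k + B i k))\<^sup>2 = (hsn I K A)\<^sup>2 + (hsn I K B)\<^sup>2 + 2 * Re (opr_trace I (mmul K A (adj B)))"
    unfolding hsn_sq Re_trace_mmul_adj * by (simp_all only: sum.distrib sum_subtractf sum_distrib_left)
qed

lemma hsn_diff_add_le:
  assumes "hsn I K A \<le> 1" "hsn I K B \<le> 1"
  defines "F \<equiv> Re (opr_trace I (mmul K A (adj B)))"
  shows "F \<le> 1" "hsn I K (\<lambda>i k. A i k - B i k) * hsn I K (\<lambda>i k. A i k + B i k) \<le> 2 * sqrt (2 * (1 - F))"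
proof -
  define p where "p = hsn I K (\<lambda>i k. A i k - B i k)"
  define q where "q = hsn I K (\<lambda>i k. A i k + B i k)"
  have le: "(hsn I K A)\<^sup>2 \<le> 1" "(hsn I K B)\<^sup>2 \<le> 1"
    using assms(1,2) power_le_one[OF hsn_nonneg] by blast+
  have p: "p\<^sup>2 \<le> 2 - 2 * F"
    unfolding p_def hsn_add_diff_sq F_def using le by linarith
  have q: "q\<^sup>2 \<le> 2 + 2 * F"
    unfolding q_def hsn_add_diff_sq F_def using le by linarith
  show F: "F \<le> 1" using order_trans[OF zero_le_power2 p] by simp
  have "(p * q)\<^sup>2 \<le> (2 - 2 * F) * (2 + 2 * F)"
    unfolding power_mult_distrib using p q F by (intro mult_mono) auto
  also have "\<dots> \<le> (2 - 2 * F) * 4"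
    using F by (intro mult_left_mono) auto
  finally have "p * q \<le> sqrt (4 * (2 * (1 - F)))"
    by (intro real_le_rsqrt) (simp add: algebra_simps)
  also have "\<dots> = 2 * sqrt (2 * (1 - F))"
    unfolding real_sqrt_mult[of 4] by simp
  finally show "p * q \<le> 2 * sqrt (2 * (1 - F))" .
qed

text \<open>Since \<psi> x times \<open>adj (W x)\<close> is the square root \<open>R x\<close> of
  Bob's state, the overlap of \<open>\<psi> x\<close> with \<open>mmul LB s (W x)\<close> is the
  trace of (R x) s. Powers-Stormer, applied once to the block operators over all inputs, bounds its
  average: 2 - 2 (mean of F) \<le> 2 \<epsilon>.\<close>

lemma hiding_overlap:
  fixes \<psi> :: "'x \<Rightarrow> 'b \<Rightarrow> 'k \<Rightarrow> complex"
  assumes X: "finite X" "X \<noteq> {}" and LB: "finite LB" and K: "finite K"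
    and \<psi>: "\<And>x. x \<in> X \<Longrightarrow> \<psi> x \<in> mats LB K" "\<And>x. x \<in> X \<Longrightarrow> hsn LB K (\<psi> x) = 1"
    and \<sigma>: "density LB \<sigma>"
    and le: "trace_norm (X \<times> LB) (blk X (\<lambda>x i j. (mmul K (\<psi> x) (adj (\<psi> x)) i j - \<sigma> i j) / card X)) \<le> 2 * \<epsilon>"
  obtains s W where "s \<in> mats LB LB" "hsn LB LB s = 1" "\<And>x. x \<in> X \<Longrightarrow> W x \<in> mats LB K"
    "\<And>x. x \<in> X \<Longrightarrow> contraction LB K (W x)"
    "(\<Sum>x\<in>X. 1 - Re (opr_trace LB (mmul K (\<psi> x) (adj (mmul LB s (W x)))))) \<le> \<epsilon> * card X"
proof -
  have \<sigma>': "\<sigma> \<in> mats LB LB" "opr_positive LB \<sigma>" "opr_trace LB \<sigma> = 1"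
    using \<sigma> by (auto simp: density_def oprs_eq_mats)
  obtain E d where E: "unitary LB E" and "\<sigma> = spec LB E d" "\<And>k. k \<in> LB \<Longrightarrow> d k \<ge> 0"
    and s0: "opr_positive LB (spec LB E (\<lambda>k. sqrt (d k)))"
    "mmul LB (spec LB E (\<lambda>k. sqrt (d k))) (spec LB E (\<lambda>k. sqrt (d k))) = \<sigma>"
    by (rule psd_sqrt_exists[OF LB \<sigma>'(1,2)]) (rule that)
  define s where "s = spec LB E (\<lambda>k. sqrt (d k))"
  have s: "s \<in> mats LB LB" "opr_positive LB s" "mmul LB s s = \<sigma>" "adj s = s"
    using s0 mats_spec[OF E] by (auto simp: s_def adj_spec)
  have "complex_of_real ((hsn LB LB s)\<^sup>2) = 1"
    unfolding hsn_sq_trace by (simp add: s \<sigma>')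
  then have hs: "hsn LB LB s = 1"
    using hsn_nonneg[of LB LB s] by (metis of_real_eq_1_iff power2_eq_1_iff neg_0_le_iff_le not_one_le_zero)
  \<comment> \<open>One predicate for both components of the polar decomposition, so that a single
    choice yields \<open>R\<close> and \<open>W\<close> together.\<close>
  define good where "good x p \<longleftrightarrow> fst p \<in> mats LB LB \<and> opr_positive LB (fst p) \<and>
    mmul LB (fst p) (fst p) = mmul K (\<psi> x) (adj (\<psi> x)) \<and>
    snd p \<in> mats LB K \<and> contraction LB K (snd p) \<and> mmul K (\<psi> x) (adj (snd p)) = fst p" for x p
  have "\<exists>p. good x p" if "x \<in> X" for x
  proof -
    obtain R W where "R \<in> mats LB LB" "opr_positive LB R" "mmul LB R R = mmul K (\<psi> x) (adj (\<psi> x))"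
      "W \<in> mats LB K" "contraction LB K W" "mmul K (\<psi> x) (adj W) = R"
      by (rule sqrt_contraction[OF LB K \<psi>(1)[OF \<open>x \<in> X\<close>]]) (rule that)
    then show ?thesis unfolding good_def by (intro exI[of _ "(R, W)"]) auto
  qed
  then obtain p where p: "\<And>x. x \<in> X \<Longrightarrow> good x (p x)" by metis
  define R where "R x = fst (p x)" for x
  define W where "W x = snd (p x)" for x
  have R: "R x \<in> mats LB LB" "opr_positive LB (R x)" "mmul LB (R x) (R x) = mmul K (\<psi> x) (adj (\<psi> x))"
    and W: "W x \<in> mats LB K" "contraction LB K (W x)" "mmul K (\<psi> x) (adj (W x)) = R x" if "x \<in> X" for x
    using p[OF that] by (simp_all add: good_def R_def W_def)
  define N where "N = real (card X)"
  have N: "N > 0" using X by (simp add: N_def card_gt_0_iff)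
  \<comment> \<open>Squaring the blocks has to produce the weight 1 / N of a uniform input.\<close>
  define c where "c = 1 / sqrt N"
  have c: "c \<ge> 0" "c * c = 1 / N" using N by (auto simp: c_def)
  define RP where "RP = blk X (\<lambda>x i j. of_real c * R x i j)"
  define Q where "Q = blk X (\<lambda>x i j. of_real c * s i j)"
  have RP: "RP \<in> mats (X \<times> LB) (X \<times> LB)" "opr_positive (X \<times> LB) RP"
    unfolding RP_def using R c X by (auto intro!: mats_blk mats_scale opr_positive_blk opr_positive_scale)
  have Q: "Q \<in> mats (X \<times> LB) (X \<times> LB)" "opr_positive (X \<times> LB) Q"
    unfolding Q_def using s c X by (auto intro!: mats_blk mats_scale opr_positive_blk opr_positive_scale)
  have prod: "mmul (X \<times> LB) (blk X (\<lambda>x i j. of_real c * A x i j)) (blk X (\<lambda>x i j. of_real c * B x i j))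
    = blk X (\<lambda>x i j. of_real (1 / N) * mmul LB (A x) (B x) i j)" for A B :: "'x \<Rightarrow> 'b \<Rightarrow> 'b \<Rightarrow> complex"
    unfolding blk_mmul[OF X(1)] mmul_scale_left mmul_scale_right c(2)[symmetric] of_real_mult mult.assoc ..
  have tr: "Re (opr_trace (X \<times> LB) (blk X (\<lambda>x i j. of_real (1 / N) * A x i j)))
    = (\<Sum>x\<in>X. Re (opr_trace LB (A x))) / N" for A :: "'x \<Rightarrow> 'b \<Rightarrow> 'b \<Rightarrow> complex"
    unfolding trace_blk opr_trace_scale by (simp add: sum_divide_distrib)
  have "Re (opr_trace LB (mmul LB (R x) (R x))) = 1" if "x \<in> X" for x
    using R(3)[OF that] \<psi>(2)[OF that] hsn_sq_trace[of LB K "\<psi> x"] by simp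
  then have t1: "Re (opr_trace (X \<times> LB) (mmul (X \<times> LB) RP RP)) = 1"
    unfolding RP_def prod tr using N by (simp add: N_def)
  have t2: "Re (opr_trace (X \<times> LB) (mmul (X \<times> LB) Q Q)) = 1"
    unfolding Q_def prod tr using N by (simp add: N_def s \<sigma>')
  define F where "F x = Re (opr_trace LB (mmul K (\<psi> x) (adj (mmul LB s (W x)))))" for x
  have "Re (opr_trace LB (mmul LB (R x) s)) = F x" if "x \<in> X" for x
    unfolding F_def W(3)[OF that, symmetric] by (simp add: adj_mmul s mmul_assoc)
  then have t3: "Re (opr_trace (X \<times> LB) (mmul (X \<times> LB) RP Q)) = (\<Sum>x\<in>X. F x) / N"
    unfolding RP_def Q_def prod tr by simp
  have diff: "mmul (X \<times> LB) RP RP i j - mmul (X \<times> LB) Q Q i j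
    = blk X (\<lambda>x i j. (mmul K (\<psi> x) (adj (\<psi> x)) i j - \<sigma> i j) / card X) i j" for i j
    unfolding RP_def Q_def prod using R(3)
    by (auto simp: blk_def s N_def diff_divide_distrib split: prod.split)
  have "1 + 1 - 2 * ((\<Sum>x\<in>X. F x) / N) \<le> 2 * \<epsilon>"
    using powers_stormer[OF _ RP Q] X LB le unfolding t1 t2 t3 diff by simp
  then have "(\<Sum>x\<in>X. 1 - F x) \<le> \<epsilon> * card X"
    using N by (simp add: sum_subtractf N_def field_simps)
  then show ?thesis using that[OF s(1) hs W(1,2)] by (simp add: F_def)
qed

section \<open>Reduced states on the receiver and the memory\<close>

text \<open>The same amplitudes with the memory moved from Alice's side to Bob's:
  \<open>\<psi>\<close> is the cut that hiding speaks about, its reshaping the cut on which Alice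
  attacks.\<close>

definition reshape :: "('b \<Rightarrow> 'a \<times> 'c \<Rightarrow> complex) \<Rightarrow> 'b \<times> 'c \<Rightarrow> 'a \<Rightarrow> complex" where
  "reshape \<psi> = (\<lambda>(b, c) a. \<psi> b (a, c))"

text \<open>The partial trace over Alice of the pure state \<open>\<psi>\<close>.\<close>

definition reduced :: "'a set \<Rightarrow> ('b \<Rightarrow> 'a \<times> 'c \<Rightarrow> complex) \<Rightarrow> 'b \<times> 'c \<Rightarrow> 'b \<times> 'c \<Rightarrow> complex" where
  "reduced LA \<psi> = mmul LA (reshape \<psi>) (adj (reshape \<psi>))"

lemma mats_reshape: "\<psi> \<in> mats LB (LA \<times> LC) \<Longrightarrow> reshape \<psi> \<in> mats (LB \<times> LC) LA"
  by (auto simp: mats_def reshape_def)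

lemma mats_reduced: "\<psi> \<in> mats LB (LA \<times> LC) \<Longrightarrow> reduced LA \<psi> \<in> mats (LB \<times> LC) (LB \<times> LC)"
  unfolding reduced_def using mats_reshape by blast

lemma hsn_reshape: "hsn (LB \<times> LC) LA (reshape \<psi>) = hsn LB (LA \<times> LC) \<psi>"
  unfolding hsn_def sum_Times reshape_def by (simp, subst sum.swap, simp)

text \<open>An inner product does not depend on how the indices are grouped. This carries the
  overlap gained from Bob's system alone over to Bob and the memory.\<close>

lemma trace_reshape:
  "opr_trace (LB \<times> LC) (mmul LA (reshape A) (adj (reshape B))) = opr_trace LB (mmul (LA \<times> LC) A (adj B))"
  unfolding opr_trace_def mmul_def adj_def sum_Times reshape_def by (simp, subst sum.swap, simp)

lemma reduced_diff_le:
  assumes "finite LB" "finite LC" and A: "hsn LB (LA \<times> LC) A \<le> 1" and B: "hsn LB (LA \<times> LC) B \<le> 1"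
    and U: "unitary (LB \<times> LC) U"
  shows "Re (opr_trace (LB \<times> LC) (mmul (LB \<times> LC) U (\<lambda>i j. reduced LA A i j - reduced LA B i j)))
    \<le> 2 * sqrt (2 * (1 - Re (opr_trace LB (mmul (LA \<times> LC) A (adj B)))))"
  unfolding reduced_def trace_reshape[symmetric]
  by (rule order_trans[OF trace_diff_squares_le[OF _ U] hsn_diff_add_le(2)])
     (use assms in \<open>simp_all add: hsn_reshape\<close>)

lemma hsn_contraction_right: "contraction I K W \<Longrightarrow> hsn J K (mmul I s W) \<le> hsn J I s"
  using contraction_hsn[OF contraction_adj, of I K W J "adj s"]
  by (metis adj_mmul hsn_adj)

text \<open>Let S be \<open>s\<close> tensored with the identity of the memory. Each reduced state
  is S times a matrix \<open>Y x\<close>, so the character sum is S Z and Cauchy-Schwarz bounds its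
  trace against a unitary by two Hilbert-Schmidt norms: \<open>sqrt (card LC)\<close> for S, and
  \<open>sqrt (2 ^ (l + 1) * card LC)\<close> for Z by the choice of the character. The norm of
  \<open>Y x\<close> is bounded by cutting \<open>W x\<close> into \<open>card LC\<close>
  contractions, one for each memory value.\<close>

lemma leftover_bound:
  assumes fin: "finite LA" "finite LB" "finite LC" and l: "l \<ge> 1"
    and s: "s \<in> mats LB LB" "hsn LB LB s = 1"
    and W: "\<And>x. x \<in> bits l \<Longrightarrow> W x \<in> mats LB (LA \<times> LC)"
      "\<And>x. x \<in> bits l \<Longrightarrow> contraction LB (LA \<times> LC) (W x)"
  obtains a where "a \<in> bits l" "a \<noteq> replicate l False"
    "\<And>U. unitary (LB \<times> LC) U \<Longrightarrow>
      Re (opr_trace (LB \<times> LC) (mmul (LB \<times> LC) U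
        (\<lambda>i j. \<Sum>x\<in>bits l. of_real (chi a x) * reduced LA (mmul LB s (W x)) i j)))
      \<le> sqrt (2 ^ (l + 1)) * card LC"
proof -
  let ?BC = "LB \<times> LC"
  define \<Phi> where "\<Phi> x = mmul LB s (W x)" for x
  define Y where "Y x = mmul LA (reshape (W x)) (adj (reshape (\<Phi> x)))" for x
  define S where "S = (\<lambda>(b, c) (b', c'). of_bool (c = c' \<and> c \<in> LC) * s b b')"
  have Wc: "contraction LB LA (\<lambda>b a. W x b (a, c))" if x: "x \<in> bits l" and c: "c \<in> LC" for x c
    unfolding contraction_def
  proof
    fix v :: "'a \<Rightarrow> complex"
    \<comment> \<open>Fixing the memory value \<open>c\<close> amounts to feeding \<open>W x\<close>
      only vectors supported on \<open>c\<close>.\<close>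
    define u where "u = (\<lambda>(a, c'). of_bool (c' = c) * v a)"
    have e: "(\<Sum>k\<in>LA \<times> LC. f k * u k) = (\<Sum>a\<in>LA. f (a, c) * v a)" for f
      using c fin by (simp add: sum_Times u_def of_bool_def if_distrib[of "\<lambda>x. x * _"] if_distrib[of "\<lambda>x. _ * x"] cong: if_cong)
    have "(\<Sum>k\<in>LA \<times> LC. (cmod (u k))\<^sup>2) = (\<Sum>a\<in>LA. \<Sum>c'\<in>LC. if c' = c then (cmod (v a))\<^sup>2 else 0)"
      unfolding sum_Times by (intro sum.cong refl) (auto simp: u_def)
    then have n: "(\<Sum>k\<in>LA \<times> LC. (cmod (u k))\<^sup>2) = (\<Sum>a\<in>LA. (cmod (v a))\<^sup>2)"
      using c fin by simp
    show "(\<Sum>i\<in>LB. (cmod (\<Sum>k\<in>LA. W x i (k, c) * v k))\<^sup>2) \<le> (\<Sum>k\<in>LA. (cmod (v k))\<^sup>2)"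
      using W(2)[OF x, unfolded contraction_def, rule_format, of u] unfolding e n .
  qed
  have \<Phi>1: "hsn LB (LA \<times> LC) (\<Phi> x) \<le> 1" if "x \<in> bits l" for x
    using hsn_contraction_right[OF W(2)[OF that], of LB s] s by (simp add: \<Phi>_def)
  have Yle: "(hsn ?BC ?BC (Y x))\<^sup>2 \<le> real (card LC)" if x: "x \<in> bits l" for x
  proof -
    have "(hsn ?BC ?BC (Y x))\<^sup>2 = (\<Sum>c\<in>LC. (hsn LB ?BC (mmul LA (\<lambda>b a. W x b (a, c)) (adj (reshape (\<Phi> x)))))\<^sup>2)"
      unfolding hsn_sq sum_Times[of _ LB LC] by (subst sum.swap) (simp add: Y_def mmul_def reshape_def)
    also have "\<dots> \<le> (\<Sum>c\<in>LC. 1)"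
    proof (rule sum_mono)
      fix c assume c: "c \<in> LC"
      have "hsn LB ?BC (mmul LA (\<lambda>b a. W x b (a, c)) (adj (reshape (\<Phi> x)))) \<le> hsn LA ?BC (adj (reshape (\<Phi> x)))"
        by (rule contraction_hsn[OF Wc[OF x c]])
      also have "\<dots> \<le> 1" unfolding hsn_adj hsn_reshape by (rule \<Phi>1[OF x])
      finally show "(hsn LB ?BC (mmul LA (\<lambda>b a. W x b (a, c)) (adj (reshape (\<Phi> x)))))\<^sup>2 \<le> 1"
        by (simp add: power_le_one)
    qed
    finally show ?thesis by simp
  qed
  obtain a where a: "a \<in> bits l" "a \<noteq> replicate l False"
    "(hsn ?BC ?BC (\<lambda>i k. \<Sum>x\<in>bits l. of_real (chi a x) * Y x i k))\<^sup>2 \<le> 2 ^ (l + 1) * real (card LC)"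
    by (rule exists_good_character[where Y = Y and I = ?BC and K = ?BC and c = "real (card LC)", OF l Yle]) (assumption, rule that)
  have hS: "hsn ?BC ?BC S = sqrt (card LC)"
  proof -
    have "(hsn ?BC ?BC S)\<^sup>2 = (\<Sum>b\<in>LB. \<Sum>c\<in>LC. \<Sum>b'\<in>LB. \<Sum>c'\<in>LC. if c' = c then (cmod (s b b'))\<^sup>2 else 0)"
      unfolding hsn_sq sum_Times by (intro sum.cong refl) (auto simp: S_def)
    also have "\<dots> = card LC * (hsn LB LB s)\<^sup>2"
      using fin by (simp add: hsn_sq sum_distrib_left)
    finally have "(hsn ?BC ?BC S)\<^sup>2 = card LC" by (simp add: s)
    then show ?thesis by (metis hsn_nonneg real_sqrt_unique)
  qed
  have red: "reduced LA (\<Phi> x) = mmul ?BC S (Y x)" if x: "x \<in> bits l" for x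
  proof -
    have "reshape (\<Phi> x) = mmul ?BC S (reshape (W x))"
    proof (intro ext, clarify)
      fix b c a
      have "mmul ?BC S (reshape (W x)) (b, c) a = (\<Sum>b'\<in>LB. \<Sum>c'\<in>LC. if c' = c then s b b' * W x b' (a, c) else 0)"
        unfolding mmul_def sum_Times by (intro sum.cong refl) (auto simp: S_def reshape_def)
      \<comment> \<open>For \<open>c\<close> outside \<open>LC\<close> both sides vanish.\<close>
      also have "\<dots> = (\<Sum>b'\<in>LB. s b b' * W x b' (a, c))"
        using fin matsD2[OF W(1)[OF x], of "(a, c)"] by (intro sum.cong refl) auto
      finally show "reshape (\<Phi> x) (b, c) a = mmul ?BC S (reshape (W x)) (b, c) a"
        by (simp add: reshape_def \<Phi>_def mmul_def)
    qed
    then show ?thesis by (simp add: reduced_def Y_def mmul_assoc[symmetric])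
  qed
  define Z where "Z = (\<lambda>i k. \<Sum>x\<in>bits l. of_real (chi a x) * Y x i k)"
  have Zred: "(\<lambda>i j. \<Sum>x\<in>bits l. of_real (chi a x) * reduced LA (\<Phi> x) i j) = mmul ?BC S Z"
  proof (intro ext)
    fix i j
    have "mmul ?BC S Z i j = (\<Sum>x\<in>bits l. of_real (chi a x) * mmul ?BC S (Y x) i j)"
      unfolding mmul_def Z_def sum_distrib_left by (subst sum.swap) (simp add: mult_ac)
    then show "(\<Sum>x\<in>bits l. of_real (chi a x) * reduced LA (\<Phi> x) i j) = mmul ?BC S Z i j"
      using red by simp
  qed
  have "hsn ?BC ?BC Z \<le> sqrt (2 ^ (l + 1) * real (card LC))"
    using a(3) unfolding Z_def by (rule real_le_rsqrt)
  then have Z: "hsn ?BC ?BC Z \<le> sqrt (2 ^ (l + 1)) * sqrt (card LC)"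
    by (simp only: real_sqrt_mult)
  have "Re (opr_trace ?BC (mmul ?BC U (mmul ?BC S Z))) \<le> sqrt (2 ^ (l + 1)) * card LC"
    if U: "unitary ?BC U" for U
  proof -
    have "Re (opr_trace ?BC (mmul ?BC U (mmul ?BC S Z))) \<le> hsn ?BC ?BC (mmul ?BC U S) * hsn ?BC ?BC Z"
      unfolding mmul_assoc[symmetric] by (rule order_trans[OF complex_Re_le_cmod trace_mmul_le_hsn])
    also have "\<dots> \<le> sqrt (card LC) * (sqrt (2 ^ (l + 1)) * sqrt (card LC))"
      using contraction_hsn[OF unitary_contraction[OF _ U], of ?BC S] Z fin hS by (intro mult_mono) auto
    also have "\<dots> = sqrt (2 ^ (l + 1)) * card LC"
      by simp
    finally show ?thesis .
  qed
  then show ?thesis using that[OF a(1,2)] unfolding \<Phi>_def[symmetric] Zred by blast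
qed

lemma sum_sqrt_le:
  fixes u :: "'a \<Rightarrow> real"
  assumes "finite X" "\<And>x. x \<in> X \<Longrightarrow> u x \<ge> 0"
  shows "(\<Sum>x\<in>X. sqrt (u x)) \<le> sqrt (card X * (\<Sum>x\<in>X. u x))"
proof -
  have "(\<Sum>x\<in>X. \<bar>1\<bar> * \<bar>sqrt (u x)\<bar>) \<le> L2_set (\<lambda>_. 1) X * L2_set (\<lambda>x. sqrt (u x)) X"
    by (rule L2_set_mult_ineq)
  also have "\<dots> = sqrt (card X) * sqrt (\<Sum>x\<in>X. u x)"
    using assms by (simp add: L2_set_def)
  finally show ?thesis using assms by (simp add: real_sqrt_mult)
qed

text \<open>Turns a one-sided bound on a difference into a bound for either sign of the
  character.\<close>

lemma unitary_sign:
  assumes "unitary S U" "c = 1 \<or> c = (-1 :: real)" shows "unitary S (\<lambda>i j. of_real c * U i j)"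
proof -
  have "adj (\<lambda>i j. of_real c * U i j) = (\<lambda>i j. of_real c * adj U i j)"
    by (simp add: adj_def)
  then show ?thesis
    using assms by (auto simp: unitary_def mmul_scale_left mmul_scale_right mats_def)
qed

text \<open>\<open>X0\<close> and \<open>X1\<close> are the level sets of the character, of size N /
  2 each, so the difference of averages is 2 / N times the character sum of the reduced states.
  Replacing the state on input \<open>x\<close> costs 2 sqrt (2 (1 - f x)), and
  \<open>leftover_bound\<close> handles the rest. The conclusion is about the trace norm, twice the
  trace distance.\<close>

lemma partition_close:
  fixes \<psi> :: "bool list \<Rightarrow> 'b \<Rightarrow> 'a \<times> 'c \<Rightarrow> complex"
  assumes fin: "finite LA" "finite LB" "finite LC" and l: "l \<ge> 1"
    and \<psi>: "\<And>x. x \<in> bits l \<Longrightarrow> \<psi> x \<in> mats LB (LA \<times> LC)" "\<And>x. x \<in> bits l \<Longrightarrow> hsn LB (LA \<times> LC) (\<psi> x) = 1"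
    and \<sigma>: "density LB \<sigma>"
    and le: "trace_norm (bits l \<times> LB) (blk (bits l)
      (\<lambda>x i j. (mmul (LA \<times> LC) (\<psi> x) (adj (\<psi> x)) i j - \<sigma> i j) / card (bits l))) \<le> 2 * \<epsilon>"
  obtains X0 X1 where "X0 \<subseteq> bits l" "X1 \<subseteq> bits l" "X0 \<noteq> {}" "X1 \<noteq> {}" "X0 \<inter> X1 = {}"
    "trace_norm (LB \<times> LC) (\<lambda>i j. (\<Sum>x\<in>X0. reduced LA (\<psi> x) i j) / card X0 - (\<Sum>x\<in>X1. reduced LA (\<psi> x) i j) / card X1)
      \<le> 4 * sqrt (2 * \<epsilon>) + 2 * card LC * sqrt (2 / 2 ^ l)"
proof -
  let ?X = "bits l" and ?BC = "LB \<times> LC" and ?K = "LA \<times> LC"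
  define N :: real where "N = 2 ^ l"
  have N: "N > 0" by (simp add: N_def)
  have Xne: "?X \<noteq> {}" using card_bits[of l] by (metis card.empty power_not_zero zero_neq_numeral)
  obtain s W where s: "s \<in> mats LB LB" "hsn LB LB s = 1" and W: "\<And>x. x \<in> ?X \<Longrightarrow> W x \<in> mats LB ?K"
    "\<And>x. x \<in> ?X \<Longrightarrow> contraction LB ?K (W x)"
    and F: "(\<Sum>x\<in>?X. 1 - Re (opr_trace LB (mmul ?K (\<psi> x) (adj (mmul LB s (W x)))))) \<le> \<epsilon> * card ?X"
    by (rule hiding_overlap[OF finite_bits Xne fin(2) finite_cartesian_product[OF fin(1,3)] \<psi> \<sigma> le]) (assumption, assumption, rule that)
  obtain a where a: "a \<in> ?X" "a \<noteq> replicate l False" and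
    left: "\<And>U. unitary ?BC U \<Longrightarrow> Re (opr_trace ?BC (mmul ?BC U
        (\<lambda>i j. \<Sum>x\<in>?X. of_real (chi a x) * reduced LA (mmul LB s (W x)) i j))) \<le> sqrt (2 ^ (l + 1)) * card LC"
    by (rule leftover_bound[OF fin l s W]) (assumption, assumption, rule that)
  define \<Phi> where "\<Phi> x = mmul LB s (W x)" for x
  define f where "f x = Re (opr_trace LB (mmul ?K (\<psi> x) (adj (\<Phi> x))))" for x
  have \<Phi>1: "hsn LB ?K (\<Phi> x) \<le> 1" if "x \<in> ?X" for x
    using hsn_contraction_right[OF W(2)[OF that], of LB s] s by (simp add: \<Phi>_def)
  define X0 where "X0 = {x \<in> ?X. chi a x = 1}"
  define X1 where "X1 = {x \<in> ?X. chi a x = -1}"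
  have un: "X0 \<union> X1 = ?X" "X0 \<inter> X1 = {}" using chi_pm[of a] by (auto simp: X0_def X1_def)
  have f01: "finite X0" "finite X1" by (simp_all add: X0_def X1_def)
  have split: "(\<Sum>x\<in>?X. g x) = (\<Sum>x\<in>X0. g x) + (\<Sum>x\<in>X1. g x)" for g :: "bool list \<Rightarrow> 'z::comm_monoid_add"
    using sum.union_disjoint[OF f01 un(2), of g] un(1) by simp
  have "real (card X0) - real (card X1) = 0"
    using split[of "chi a"] chi_balanced[OF a] by (simp add: X0_def X1_def)
  moreover have "real (card X0) + real (card X1) = N"
    using split[of "\<lambda>_. 1 :: real"] by (simp add: card_bits N_def)
  ultimately have cards: "real (card X0) = N / 2" "real (card X1) = N / 2" by auto
  define T where "T = (\<lambda>i j. (\<Sum>x\<in>X0. reduced LA (\<psi> x) i j) / card X0 - (\<Sum>x\<in>X1. reduced LA (\<psi> x) i j) / card X1)"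
  have ccards: "complex_of_nat (card X0) = of_real (N / 2)" "complex_of_nat (card X1) = of_real (N / 2)"
    using cards by (metis of_real_of_nat_eq)+
  have T: "T = (\<lambda>i j. of_real (2 / N) * (\<Sum>x\<in>?X. of_real (chi a x) * reduced LA (\<psi> x) i j))"
    unfolding T_def split ccards using N by (intro ext) (simp add: X0_def X1_def sum_negf field_simps)
  have Tm: "T \<in> mats ?BC ?BC"
  proof (rule matsI)
    fix i j assume "i \<notin> ?BC \<or> j \<notin> ?BC"
    then have "reduced LA (\<psi> x) i j = 0" if "x \<in> ?X" for x
      using mats_reduced[OF \<psi>(1)[OF that]] by (meson matsD1 matsD2)
    then show "T i j = 0" by (simp add: T)
  qed
  obtain U where U: "unitary ?BC U" and TU: "trace_norm ?BC T = Re (opr_trace ?BC (mmul ?BC U T))"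
    by (rule trace_norm_attained[OF finite_cartesian_product[OF fin(2,3)] Tm]) (rule that)
  \<comment> \<open>Testing with one fixed optimal \<open>U\<close> makes the trace norm additive,
    so the pieces can be bounded separately.\<close>
  define G where "G A = Re (opr_trace ?BC (mmul ?BC U A))" for A
  have Gsum: "G (\<lambda>i j. \<Sum>x\<in>?X. A x i j) = (\<Sum>x\<in>?X. G (A x))" for A
  proof -
    have "mmul ?BC U (\<lambda>i j. \<Sum>x\<in>?X. A x i j) = (\<lambda>i j. \<Sum>x\<in>?X. mmul ?BC U (A x) i j)"
      unfolding mmul_def sum_distrib_left by (intro ext, rule sum.swap)
    then show ?thesis unfolding G_def opr_trace_def by (simp add: sum.swap[of _ ?X])
  qed
  have Gadd: "G (\<lambda>i j. A i j + B i j) = G A + G B" for A B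
    by (simp add: G_def mmul_add_right opr_trace_add)
  have Gscale: "G (\<lambda>i j. of_real r * A i j) = r * G A" for r A
    by (simp add: G_def mmul_scale_right opr_trace_scale)
  have eq: "(\<lambda>i j. \<Sum>x\<in>?X. of_real (chi a x) * reduced LA (\<psi> x) i j)
    = (\<lambda>i j. (\<Sum>x\<in>?X. of_real (chi a x) * (reduced LA (\<psi> x) i j - reduced LA (\<Phi> x) i j))
        + (\<Sum>x\<in>?X. of_real (chi a x) * reduced LA (\<Phi> x) i j))"
    by (intro ext) (simp add: algebra_simps sum_subtractf)
  have "trace_norm ?BC T = 2 / N * G (\<lambda>i j. \<Sum>x\<in>?X. of_real (chi a x) * reduced LA (\<psi> x) i j)"
    unfolding TU G_def[symmetric] unfolding T by (rule Gscale)
  also have "\<dots> = 2 / N * ((\<Sum>x\<in>?X. chi a x * G (\<lambda>i j. reduced LA (\<psi> x) i j - reduced LA (\<Phi> x) i j))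
        + G (\<lambda>i j. \<Sum>x\<in>?X. of_real (chi a x) * reduced LA (\<Phi> x) i j))"
    unfolding eq by (simp only: Gadd Gsum Gscale)
  also have "\<dots> \<le> 2 / N * ((\<Sum>x\<in>?X. 2 * sqrt (2 * (1 - f x))) + sqrt (2 ^ (l + 1)) * card LC)"
  proof (intro mult_left_mono add_mono sum_mono)
    fix x assume x: "x \<in> ?X"
    have "chi a x * G (\<lambda>i j. reduced LA (\<psi> x) i j - reduced LA (\<Phi> x) i j)
      = Re (opr_trace ?BC (mmul ?BC (\<lambda>i j. of_real (chi a x) * U i j) (\<lambda>i j. reduced LA (\<psi> x) i j - reduced LA (\<Phi> x) i j)))"
      by (simp add: G_def mmul_scale_left opr_trace_scale)
    also have "\<dots> \<le> 2 * sqrt (2 * (1 - f x))"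
      unfolding f_def using \<psi>(2)[OF x] \<Phi>1[OF x] fin
      by (intro reduced_diff_le unitary_sign[OF U chi_pm]) auto
    finally show "chi a x * G (\<lambda>i j. reduced LA (\<psi> x) i j - reduced LA (\<Phi> x) i j) \<le> 2 * sqrt (2 * (1 - f x))" .
  next
    show "G (\<lambda>i j. \<Sum>x\<in>?X. of_real (chi a x) * reduced LA (\<Phi> x) i j) \<le> sqrt (2 ^ (l + 1)) * card LC"
      unfolding G_def \<Phi>_def by (rule left[OF U])
  qed (use N in auto)
  also have "\<dots> \<le> 2 / N * (2 * (N * sqrt (2 * \<epsilon>)) + sqrt (2 ^ (l + 1)) * card LC)"
  proof (intro mult_left_mono add_right_mono)
    have f1: "f x \<le> 1" if "x \<in> ?X" for x
      unfolding f_def using \<psi>(2)[OF that] \<Phi>1[OF that] by (intro hsn_diff_add_le(1)) auto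
    \<comment> \<open>Hiding controls only the sum of 1 - f x; concavity of the root transfers this
      to the sum of the roots.\<close>
    have "(\<Sum>x\<in>?X. sqrt (2 * (1 - f x))) \<le> sqrt (card ?X * (\<Sum>x\<in>?X. 2 * (1 - f x)))"
      using f1 by (intro sum_sqrt_le) auto
    also have "\<dots> \<le> sqrt (N * (2 * (\<epsilon> * N)))"
    proof (intro real_sqrt_le_mono)
      have "(\<Sum>x\<in>?X. 2 * (1 - f x)) \<le> 2 * (\<epsilon> * N)"
        using F unfolding f_def \<Phi>_def sum_distrib_left[symmetric] by (simp add: card_bits N_def)
      then show "card ?X * (\<Sum>x\<in>?X. 2 * (1 - f x)) \<le> N * (2 * (\<epsilon> * N))"
        using N by (simp add: card_bits N_def)
    qed
    also have "\<dots> = N * sqrt (2 * \<epsilon>)"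
      using N by (simp add: real_sqrt_mult)
    finally show "(\<Sum>x\<in>?X. 2 * sqrt (2 * (1 - f x))) \<le> 2 * (N * sqrt (2 * \<epsilon>))"
      by (simp add: sum_distrib_left[symmetric])
  qed (use N in auto)
  also have "\<dots> = 4 * sqrt (2 * \<epsilon>) + 2 * card LC * sqrt (2 / 2 ^ l)"
  proof -
    have "sqrt (2 ^ (l + 1)) = N * sqrt (2 / N)"
    proof -
      have "2 ^ (l + 1) = N\<^sup>2 * (2 / N)" using N by (simp add: N_def power2_eq_square)
      then have "sqrt (2 ^ (l + 1)) = sqrt (N\<^sup>2 * (2 / N))" by (rule arg_cong)
      then show ?thesis using N unfolding real_sqrt_mult by simp
    qed
    then show ?thesis using N by (simp add: field_simps flip: N_def del: power_Suc)
  qed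
  finally have "trace_norm ?BC T \<le> 4 * sqrt (2 * \<epsilon>) + 2 * card LC * sqrt (2 / 2 ^ l)" .
  moreover have "X0 \<noteq> {}" "X1 \<noteq> {}" using cards N by auto
  ultimately show ?thesis
    using that[of X0 X1] un by (auto simp: T_def X0_def X1_def)
qed

section \<open>Local unitary attacks\<close>

text \<open>The polar factors give a contraction L = (adj W0) W1 for which L (adj M1) M0 has the
  same trace as R0 R1. A unitary does at least as well as \<open>L\<close>, and Powers-Stormer
  bounds the trace of R0 R1 from below by the trace norm directly, without passing through the
  fidelity.\<close>

lemma uhlmann:
  assumes I: "finite I" and K: "finite K" and M: "M0 \<in> mats I K" "M1 \<in> mats I K"
  obtains V where "unitary K V"
    "((hsn I K M0)\<^sup>2 + (hsn I K M1)\<^sup>2 - trace_norm I (\<lambda>i j. mmul K M0 (adj M0) i j - mmul K M1 (adj M1) i j)) / 2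
      \<le> Re (opr_trace I (mmul K (mmul K M0 V) (adj M1)))"
proof -
  obtain R0 W0 where 0: "R0 \<in> mats I I" "opr_positive I R0" "mmul I R0 R0 = mmul K M0 (adj M0)"
    "W0 \<in> mats I K" "contraction I K W0" "mmul K M0 (adj W0) = R0"
    by (rule sqrt_contraction[OF I K M(1)]) (rule that)
  obtain R1 W1 where 1: "R1 \<in> mats I I" "opr_positive I R1" "mmul I R1 R1 = mmul K M1 (adj M1)"
    "W1 \<in> mats I K" "contraction I K W1" "mmul K M1 (adj W1) = R1"
    by (rule sqrt_contraction[OF I K M(2)]) (rule that)
  define L where "L = mmul I (adj W0) W1"
  define Z where "Z = mmul I (adj M1) M0"
  have L: "contraction K K L"
    unfolding L_def by (rule contraction_mmul[OF contraction_adj[OF 0(5)] 1(5)])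
  have Z: "Z \<in> mats K K" unfolding Z_def using M by blast
  obtain V where V: "unitary K V" "Re (opr_trace K (mmul K L Z)) \<le> Re (opr_trace K (mmul K V Z))"
    by (rule unitary_dominates_contraction[OF K Z L]) (rule that)
  have "mmul K W1 (adj M1) = adj R1" by (simp add: 1(6)[symmetric] adj_mmul)
  then have R1: "mmul K W1 (adj M1) = R1" using opr_positive_hermitian[OF I 1(2,1)] by simp
  have "opr_trace K (mmul K L Z) = opr_trace K (mmul I (adj W0) (mmul K W1 (mmul I (adj M1) M0)))"
    by (simp add: L_def Z_def mmul_assoc)
  also have "\<dots> = opr_trace I (mmul I (mmul K W1 (adj M1)) (mmul K M0 (adj W0)))"
    by (subst trace_cyclic) (simp add: mmul_assoc)
  also have "\<dots> = opr_trace I (mmul I R0 R1)"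
    unfolding R1 0(6) by (rule trace_cyclic)
  finally have LZ: "opr_trace K (mmul K L Z) = opr_trace I (mmul I R0 R1)" .
  have "opr_trace K (mmul K V Z) = opr_trace K (mmul I (mmul K V (adj M1)) M0)"
    by (simp add: Z_def mmul_assoc)
  also have "\<dots> = opr_trace I (mmul K (mmul K M0 V) (adj M1))"
    by (subst trace_cyclic) (simp add: mmul_assoc)
  finally have VZ: "opr_trace K (mmul K V Z) = opr_trace I (mmul K (mmul K M0 V) (adj M1))" .
  have h: "Re (opr_trace I (mmul K M (adj M))) = (hsn I K M)\<^sup>2" for M
    by (simp add: hsn_sq_trace[symmetric] del: of_real_power)
  show ?thesis
    using that[OF V(1)] powers_stormer[OF I 0(1,2) 1(1,2)] V(2)
    unfolding LZ VZ 0(3) 1(3) h by simp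
qed

section \<open>Conjugation by a unitary on one tensor factor\<close>

lemma opr_positive_conj:
  assumes "opr_positive S T" shows "opr_positive S (mmul S A (mmul S T (adj A)))"
proof -
  \<comment> \<open>The vector as a one-column matrix: the form becomes a matrix product and
    associativity applies.\<close>
  define col :: "('a \<Rightarrow> complex) \<Rightarrow> 'a \<Rightarrow> unit \<Rightarrow> complex" where "col v = (\<lambda>i _. v i)" for v
  have sesq: "sesq S T v = mmul S (adj (col v)) (mmul S T (col v)) () ()" for T v
    by (simp add: sesq_def mmul_def adj_def col_def sum_distrib_left mult.assoc)
  have "sesq S (mmul S A (mmul S T (adj A))) v = sesq S T (\<lambda>k. mmul S (adj A) (col v) k ())" for v
  proof -
    have "col (\<lambda>k. mmul S (adj A) (col v) k ()) = mmul S (adj A) (col v)"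
      by (intro ext) (simp add: col_def)
    then show ?thesis unfolding sesq by (simp add: adj_mmul mmul_assoc)
  qed
  then show ?thesis using assms by (simp add: opr_positive_sesq)
qed

text \<open>\<open>U\<close> on the first tensor factor, the identity on the second factor
  \<open>D\<close>.\<close>

definition ampl :: "'r set \<Rightarrow> ('i \<Rightarrow> 'i \<Rightarrow> complex) \<Rightarrow> 'i \<times> 'r \<Rightarrow> 'i \<times> 'r \<Rightarrow> complex" where
  "ampl D U = (\<lambda>(i, r) (k, s). of_bool (r = s \<and> r \<in> D) * U i k)"

lemma ampl_mmul:
  assumes "finite D" "r \<in> D" shows "mmul (S \<times> D) (ampl D U) A (i, r) t = (\<Sum>k\<in>S. U i k * A (k, r) t)"
proof -
  have "mmul (S \<times> D) (ampl D U) A (i, r) t = (\<Sum>k\<in>S. \<Sum>s\<in>D. if s = r then U i k * A (k, r) t else 0)"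
    unfolding mmul_def sum_Times using assms(2) by (intro sum.cong refl) (auto simp: ampl_def)
  then show ?thesis using assms by simp
qed

text \<open>\<open>tensor_id\<close> treats each block of \<rho> without reference to a second label
  set; support in \<open>D\<close> makes this agree with conjugation by \<open>ampl D U\<close>.
  Complete positivity and the effect of the attack both follow from it.\<close>

lemma tensor_id_conj:
  assumes D: "finite D" and \<rho>: "\<rho> \<in> mats (S \<times> D) (S \<times> D)"
  shows "tensor_id (\<lambda>\<rho>. mmul S U (mmul S \<rho> (adj U))) \<rho>
    = mmul (S \<times> D) (ampl D U) (mmul (S \<times> D) \<rho> (adj (ampl D U)))"
proof (intro ext, clarify)
  fix i r j s
  have right: "mmul (S \<times> D) \<rho> (adj (ampl D U)) p (j, s) = (\<Sum>l\<in>S. \<rho> p (l, s) * cnj (U j l))" for p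
  proof (cases "s \<in> D")
    case True
    have "mmul (S \<times> D) \<rho> (adj (ampl D U)) p (j, s) = cnj (mmul (S \<times> D) (ampl D U) (adj \<rho>) (j, s) p)"
      using fun_cong[OF fun_cong[OF adj_mmul[of "S \<times> D" "ampl D U" "adj \<rho>"]], of p "(j, s)"]
      by (simp add: adj_def)
    then show ?thesis unfolding ampl_mmul[OF D True] by (simp add: adj_def mult.commute)
  next
    case False
    then have "\<rho> p (l, s) = 0" for l using matsD2[OF \<rho>, of "(l, s)"] by auto
    moreover have "adj (ampl D U) q (j, s) = 0" for q using False by (auto simp: adj_def ampl_def split: prod.split)
    ultimately show ?thesis by (simp add: mmul_def)
  qed
  show "tensor_id (\<lambda>\<rho>. mmul S U (mmul S \<rho> (adj U))) \<rho> (i, r) (j, s)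
    = mmul (S \<times> D) (ampl D U) (mmul (S \<times> D) \<rho> (adj (ampl D U))) (i, r) (j, s)"
  proof (cases "r \<in> D")
    case True
    show ?thesis
      unfolding ampl_mmul[OF D True] right by (simp add: tensor_id_def mmul_def adj_def)
  next
    case False
    then have "\<rho> (k, r) q = 0" for k q using matsD1[OF \<rho>, of "(k, r)"] by auto
    moreover have "ampl D U (i, r) q = 0" for q using False by (auto simp: ampl_def split: prod.split)
    ultimately show ?thesis by (simp add: tensor_id_def mmul_def)
  qed
qed

lemma cptp_unitary:
  assumes S: "finite S" and U: "unitary S U"
  shows "cptp S (\<lambda>\<rho>. mmul S U (mmul S \<rho> (adj U)))"
  unfolding cptp_def oprs_eq_mats
proof (intro conjI ballI allI impI)
  fix \<rho> assume \<rho>: "\<rho> \<in> mats S S"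
  show "mmul S U (mmul S \<rho> (adj U)) \<in> mats S S"
    using unitary_mats[OF U] \<rho> by blast
  show "opr_trace S (mmul S U (mmul S \<rho> (adj U))) = opr_trace S \<rho>"
    using U by (subst trace_cyclic) (simp add: mmul_assoc unitary_def mmul_idm_right[OF S \<rho>])
next
  fix d :: nat and \<rho> assume \<rho>: "\<rho> \<in> mats (S \<times> {..<d}) (S \<times> {..<d})" and "opr_positive (S \<times> {..<d}) \<rho>"
  then show "opr_positive (S \<times> {..<d}) (tensor_id (\<lambda>\<rho>. mmul S U (mmul S \<rho> (adj U))) \<rho>)"
    unfolding tensor_id_conj[OF finite_lessThan \<rho>] by (intro opr_positive_conj)
qed (simp_all add: mmul_add_left mmul_add_right mmul_scale_left mmul_scale_right)

text \<open>States are stored with Alice's labels as columns, so multiplying by \<open>V\<close> on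
  the right means that Alice applies the transpose of \<open>V\<close>.\<close>

lemma unitary_transpose:
  assumes "unitary S V" shows "unitary S (\<lambda>i j. V j i)"
proof -
  have "mmul S (adj (\<lambda>i j. V j i)) (\<lambda>i j. V j i) i k = mmul S V (adj V) k i"
    "mmul S (\<lambda>i j. V j i) (adj (\<lambda>i j. V j i)) i k = mmul S (adj V) V k i" for i k
    by (simp_all add: mmul_def adj_def mult.commute)
  then have "mmul S (adj (\<lambda>i j. V j i)) (\<lambda>i j. V j i) = idm S" "mmul S (\<lambda>i j. V j i) (adj (\<lambda>i j. V j i)) = idm S"
    using assms by (auto simp: unitary_def idm_def fun_eq_iff)
  then show ?thesis using assms by (auto simp: unitary_def mats_def)
qed

text \<open>A pure state of \<open>K \<otimes> I\<close>, dephased with respect to the classical value \<open>\<tau>\<close> contained in the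
  label of \<open>I\<close>. Dephasing commutes with every operation on \<open>K\<close>.\<close>

definition dephased :: "('i \<Rightarrow> 't) \<Rightarrow> ('i \<Rightarrow> 'k \<Rightarrow> complex) \<Rightarrow> 'k \<times> 'i \<Rightarrow> 'k \<times> 'i \<Rightarrow> complex" where
  "dephased \<tau> M = (\<lambda>(k, i) (k', i'). of_bool (\<tau> i = \<tau> i') * (M i k * cnj (M i' k')))"

text \<open>\<open>col\<close> purifies the dephased state by copying the classical value into an
  extra index that is traced out. Norms and overlaps of these purifications are those of the
  matrices themselves, so dephasing costs nothing and the bound for pure states survives.\<close>

lemma unitary_attack_le:
  fixes M0 M1 :: "'i \<Rightarrow> 'k \<Rightarrow> complex" and \<tau> :: "'i \<Rightarrow> 't"
  assumes I: "finite I" and K: "finite K" and M: "M0 \<in> mats I K" "M1 \<in> mats I K"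
    and h: "hsn I K M0 \<le> 1" "hsn I K M1 \<le> 1" and V: "unitary K V"
  shows "trace_dist (K \<times> I) (tensor_id (\<lambda>\<rho>. mmul K (\<lambda>i j. V j i) (mmul K \<rho> (adj (\<lambda>i j. V j i)))) (dephased \<tau> M0))
      (dephased \<tau> M1) \<le> sqrt (2 * (1 - Re (opr_trace I (mmul K (mmul K M0 V) (adj M1)))))"
proof -
  let ?U = "\<lambda>i j. V j i" and ?T = "\<tau> ` I" and ?S = "K \<times> I"
  define col :: "('i \<Rightarrow> 'k \<Rightarrow> complex) \<Rightarrow> 'k \<times> 'i \<Rightarrow> 't \<Rightarrow> complex"
    where "col M = (\<lambda>(k, i) t. of_bool (\<tau> i = t) * M i k)" for M
  have T: "finite ?T" using I by simp
  have deph: "dephased \<tau> M = mmul ?T (col M) (adj (col M))" if "M \<in> mats I K" for M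
  proof (intro ext, clarify)
    fix k i k' i'
    show "dephased \<tau> M (k, i) (k', i') = mmul ?T (col M) (adj (col M)) (k, i) (k', i')"
    proof (cases "i \<in> I")
      case True
      have "mmul ?T (col M) (adj (col M)) (k, i) (k', i')
        = (\<Sum>t\<in>?T. if t = \<tau> i then of_bool (\<tau> i = \<tau> i') * (M i k * cnj (M i' k')) else 0)"
        unfolding mmul_def by (intro sum.cong refl) (auto simp: col_def adj_def)
      then show ?thesis using True T by (simp add: dephased_def)
    next
      case False
      then have "M i k = 0" by (rule matsD1[OF that])
      then show ?thesis by (simp add: dephased_def mmul_def col_def)
    qed
  qed
  have dm: "dephased \<tau> M \<in> mats ?S ?S" if "M \<in> mats I K" for M
    using that by (auto simp: mats_def dephased_def)
  have hcol: "hsn ?S ?T (col M) = hsn I K M" for M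
  proof -
    have "(\<Sum>p\<in>?S. \<Sum>t\<in>?T. (cmod (col M p t))\<^sup>2) = (\<Sum>k\<in>K. \<Sum>i\<in>I. \<Sum>t\<in>?T. if t = \<tau> i then (cmod (M i k))\<^sup>2 else 0)"
      unfolding sum_Times by (intro sum.cong refl) (auto simp: col_def)
    also have "\<dots> = (\<Sum>k\<in>K. \<Sum>i\<in>I. (cmod (M i k))\<^sup>2)" using T by simp
    also have "\<dots> = (\<Sum>i\<in>I. \<Sum>k\<in>K. (cmod (M i k))\<^sup>2)" by (rule sum.swap)
    finally show ?thesis by (simp add: hsn_def)
  qed
  have tcol: "opr_trace ?S (mmul ?T (col A) (adj (col B))) = opr_trace I (mmul K A (adj B))" for A B
  proof -
    have "opr_trace ?S (mmul ?T (col A) (adj (col B)))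
      = (\<Sum>k\<in>K. \<Sum>i\<in>I. \<Sum>t\<in>?T. if t = \<tau> i then A i k * cnj (B i k) else 0)"
      unfolding opr_trace_def mmul_def sum_Times by (intro sum.cong refl) (auto simp: col_def adj_def)
    also have "\<dots> = (\<Sum>k\<in>K. \<Sum>i\<in>I. A i k * cnj (B i k))" using T by simp
    also have "\<dots> = opr_trace I (mmul K A (adj B))"
      unfolding opr_trace_def mmul_def adj_def by (rule sum.swap)
    finally show ?thesis .
  qed
  define M0' where "M0' = mmul K M0 V"
  have M0': "M0' \<in> mats I K" unfolding M0'_def using M unitary_mats[OF V] by blast
  have h0': "hsn I K M0' \<le> 1"
    using hsn_contraction_right[OF unitary_contraction[OF K V], of I M0] h by (simp add: M0'_def)
  have Ucol: "mmul ?S (ampl I ?U) (col M0) = col M0'"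
  proof (intro ext, clarify)
    fix k i t
    show "mmul ?S (ampl I ?U) (col M0) (k, i) t = col M0' (k, i) t"
    proof (cases "i \<in> I")
      case True
      show ?thesis
        unfolding ampl_mmul[OF I True] by (simp add: col_def M0'_def mmul_def sum_distrib_left mult_ac)
    next
      case False
      then have "M0' i k = 0" by (rule matsD1[OF M0'])
      moreover have "ampl I ?U (k, i) q = 0" for q using False by (auto simp: ampl_def split: prod.split)
      ultimately show ?thesis by (simp add: col_def mmul_def)
    qed
  qed
  have "tensor_id (\<lambda>\<rho>. mmul K ?U (mmul K \<rho> (adj ?U))) (dephased \<tau> M0)
    = mmul ?T (mmul ?S (ampl I ?U) (col M0)) (adj (mmul ?S (ampl I ?U) (col M0)))"
    unfolding tensor_id_conj[OF I dm[OF M(1)]] unfolding deph[OF M(1)] by (simp add: adj_mmul mmul_assoc)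
  then have E: "tensor_id (\<lambda>\<rho>. mmul K ?U (mmul K \<rho> (adj ?U))) (dephased \<tau> M0) = mmul ?T (col M0') (adj (col M0'))"
    by (simp only: Ucol)
  let ?D = "\<lambda>i j. mmul ?T (col M0') (adj (col M0')) i j - mmul ?T (col M1) (adj (col M1)) i j"
  have fS: "finite ?S" using I K by simp
  have D: "?D \<in> mats ?S ?S"
  proof (rule matsI)
    fix i j assume "i \<notin> ?S \<or> j \<notin> ?S"
    then show "?D i j = 0"
      unfolding deph[OF M0', symmetric] deph[OF M(2), symmetric]
      using dm[OF M0'] dm[OF M(2)] by (metis matsD1 matsD2 diff_zero)
  qed
  obtain U where U: "unitary ?S U" "trace_norm ?S ?D = Re (opr_trace ?S (mmul ?S U ?D))"
    by (rule trace_norm_attained[OF fS D]) (rule that)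
  have "trace_norm ?S ?D \<le> 2 * sqrt (2 * (1 - Re (opr_trace ?S (mmul ?T (col M0') (adj (col M1))))))"
    unfolding U(2) by (rule order_trans[OF trace_diff_squares_le[OF fS U(1)] hsn_diff_add_le(2)])
      (simp_all add: hcol h h0')
  then show ?thesis
    unfolding trace_dist_def E deph[OF M(2)] tcol M0'_def[symmetric] by simp
qed

section \<open>Execution of protocols\<close>

lemma valid_graft: "valid n l (graft P f) S st \<Longrightarrow> valid n l P S st"
  by (induction P arbitrary: f S st) auto

text \<open>The control register is never altered: each value \<open>r\<close> evolves by itself, as
  a run on the fixed input \<open>inp r\<close>.\<close>

lemma run_pointwise: "run inp P t \<psi> r s c = run (\<lambda>_. inp r) P t (\<lambda>_. \<psi> r) () s c"
proof (induction P arbitrary: t \<psi> s c)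
  case (AliceOp S T V P)
  have "(\<lambda>_::unit. apply_local Alice S T (\<lambda>r. V (inp r)) \<psi> r) = apply_local Alice S T (\<lambda>_. V (inp r)) (\<lambda>_. \<psi> r)"
    by (intro ext) (simp add: apply_local_def)
  then show ?case by (simp add: AliceOp)
next
  case (BobOp S T V P)
  have "(\<lambda>_::unit. apply_local Bob S T (\<lambda>r. V) \<psi> r) = apply_local Bob S T (\<lambda>_. V) (\<lambda>_. \<psi> r)"
    by (intro ext) (simp add: apply_local_def)
  then show ?case by (simp add: BobOp)
next
  case (Send p P)
  have "(\<lambda>_::unit. apply_send p \<psi> r) = apply_send p (\<lambda>_. \<psi> r)"
    by (intro ext) (simp add: apply_send_def)
  then show ?case by (simp add: Send)
next
  case (Announce p P)
  have "(\<lambda>_::unit. apply_announce p m \<psi> r) = apply_announce p m (\<lambda>_. \<psi> r)" for m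
    by (intro ext) (simp add: apply_announce_def)
  then show ?case by (simp add: Announce split: list.split)
next
  case (Commit p i P)
  have "(\<lambda>_::unit. apply_commit p i \<psi> r) = apply_commit p i (\<lambda>_. \<psi> r)"
    by (intro ext) (simp add: apply_commit_def)
  then show ?case by (simp add: Commit)
next
  case (Open p i P)
  have "(\<lambda>_::unit. apply_open p i \<psi> r) = apply_open p i (\<lambda>_. \<psi> r)"
    by (intro ext) (simp add: apply_open_def)
  then show ?case by (simp add: Open)
qed simp

text \<open>The case \<open>z = 0\<close> is used as well: a branch without amplitude stays
  zero.\<close>

lemma run_scale: "run inp P t (\<lambda>r s c. z * \<psi> r s c) = (\<lambda>r s c. z * run inp P t \<psi> r s c)"
proof (induction P arbitrary: t \<psi>)
  case (AliceOp S T V P)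
  have "apply_local Alice S T (\<lambda>r. V (inp r)) (\<lambda>r s c. z * \<psi> r s c)
    = (\<lambda>r s c. z * apply_local Alice S T (\<lambda>r. V (inp r)) \<psi> r s c)"
    by (intro ext) (simp add: apply_local_def sum_distrib_left mult_ac)
  then show ?case by (simp add: AliceOp)
next
  case (BobOp S T V P)
  have "apply_local Bob S T (\<lambda>_. V) (\<lambda>r s c. z * \<psi> r s c)
    = (\<lambda>r s c. z * apply_local Bob S T (\<lambda>_. V) \<psi> r s c)"
    by (intro ext) (simp add: apply_local_def sum_distrib_left mult_ac)
  then show ?case by (simp add: BobOp)
next
  case (Send p P)
  have "apply_send p (\<lambda>r s c. z * \<psi> r s c) = (\<lambda>r s c. z * apply_send p \<psi> r s c)"
    by (intro ext) (simp add: apply_send_def split: list.split)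
  then show ?case by (simp add: Send)
next
  case (Announce p P)
  have "apply_announce p m (\<lambda>r s c. z * \<psi> r s c) = (\<lambda>r s c. z * apply_announce p m \<psi> r s c)" for m
    by (intro ext) (simp add: apply_announce_def)
  then show ?case by (simp add: Announce split: list.split)
next
  case (Commit p i P)
  have "apply_commit p i (\<lambda>r s c. z * \<psi> r s c) = (\<lambda>r s c. z * apply_commit p i \<psi> r s c)"
    by (intro ext) (simp add: apply_commit_def)
  then show ?case by (simp add: Commit)
next
  case (Open p i P)
  have "apply_open p i (\<lambda>r s c. z * \<psi> r s c) = (\<lambda>r s c. z * apply_open p i \<psi> r s c)"
    by (intro ext) (simp add: apply_open_def split: list.split)
  then show ?case by (simp add: Open)
qed (simp split: if_split)

lemma other_neq [simp]: "other p \<noteq> p" "p \<noteq> other p"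
  by (cases p; simp)+

lemma all_party: "(\<forall>q. P q) \<longleftrightarrow> P p \<and> P (other p)"
  by (cases p) (metis other.simps party.exhaust)+

lemma mem_update:
  "c \<in> mem_labels n \<Longrightarrow> m \<in> {0, 1} \<Longrightarrow> c[i := m] \<in> mem_labels n"
  using set_update_subset_insert[of c i m] by (auto simp: mem_labels_def)

lemma mem_nth: "c \<in> mem_labels n \<Longrightarrow> i < n \<Longrightarrow> c ! i \<in> {0, 1}"
  by (auto simp: mem_labels_def dest!: nth_mem)

lemma finite_mem_labels [simp]: "finite (mem_labels n)"
  using finite_lists_length_eq[of "{0, 1 :: nat}" n] by (auto simp: mem_labels_def conj_commute)

lemma card_mem_labels: "card (mem_labels n) = 2 ^ n"
  using card_lists_length_eq[of "{0, 1 :: nat}" n] by (simp add: mem_labels_def conj_commute card_insert_if numeral_2_eq_2)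

section \<open>Norm conservation in single protocol steps\<close>

definition config :: "nat \<Rightarrow> (party \<Rightarrow> reg set) \<Rightarrow> ((party \<Rightarrow> reg) \<times> mem) set" where
  "config n S = {(s, c). (\<forall>p. s p \<in> S p) \<and> c \<in> mem_labels n}"

lemma mem_config: "x \<in> config n S \<longleftrightarrow> (\<forall>p. fst x p \<in> S p) \<and> snd x \<in> mem_labels n"
  by (cases x) (simp add: config_def)

definition wnorm :: "nat \<Rightarrow> (party \<Rightarrow> reg set) \<Rightarrow> unit wave \<Rightarrow> real" where
  "wnorm n S \<psi> = (\<Sum>(s, c)\<in>config n S. (cmod (\<psi> () s c))\<^sup>2)"

text \<open>Besides the labels, the invariant records that every slot not holding a qubit is in
  state 0. \<open>apply_commit\<close> overwrites such a slot, and this condition makes the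
  overwriting norm preserving.\<close>

definition supported :: "nat \<Rightarrow> (party \<Rightarrow> reg set) \<Rightarrow> (nat \<Rightarrow> slot) \<Rightarrow> unit wave \<Rightarrow> bool" where
  "supported n S st \<psi> \<longleftrightarrow> (\<forall>s c. \<psi> () s c \<noteq> 0 \<longrightarrow>
     (\<forall>p. s p \<in> S p) \<and> c \<in> mem_labels n \<and> (\<forall>i<n. (\<forall>q. st i \<noteq> Held q) \<longrightarrow> c ! i = 0))"

lemma supportedD:
  assumes "supported n S st \<psi>" "\<psi> () s c \<noteq> 0"
  shows "s p \<in> S p" "c \<in> mem_labels n" "i < n \<Longrightarrow> (\<And>q. st i \<noteq> Held q) \<Longrightarrow> c ! i = 0"
  using assms unfolding supported_def by blast+

definition mk :: "party \<Rightarrow> reg \<Rightarrow> reg \<Rightarrow> party \<Rightarrow> reg" where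
  "mk p a b = (\<lambda>q. if q = p then a else b)"

lemma mk_eta: "mk p (s p) (s (other p)) = s"
proof
  fix q show "mk p (s p) (s (other p)) q = s q" by (cases p; cases q) (simp_all add: mk_def)
qed

text \<open>Splits off the register of the acting party \<open>p\<close> as the innermost sum, on
  which an isometry of \<open>p\<close> acts for fixed remaining labels.\<close>

lemma sum_config:
  "(\<Sum>(s, c)\<in>config n S. f s c) = (\<Sum>b\<in>S (other p). \<Sum>c\<in>mem_labels n. \<Sum>a\<in>S p. f (mk p a b) c)"
proof -
  have "(\<Sum>(s, c)\<in>config n S. f s c) = (\<Sum>(b, c, a)\<in>S (other p) \<times> mem_labels n \<times> S p. f (mk p a b) c)"
    by (rule sum.reindex_bij_witness[where i = "\<lambda>(b, c, a). (mk p a b, c)" and j = "\<lambda>(s, c). (s (other p), c, s p)"])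
       (auto simp: config_def mk_eta all_party[of _ p], simp_all add: mk_def)
  then show ?thesis by (simp add: sum.cartesian_product)
qed

lemma finite_config:
  assumes "\<And>p. finite (S p)" shows "finite (config n S)"
proof -
  have "config n S \<subseteq> (\<lambda>(a, b, c). (mk Alice a b, c)) ` (S Alice \<times> S Bob \<times> mem_labels n)"
  proof clarify
    fix s c assume "(s, c) \<in> config n S"
    then show "(s, c) \<in> (\<lambda>(a, b, c). (mk Alice a b, c)) ` (S Alice \<times> S Bob \<times> mem_labels n)"
      by (intro image_eqI[of _ _ "(s Alice, s Bob, c)"]) (auto simp: config_def mk_def fun_eq_iff intro: party.exhaust)
  qed
  then show ?thesis using assms by (meson finite_SigmaI finite_imageI finite_mem_labels finite_subset)
qed

text \<open>A bijection between the supports is enough. The label sets after sending, committing or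
  opening are in general only upper bounds, so moving a register need not be a bijection between the
  full sets.\<close>

lemma sum_transport:
  assumes "finite A" "finite B"
    and "\<And>x. x \<in> A \<Longrightarrow> f x \<noteq> 0 \<Longrightarrow> i x \<in> B \<and> j (i x) = x"
    and "\<And>y. y \<in> B \<Longrightarrow> g y \<noteq> 0 \<Longrightarrow> j y \<in> A \<and> i (j y) = y"
    and "\<And>x. x \<in> A \<Longrightarrow> f x \<noteq> 0 \<Longrightarrow> g (i x) = f x" "\<And>y. y \<in> B \<Longrightarrow> g y \<noteq> 0 \<Longrightarrow> f (j y) = g y"
  shows "sum f A = sum g B"
proof -
  have "sum f A = sum f {x \<in> A. f x \<noteq> 0}" using assms(1) by (intro sum.mono_neutral_right) auto
  also have "\<dots> = sum g {y \<in> B. g y \<noteq> 0}"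
    by (rule sum.reindex_bij_witness[where i = j and j = i]) (use assms in auto)
  also have "\<dots> = sum g B" using assms(2) by (intro sum.mono_neutral_left) auto
  finally show ?thesis .
qed

lemma local_step:
  assumes fin: "\<And>q. finite (S q)" and T: "finite T" and V: "isometry (S p) T V" and \<psi>: "supported n S st \<psi>"
  shows "supported n (S(p := T)) st (apply_local p (S p) T (\<lambda>_. V) \<psi>)"
    and "wnorm n (S(p := T)) (apply_local p (S p) T (\<lambda>_. V) \<psi>) = wnorm n S \<psi>"
proof -
  let ?\<psi> = "apply_local p (S p) T (\<lambda>_. V) \<psi>"
  show "supported n (S(p := T)) st ?\<psi>"
    unfolding supported_def
  proof (intro allI impI)
    fix s c assume nz: "?\<psi> () s c \<noteq> 0"
    then have sT: "s p \<in> T" and "(\<Sum>a\<in>S p. V (s p) a * \<psi> () (s(p := a)) c) \<noteq> 0"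
      by (auto simp: apply_local_def split: if_splits)
    then obtain a where a: "\<psi> () (s(p := a)) c \<noteq> 0"
      by (metis (no_types, lifting) mult_zero_right sum.neutral)
    have "s q \<in> S q" if "q \<noteq> p" for q using supportedD(1)[OF \<psi> a, of q] that by simp
    then show "(\<forall>q. s q \<in> (S(p := T)) q) \<and> c \<in> mem_labels n \<and> (\<forall>i<n. (\<forall>q. st i \<noteq> Held q) \<longrightarrow> c ! i = 0)"
      using supportedD(2,3)[OF \<psi> a] sT by auto
  qed
  have iso: "(\<Sum>b\<in>T. (cmod (\<Sum>a\<in>S p. V b a * v a))\<^sup>2) = (\<Sum>a\<in>S p. (cmod (v a))\<^sup>2)" for v
  proof -
    have "complex_of_real (\<Sum>b\<in>T. (cmod (\<Sum>a\<in>S p. V b a * v a))\<^sup>2)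
      = (\<Sum>b\<in>T. \<Sum>a\<in>S p. \<Sum>a'\<in>S p. (V b a * v a) * cnj (V b a' * v a'))"
      unfolding of_real_sum complex_norm_square by (simp only: cnj_sum sum_product)
    also have "\<dots> = (\<Sum>a\<in>S p. \<Sum>a'\<in>S p. \<Sum>b\<in>T. (V b a * v a) * cnj (V b a' * v a'))"
      by (rule trans[OF sum.swap], rule sum.cong[OF refl], rule sum.swap)
    also have "\<dots> = (\<Sum>a\<in>S p. \<Sum>a'\<in>S p. (\<Sum>b\<in>T. cnj (V b a') * V b a) * (v a * cnj (v a')))"
      unfolding sum_distrib_right by (simp add: mult_ac)
    also have "\<dots> = (\<Sum>a\<in>S p. \<Sum>a'\<in>S p. if a' = a then v a * cnj (v a) else 0)"
      using V by (intro sum.cong refl) (auto simp: isometry_def)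
    also have "\<dots> = (\<Sum>a\<in>S p. v a * cnj (v a))"
      using fin by simp
    also have "\<dots> = complex_of_real (\<Sum>a\<in>S p. (cmod (v a))\<^sup>2)"
      unfolding of_real_sum complex_norm_square ..
    finally show ?thesis unfolding of_real_eq_iff .
  qed
  have mk: "(mk p a b)(p := a') = mk p a' b" "mk p a b p = a" for a a' b
    by (auto simp: mk_def)
  have "wnorm n (S(p := T)) ?\<psi> = (\<Sum>b\<in>S (other p). \<Sum>c\<in>mem_labels n. \<Sum>a\<in>T. (cmod (\<Sum>a'\<in>S p. V a a' * \<psi> () (mk p a' b) c))\<^sup>2)"
    unfolding wnorm_def sum_config[of _ _ "S(p := T)" p] by (simp add: apply_local_def mk)
  also have "\<dots> = wnorm n S \<psi>"
    unfolding wnorm_def sum_config[of _ _ S p] iso ..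
  finally show "wnorm n (S(p := T)) ?\<psi> = wnorm n S \<psi>" .
qed

lemma finite_cons_labels: "finite M \<Longrightarrow> finite S \<Longrightarrow> finite (cons_labels M S)"
  unfolding cons_labels_def by (rule finite_subset[of _ "(\<lambda>(m, a). m # a) ` (M \<times> S)"]) auto

lemma send_step:
  assumes fin: "\<And>q. finite (S q)" and ne: "[] \<notin> S p" and \<psi>: "supported n S st \<psi>"
  shows "finite (send_labels p S q)" and "supported n (send_labels p S) st (apply_send p \<psi>)"
    and "wnorm n (send_labels p S) (apply_send p \<psi>) = wnorm n S \<psi>"
proof -
  show fin': "finite (send_labels p S q)" for q
    using fin by (simp add: send_labels_def finite_cons_labels)
  have sup: "(\<forall>q. s q \<in> send_labels p S q) \<and> c \<in> mem_labels n \<and> (\<forall>i<n. (\<forall>q. st i \<noteq> Held q) \<longrightarrow> c ! i = 0)"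
    and mb: "\<exists>m b. s (other p) = m # b" if nz: "apply_send p \<psi> () s c \<noteq> 0" for s c
  proof -
    obtain m b where mb: "s (other p) = m # b" and nz': "\<psi> () (s(p := m # s p, other p := b)) c \<noteq> 0"
      using nz by (auto simp: apply_send_def split: list.splits)
    have "m # s p \<in> S p" "b \<in> S (other p)"
      using supportedD(1)[OF \<psi> nz', of p] supportedD(1)[OF \<psi> nz', of "other p"] by simp_all
    then have "s p \<in> tl ` S p" "s (other p) \<in> cons_labels (hd ` S p) (S (other p))"
      using mb by (force simp: cons_labels_def image_iff)+
    then have "\<forall>q. s q \<in> send_labels p S q"
      by (simp add: all_party[of _ p] send_labels_def)
    then show "(\<forall>q. s q \<in> send_labels p S q) \<and> c \<in> mem_labels n \<and> (\<forall>i<n. (\<forall>q. st i \<noteq> Held q) \<longrightarrow> c ! i = 0)"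
      using supportedD(2,3)[OF \<psi> nz'] by simp
    show "\<exists>m b. s (other p) = m # b" using mb by blast
  qed
  show "supported n (send_labels p S) st (apply_send p \<psi>)"
    using sup unfolding supported_def by blast
  define i where "i = (\<lambda>(s :: party \<Rightarrow> reg, c :: mem). (s(p := tl (s p), other p := hd (s p) # s (other p)), c))"
  define j where "j = (\<lambda>(s :: party \<Rightarrow> reg, c :: mem). (s(p := hd (s (other p)) # s p, other p := tl (s (other p))), c))"
  have "wnorm n S \<psi> = wnorm n (send_labels p S) (apply_send p \<psi>)"
    unfolding wnorm_def
  proof (rule sum_transport[where i = i and j = j, OF finite_config[OF fin] finite_config[OF fin']]; clarify)
    fix s c assume sc: "(s, c) \<in> config n S"
    then have "s p \<in> S p" by (simp add: config_def)
    then have "s p \<noteq> []" using ne by metis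
    then have s: "s p = hd (s p) # tl (s p)" by simp
    have ji: "j (i (s, c)) = (s, c)"
      using s by (auto simp: i_def j_def fun_eq_iff all_party[of _ p])
    have ap: "apply_send p \<psi> () (fst (i (s, c))) (snd (i (s, c))) = \<psi> () s c"
      using s by (auto simp: apply_send_def i_def intro!: arg_cong[where f = "\<lambda>s. \<psi> () s c"] simp: fun_eq_iff all_party[of _ p])
    show "(case i (s, c) of (s, c) \<Rightarrow> (cmod (apply_send p \<psi> () s c))\<^sup>2) = (cmod (\<psi> () s c))\<^sup>2"
      using ap by (simp add: case_prod_beta)
    assume "(cmod (\<psi> () s c))\<^sup>2 \<noteq> 0"
    then have "apply_send p \<psi> () (fst (i (s, c))) (snd (i (s, c))) \<noteq> 0" using ap by simp
    from sup[OF this] ji show "i (s, c) \<in> config n (send_labels p S) \<and> j (i (s, c)) = (s, c)"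
      by (simp add: mem_config)
  next
    fix s c assume nz: "(cmod (apply_send p \<psi> () s c))\<^sup>2 \<noteq> 0"
    then obtain m b where mb: "s (other p) = m # b" using mb[of s c] by auto
    have ij: "i (j (s, c)) = (s, c)"
      using mb by (auto simp: i_def j_def fun_eq_iff all_party[of _ p])
    have ap: "\<psi> () (fst (j (s, c))) (snd (j (s, c))) = apply_send p \<psi> () s c"
      using mb by (simp add: apply_send_def j_def)
    show "(case j (s, c) of (s, c) \<Rightarrow> (cmod (\<psi> () s c))\<^sup>2) = (cmod (apply_send p \<psi> () s c))\<^sup>2"
      using ap by (simp add: case_prod_beta)
    have "\<psi> () (fst (j (s, c))) (snd (j (s, c))) \<noteq> 0" using ap nz by simp
    from supportedD(1,2)[OF \<psi> this] ij show "j (s, c) \<in> config n S \<and> i (j (s, c)) = (s, c)"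
      by (simp add: mem_config)
  qed
  then show "wnorm n (send_labels p S) (apply_send p \<psi>) = wnorm n S \<psi>" ..
qed

lemma commit_step:
  assumes fin: "\<And>q. finite (S q)" and ne: "[] \<notin> S p" and \<psi>: "supported n S st \<psi>"
    and i: "i < n" "st i = Fresh" and hd: "hd ` S p \<subseteq> {0, 1}"
  shows "finite (commit_labels p S q)" and "supported n (commit_labels p S) (st(i := Held p)) (apply_commit p i \<psi>)"
    and "wnorm n (commit_labels p S) (apply_commit p i \<psi>) = wnorm n S \<psi>"
proof -
  show fin': "finite (commit_labels p S q)" for q
    using fin by (simp add: commit_labels_def)
  have len: "c \<in> mem_labels n \<Longrightarrow> length c = n" for c by (simp add: mem_labels_def)
  have sup: "(\<forall>q. s q \<in> commit_labels p S q) \<and> c \<in> mem_labels n \<and> (\<forall>k<n. (\<forall>q. (st(i := Held p)) k \<noteq> Held q) \<longrightarrow> c ! k = 0)"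
    if nz: "apply_commit p i \<psi> () s c \<noteq> 0" for s c
  proof -
    have nz': "\<psi> () (s(p := c ! i # s p)) (c[i := 0]) \<noteq> 0" using nz by (simp add: apply_commit_def)
    note D = supportedD[OF \<psi> nz']
    have "c ! i # s p \<in> S p" using D(1)[of p] by simp
    then have sp: "s p \<in> tl ` S p" and ci: "c ! i \<in> {0, 1}" using hd by (force simp: image_iff)+
    have "\<forall>q. s q \<in> commit_labels p S q"
      using sp D(1)[of "other p"] by (simp add: all_party[of _ p] commit_labels_def)
    moreover have "c \<in> mem_labels n"
      using mem_update[OF D(2) ci, of i] by simp
    moreover have "c ! k = 0" if k: "k < n" "\<And>q. (st(i := Held p)) k \<noteq> Held q" for k
    proof -
      have "k \<noteq> i" using k(2)[of p] by auto
      then show ?thesis using D(3)[OF k(1)] k(2) by simp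
    qed
    ultimately show ?thesis by blast
  qed
  show "supported n (commit_labels p S) (st(i := Held p)) (apply_commit p i \<psi>)"
    using sup unfolding supported_def by blast
  define f where "f = (\<lambda>(s :: party \<Rightarrow> reg, c :: mem). (s(p := tl (s p)), c[i := hd (s p)]))"
  define g where "g = (\<lambda>(s :: party \<Rightarrow> reg, c :: mem). (s(p := c ! i # s p), c[i := 0]))"
  have "wnorm n S \<psi> = wnorm n (commit_labels p S) (apply_commit p i \<psi>)"
    unfolding wnorm_def
  proof (rule sum_transport[where i = f and j = g, OF finite_config[OF fin] finite_config[OF fin']]; clarify)
    fix s c assume sc: "(s, c) \<in> config n S" and nz: "(cmod (\<psi> () s c))\<^sup>2 \<noteq> 0"
    then have "s p \<in> S p" and c: "length c = n" by (simp_all add: config_def len)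
    then have "s p \<noteq> []" using ne by metis
    then have s: "s p = hd (s p) # tl (s p)" by simp
    \<comment> \<open>A fresh slot holds 0, so resetting it on the way back restores the old
      memory.\<close>
    have c0: "c ! i = 0" using supportedD(3)[OF \<psi> _ i(1), of s c] nz i by simp
    have ji: "g (f (s, c)) = (s, c)"
      using s c c0 i by (auto simp: f_def g_def) (metis list_update_id)
    have ap: "apply_commit p i \<psi> () (fst (f (s, c))) (snd (f (s, c))) = \<psi> () s c"
      using ji by (simp add: apply_commit_def f_def g_def)
    show "(case f (s, c) of (s, c) \<Rightarrow> (cmod (apply_commit p i \<psi> () s c))\<^sup>2) = (cmod (\<psi> () s c))\<^sup>2"
      using ap by (simp add: case_prod_beta)
    have "apply_commit p i \<psi> () (fst (f (s, c))) (snd (f (s, c))) \<noteq> 0" using ap nz by simp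
    from sup[OF this] ji show "f (s, c) \<in> config n (commit_labels p S) \<and> g (f (s, c)) = (s, c)"
      by (simp add: mem_config)
  next
    fix s c assume sc: "(s, c) \<in> config n (commit_labels p S)" and nz: "(cmod (apply_commit p i \<psi> () s c))\<^sup>2 \<noteq> 0"
    have ij: "f (g (s, c)) = (s, c)"
      using sc i by (auto simp: f_def g_def config_def)
    have ap: "\<psi> () (fst (g (s, c))) (snd (g (s, c))) = apply_commit p i \<psi> () s c"
      by (simp add: apply_commit_def g_def)
    show "(case g (s, c) of (s, c) \<Rightarrow> (cmod (\<psi> () s c))\<^sup>2) = (cmod (apply_commit p i \<psi> () s c))\<^sup>2"
      using ap by (simp add: case_prod_beta)
    have "\<psi> () (fst (g (s, c))) (snd (g (s, c))) \<noteq> 0" using ap nz by simp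
    from supportedD(1,2)[OF \<psi> this] ij show "g (s, c) \<in> config n S \<and> f (g (s, c)) = (s, c)"
      by (simp add: mem_config)
  qed
  then show "wnorm n (commit_labels p S) (apply_commit p i \<psi>) = wnorm n S \<psi>" ..
qed

lemma open_step:
  assumes fin: "\<And>q. finite (S q)" and \<psi>: "supported n S st \<psi>" and i: "i < n"
  shows "finite (open_labels p S q)" and "supported n (open_labels p S) (st(i := Opened)) (apply_open p i \<psi>)"
    and "wnorm n (open_labels p S) (apply_open p i \<psi>) = wnorm n S \<psi>"
proof -
  show fin': "finite (open_labels p S q)" for q
    using fin by (simp add: open_labels_def finite_cons_labels)
  have len: "c \<in> mem_labels n \<Longrightarrow> length c = n" for c by (simp add: mem_labels_def)
  have shape: "\<exists>m b. s (other p) = m # b \<and> c ! i = 0 \<and> \<psi> () (s(other p := b)) (c[i := m]) \<noteq> 0"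
    if "apply_open p i \<psi> () s c \<noteq> 0" for s c
    using that by (auto simp: apply_open_def split: list.splits if_splits)
  have sup: "(\<forall>q. s q \<in> open_labels p S q) \<and> c \<in> mem_labels n \<and> (\<forall>k<n. (\<forall>q. (st(i := Opened)) k \<noteq> Held q) \<longrightarrow> c ! k = 0)"
    if nz: "apply_open p i \<psi> () s c \<noteq> 0" for s c
  proof -
    obtain m b where mb: "s (other p) = m # b" and c0: "c ! i = 0" and nz': "\<psi> () (s(other p := b)) (c[i := m]) \<noteq> 0"
      using shape[OF nz] by blast
    note D = supportedD[OF \<psi> nz']
    have "length c = n" using len[OF D(2)] by simp
    then have m: "m \<in> {0, 1}" using mem_nth[OF D(2) i] i by simp
    have "\<forall>q. s q \<in> open_labels p S q"
      using mb m D(1)[of p] D(1)[of "other p"] by (auto simp: all_party[of _ p] open_labels_def cons_labels_def)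
    moreover have "c \<in> mem_labels n"
      using mem_update[OF D(2), of 0 i] c0 by (metis insertI1 list_update_id list_update_overwrite)
    \<comment> \<open>The opened slot itself is covered by the test \<open>c ! i = 0\<close> in
      \<open>apply_open\<close>.\<close>
    moreover have "c ! k = 0" if k: "k < n" "\<And>q. (st(i := Opened)) k \<noteq> Held q" for k
      using D(3)[OF k(1)] k(2) c0 by (cases "k = i") simp_all
    ultimately show ?thesis by blast
  qed
  show "supported n (open_labels p S) (st(i := Opened)) (apply_open p i \<psi>)"
    using sup unfolding supported_def by blast
  define f where "f = (\<lambda>(s :: party \<Rightarrow> reg, c :: mem). (s(other p := c ! i # s (other p)), c[i := 0]))"
  define g where "g = (\<lambda>(s :: party \<Rightarrow> reg, c :: mem). (s(other p := tl (s (other p))), c[i := hd (s (other p))]))"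
  have "wnorm n S \<psi> = wnorm n (open_labels p S) (apply_open p i \<psi>)"
    unfolding wnorm_def
  proof (rule sum_transport[where i = f and j = g, OF finite_config[OF fin] finite_config[OF fin']]; clarify)
    fix s c assume sc: "(s, c) \<in> config n S" and nz: "(cmod (\<psi> () s c))\<^sup>2 \<noteq> 0"
    have c: "length c = n" using sc by (simp add: config_def len)
    have ji: "g (f (s, c)) = (s, c)"
      using c i by (auto simp: f_def g_def)
    have ap: "apply_open p i \<psi> () (fst (f (s, c))) (snd (f (s, c))) = \<psi> () s c"
      using c i by (simp add: apply_open_def f_def)
    show "(case f (s, c) of (s, c) \<Rightarrow> (cmod (apply_open p i \<psi> () s c))\<^sup>2) = (cmod (\<psi> () s c))\<^sup>2"
      using ap by (simp add: case_prod_beta)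
    have "apply_open p i \<psi> () (fst (f (s, c))) (snd (f (s, c))) \<noteq> 0" using ap nz by simp
    from sup[OF this] ji show "f (s, c) \<in> config n (open_labels p S) \<and> g (f (s, c)) = (s, c)"
      by (simp add: mem_config)
  next
    fix s c assume sc: "(s, c) \<in> config n (open_labels p S)" and nz: "(cmod (apply_open p i \<psi> () s c))\<^sup>2 \<noteq> 0"
    have nz0: "apply_open p i \<psi> () s c \<noteq> 0" using nz by simp
    obtain m b where mb: "s (other p) = m # b" and c0: "c ! i = 0"
      using shape[OF nz0] by blast
    have c: "length c = n" using sc by (simp add: config_def len)
    have ij: "f (g (s, c)) = (s, c)"
      using mb c c0 i by (auto simp: f_def g_def) (metis list_update_id)
    have ap: "\<psi> () (fst (g (s, c))) (snd (g (s, c))) = apply_open p i \<psi> () s c"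
      using mb c0 by (simp add: apply_open_def g_def)
    show "(case g (s, c) of (s, c) \<Rightarrow> (cmod (\<psi> () s c))\<^sup>2) = (cmod (apply_open p i \<psi> () s c))\<^sup>2"
      using ap by (simp add: case_prod_beta)
    have "\<psi> () (fst (g (s, c))) (snd (g (s, c))) \<noteq> 0" using ap nz by simp
    from supportedD(1,2)[OF \<psi> this] ij show "g (s, c) \<in> config n S \<and> f (g (s, c)) = (s, c)"
      by (simp add: mem_config)
  qed
  then show "wnorm n (open_labels p S) (apply_open p i \<psi>) = wnorm n S \<psi>" ..
qed

text \<open>A measurement conserves the norm only in total: the labels of \<open>p\<close> are
  partitioned by their first register, and each outcome keeps one class.\<close>

lemma announce_step:
  assumes fin: "\<And>q. finite (S q)" and ne: "[] \<notin> S p" and \<psi>: "supported n S st \<psi>"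
  shows "finite (announce_labels p m S q)" and "supported n (announce_labels p m S) st (apply_announce p m \<psi>)"
    and "(\<Sum>m\<in>hd ` S p. wnorm n (announce_labels p m S) (apply_announce p m \<psi>)) = wnorm n S \<psi>"
proof -
  have finA: "finite {a. m # a \<in> S p}" for m
    using finite_vimageI[OF fin[of p], of "(#) m"] by (simp add: vimage_def)
  then show "finite (announce_labels p m S q)"
    using fin by (simp add: announce_labels_def)
  show "supported n (announce_labels p m S) st (apply_announce p m \<psi>)"
    unfolding supported_def
  proof (intro allI impI)
    fix s c assume "apply_announce p m \<psi> () s c \<noteq> 0"
    then have nz: "\<psi> () (s(p := m # s p)) c \<noteq> 0" by (simp add: apply_announce_def)
    have "\<forall>q. s q \<in> announce_labels p m S q"
      using supportedD(1)[OF \<psi> nz, of p] supportedD(1)[OF \<psi> nz, of "other p"]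
      by (simp add: all_party[of _ p] announce_labels_def)
    then show "(\<forall>q. s q \<in> announce_labels p m S q) \<and> c \<in> mem_labels n \<and> (\<forall>i<n. (\<forall>q. st i \<noteq> Held q) \<longrightarrow> c ! i = 0)"
      using supportedD(2,3)[OF \<psi> nz] by blast
  qed
  have sum_hd: "(\<Sum>a\<in>S p. f a) = (\<Sum>m\<in>hd ` S p. \<Sum>a | m # a \<in> S p. f (m # a))" for f :: "reg \<Rightarrow> real"
  proof -
    have "(\<Sum>a\<in>S p. f a) = (\<Sum>(m, a)\<in>Sigma (hd ` S p) (\<lambda>m. {a. m # a \<in> S p}). f (m # a))"
    proof (rule sum.reindex_bij_witness[where i = "\<lambda>(m, a). m # a" and j = "\<lambda>a. (hd a, tl a)"])
      fix a assume a: "a \<in> S p"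
      then have "a \<noteq> []" using ne by metis
      then show "(case (hd a, tl a) of (m, a) \<Rightarrow> m # a) = a" "(hd a, tl a) \<in> Sigma (hd ` S p) (\<lambda>m. {a. m # a \<in> S p})"
        "(case (hd a, tl a) of (m, a) \<Rightarrow> f (m # a)) = f a"
        using a by auto
    qed auto
    then show ?thesis using fin finA by (simp add: sum.Sigma)
  qed
  have mk: "(mk p a b)(p := m # mk p a b p) = mk p (m # a) b" for a b m
    by (auto simp: mk_def)
  have "(\<Sum>m\<in>hd ` S p. wnorm n (announce_labels p m S) (apply_announce p m \<psi>))
    = (\<Sum>m\<in>hd ` S p. \<Sum>b\<in>S (other p). \<Sum>c\<in>mem_labels n. \<Sum>a | m # a \<in> S p. (cmod (\<psi> () (mk p (m # a) b) c))\<^sup>2)"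
    unfolding wnorm_def sum_config[of _ _ "announce_labels p m S" p for m]
    by (simp add: announce_labels_def apply_announce_def mk)
  also have "\<dots> = (\<Sum>b\<in>S (other p). \<Sum>c\<in>mem_labels n. \<Sum>m\<in>hd ` S p. \<Sum>a | m # a \<in> S p. (cmod (\<psi> () (mk p (m # a) b) c))\<^sup>2)"
    by (rule trans[OF sum.swap], rule sum.cong[OF refl], rule sum.swap)
  also have "\<dots> = wnorm n S \<psi>"
    unfolding wnorm_def sum_config[of _ _ S p] sum_hd ..
  finally show "(\<Sum>m\<in>hd ` S p. wnorm n (announce_labels p m S) (apply_announce p m \<psi>)) = wnorm n S \<psi>" .
qed

section \<open>Support and norm at the end of a protocol\<close>

definition final_config :: "nat \<Rightarrow> protocol \<Rightarrow> (party \<Rightarrow> reg set) \<Rightarrow> (transcript \<times> (party \<Rightarrow> reg) \<times> mem) set" where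
  "final_config n P S = {(t, s, c). (\<forall>q. (t, s q) \<in> final_labels P S q) \<and> c \<in> mem_labels n}"

text \<open>The three facts are bundled for one induction over the protocol. The last one sums over
  all transcripts: their probabilities add up to the initial squared norm.\<close>

definition final_ok :: "nat \<Rightarrow> bool list \<Rightarrow> protocol \<Rightarrow> (party \<Rightarrow> reg set) \<Rightarrow> unit wave \<Rightarrow> bool" where
  "final_ok n x P S \<psi> \<longleftrightarrow> (\<forall>q. finite (final_labels P S q)) \<and>
     (\<forall>t s c. run (\<lambda>_. x) P t \<psi> () s c \<noteq> 0 \<longrightarrow> (t, s, c) \<in> final_config n P S) \<and>
     (\<Sum>(t, s, c)\<in>final_config n P S. (cmod (run (\<lambda>_. x) P t \<psi> () s c))\<^sup>2) = wnorm n S \<psi>"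

lemma finite_final_config:
  assumes "\<And>q. finite (final_labels P S q)" shows "finite (final_config n P S)"
proof -
  have "final_config n P S \<subseteq> (\<lambda>((t, a), (u, b), c). (t, mk Alice a b, c)) ` (final_labels P S Alice \<times> final_labels P S Bob \<times> mem_labels n)"
  proof clarify
    fix t s c assume "(t, s, c) \<in> final_config n P S"
    then show "(t, s, c) \<in> (\<lambda>((t, a), (u, b), c). (t, mk Alice a b, c)) ` (final_labels P S Alice \<times> final_labels P S Bob \<times> mem_labels n)"
      by (intro image_eqI[of _ _ "((t, s Alice), (t, s Bob), c)"])
         (use mk_eta[of Alice s] in \<open>auto simp: final_config_def\<close>)
  qed
  then show ?thesis using assms by (meson finite_SigmaI finite_imageI finite_mem_labels finite_subset)
qed

text \<open>That held slots lie below \<open>n\<close> is an invariant of \<open>valid\<close>: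
  \<open>Commit\<close> checks the bound and \<open>Open\<close> inherits it.\<close>

lemma run_final_ok:
  assumes "valid n l P S st" "\<And>q. finite (S q)" "supported n S st \<psi>" "\<And>i q. st i = Held q \<Longrightarrow> i < n" "x \<in> bits l"
  shows "final_ok n x P S \<psi>"
  using assms
proof (induction P arbitrary: S st \<psi>)
  case Done
  have fc: "final_config n Done S = {[]} \<times> config n S"
    by (auto simp: final_config_def config_def)
  have "finite (final_labels Done S q)" for q using Done(2) by simp
  moreover have "(t, s, c) \<in> final_config n Done S" if "run (\<lambda>_. x) Done t \<psi> () s c \<noteq> 0" for t s c
  proof -
    have "t = []" "\<psi> () s c \<noteq> 0" using that by (auto split: if_splits)
    then show ?thesis using Done(3) unfolding fc supported_def config_def by blast
  qed
  moreover have "(\<Sum>(t, s, c)\<in>final_config n Done S. (cmod (run (\<lambda>_. x) Done t \<psi> () s c))\<^sup>2) = wnorm n S \<psi>"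
    unfolding fc sum_Times wnorm_def by (simp add: case_prod_beta)
  ultimately show ?case unfolding final_ok_def by blast
next
  case (AliceOp S1 T V P)
  have v: "S1 = S Alice" "finite T" "isometry (S Alice) T (V x)" "valid n l P (S(Alice := T)) st"
    using AliceOp.prems(1,5) by auto
  note step = local_step[OF AliceOp.prems(2) v(2,3) AliceOp.prems(3)]
  have "final_ok n x P (S(Alice := T)) (apply_local Alice (S Alice) T (\<lambda>_. V x) \<psi>)"
    using v AliceOp.prems by (intro AliceOp.IH[OF v(4) _ step(1)]) auto
  then show ?case by (simp add: final_ok_def final_config_def step(2) v)
next
  case (BobOp S1 T V P)
  have v: "S1 = S Bob" "finite T" "isometry (S Bob) T V" "valid n l P (S(Bob := T)) st"
    using BobOp.prems(1,5) by auto
  note step = local_step[OF BobOp.prems(2) v(2,3) BobOp.prems(3)]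
  have "final_ok n x P (S(Bob := T)) (apply_local Bob (S Bob) T (\<lambda>_. V) \<psi>)"
    using v BobOp.prems by (intro BobOp.IH[OF v(4) _ step(1)]) auto
  then show ?case by (simp add: final_ok_def final_config_def step(2) v)
next
  case (Send p P)
  have v: "[] \<notin> S p" "valid n l P (send_labels p S) st" using Send.prems(1) by auto
  note step = send_step[OF Send.prems(2) v(1) Send.prems(3)]
  have "final_ok n x P (send_labels p S) (apply_send p \<psi>)"
    by (rule Send.IH[OF v(2) step(1,2) Send.prems(4,5)])
  then show ?case by (simp add: final_ok_def final_config_def step(3))
next
  case (Commit p i P)
  have v: "i < n" "st i = Fresh" "[] \<notin> S p" "hd ` S p \<subseteq> {0, 1}" "valid n l P (commit_labels p S) (st(i := Held p))"
    using Commit.prems(1) by auto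
  note step = commit_step[OF Commit.prems(2) v(3) Commit.prems(3) v(1,2,4)]
  have "final_ok n x P (commit_labels p S) (apply_commit p i \<psi>)"
    by (rule Commit.IH[OF v(5) step(1,2) _ Commit.prems(5)]) (use v(1) Commit.prems(4) in \<open>auto split: if_splits\<close>)
  then show ?case by (simp add: final_ok_def final_config_def step(3))
next
  case (Open p i P)
  have v: "st i = Held p" "valid n l P (open_labels p S) (st(i := Opened))"
    using Open.prems(1) by auto
  note step = open_step[OF Open.prems(2,3) Open.prems(4)[OF v(1)]]
  have "final_ok n x P (open_labels p S) (apply_open p i \<psi>)"
    by (rule Open.IH[OF v(2) step(1,2) _ Open.prems(5)]) (use Open.prems(4) in \<open>auto split: if_splits\<close>)
  then show ?case by (simp add: final_ok_def final_config_def step(3))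
next
  case (Announce p P)
  let ?M = "hd ` S p"
  have v: "[] \<notin> S p" "\<And>m. m \<in> ?M \<Longrightarrow> valid n l (P m) (announce_labels p m S) st"
    using Announce.prems(1) by auto
  note step = announce_step[OF Announce.prems(2) v(1) Announce.prems(3)]
  have ok: "final_ok n x (P m) (announce_labels p m S) (apply_announce p m \<psi>)" if "m \<in> ?M" for m
    by (rule Announce.IH[OF _ v(2)[OF that] step(1,2) Announce.prems(4,5)]) simp
  have fl: "(u, a) \<in> final_labels (Announce p P) S q \<longleftrightarrow>
      (\<exists>m t. u = m # t \<and> m \<in> ?M \<and> (t, a) \<in> final_labels (P m) (announce_labels p m S) q)" for u a q
    by force
  \<comment> \<open>Both parties record the same announced value, so the head of the transcript
    selects one branch for both.\<close>
  have fc: "(u, s, c) \<in> final_config n (Announce p P) S \<longleftrightarrow>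
      (\<exists>m t. u = m # t \<and> m \<in> ?M \<and> (t, s, c) \<in> final_config n (P m) (announce_labels p m S))" for u s c
    unfolding final_config_def mem_Collect_eq case_prod_conv fl by (cases u) auto
  have "finite (final_labels (Announce p P) S q)" for q
    using ok Announce.prems(2) by (auto simp: final_ok_def)
  moreover have "(u, s, c) \<in> final_config n (Announce p P) S" if nzu: "run (\<lambda>_. x) (Announce p P) u \<psi> () s c \<noteq> 0" for u s c
  proof -
    obtain m t where u: "u = m # t" and nz: "run (\<lambda>_. x) (P m) t (apply_announce p m \<psi>) () s c \<noteq> 0"
      using nzu by (cases u) auto
    \<comment> \<open>\<open>run\<close> accepts any number as outcome. A value that is not a first
      register of \<open>p\<close> has amplitude 0, and by linearity its branch contributes
      nothing.\<close>
    have m: "m \<in> ?M"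
    proof (rule ccontr)
      assume m: "m \<notin> ?M"
      have "\<psi> () (s(p := m # s p)) c = 0" for s c
      proof (rule ccontr)
        assume "\<psi> () (s(p := m # s p)) c \<noteq> 0"
        then have "m # s p \<in> S p" using supportedD(1)[OF Announce.prems(3), of _ _ p] by fastforce
        then show False using m by force
      qed
      then have "apply_announce p m \<psi> = (\<lambda>r s c. 0 * \<psi> r s c)"
        by (intro ext) (simp add: apply_announce_def)
      then have "run (\<lambda>_. x) (P m) t (apply_announce p m \<psi>) () s c = 0"
        by (simp only: run_scale) simp
      then show False using nz by simp
    qed
    show ?thesis unfolding fc using u m nz ok[OF m] by (auto simp: final_ok_def)
  qed
  moreover have "(\<Sum>(t, s, c)\<in>final_config n (Announce p P) S. (cmod (run (\<lambda>_. x) (Announce p P) t \<psi> () s c))\<^sup>2) = wnorm n S \<psi>"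
  proof -
    have "(\<Sum>(t, s, c)\<in>final_config n (Announce p P) S. (cmod (run (\<lambda>_. x) (Announce p P) t \<psi> () s c))\<^sup>2)
      = (\<Sum>(m, t, s, c)\<in>Sigma ?M (\<lambda>m. final_config n (P m) (announce_labels p m S)).
          (cmod (run (\<lambda>_. x) (P m) t (apply_announce p m \<psi>) () s c))\<^sup>2)"
      by (rule sum.reindex_bij_witness[where i = "\<lambda>(m, t, s, c). (m # t, s, c)" and j = "\<lambda>(u, s, c). (hd u, tl u, s, c)"])
         (auto simp: fc)
    also have "\<dots> = (\<Sum>m\<in>?M. \<Sum>(t, s, c)\<in>final_config n (P m) (announce_labels p m S).
          (cmod (run (\<lambda>_. x) (P m) t (apply_announce p m \<psi>) () s c))\<^sup>2)"
      using Announce.prems(2) ok by (intro sum.Sigma[symmetric]) (auto simp: final_ok_def intro!: finite_final_config)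
    also have "\<dots> = (\<Sum>m\<in>?M. wnorm n (announce_labels p m S) (apply_announce p m \<psi>))"
      using ok by (intro sum.cong refl) (simp add: final_ok_def)
    finally show ?thesis by (simp only: step(3))
  qed
  ultimately show ?case unfolding final_ok_def by blast
qed

section \<open>The state after the commit phase\<close>

text \<open>The state on input \<open>x\<close> as a matrix from Alice and the memory to Bob. The two copies of the
  transcript are superposed coherently here; tracing out either copy, or dephasing it, yields the
  state of the protocol.\<close>

definition commit_matrix ::
  "nat \<Rightarrow> commitment \<Rightarrow> bool list \<Rightarrow> transcript \<times> reg \<Rightarrow> (transcript \<times> reg) \<times> mem \<Rightarrow> complex" where
  "commit_matrix n \<Pi> x = (\<lambda>(u, b) ((t, a), c). of_bool (u = t) *
     run (\<lambda>_. x) (commit_phase \<Pi>) t (init_wave n \<Pi> (\<lambda>_. 1)) () (case_party a b) c)"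

lemma case_party_eta: "case_party (s Alice) (s Bob) = s"
proof
  fix q show "(case q of Alice \<Rightarrow> s Alice | Bob \<Rightarrow> s Bob) = s q" by (cases q) simp_all
qed

lemma commit_run_ok:
  assumes sc: "string_commitment n l \<Pi>" and x: "x \<in> bits l"
  shows "final_ok n x (commit_phase \<Pi>) (init_labels \<Pi>) (init_wave n \<Pi> (\<lambda>_. 1))"
    and "wnorm n (init_labels \<Pi>) (init_wave n \<Pi> (\<lambda>_. 1)) = 1"
proof -
  have fin: "\<And>p. finite (init_labels \<Pi> p)"
    and init: "\<And>a b. init_state \<Pi> a b \<noteq> 0 \<Longrightarrow> a \<in> init_labels \<Pi> Alice \<and> b \<in> init_labels \<Pi> Bob"
    and norm: "(\<Sum>a\<in>init_labels \<Pi> Alice. \<Sum>b\<in>init_labels \<Pi> Bob. (cmod (init_state \<Pi> a b))\<^sup>2) = 1"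
    and valid: "valid n l (commit_phase \<Pi>) (init_labels \<Pi>) (\<lambda>_. Fresh)"
    using sc valid_graft unfolding string_commitment_def full_protocol_def by blast+
  have zero: "replicate n 0 \<in> mem_labels n" by (auto simp: mem_labels_def)
  have "supported n (init_labels \<Pi>) (\<lambda>_. Fresh) (init_wave n \<Pi> (\<lambda>_. 1))"
    using init zero by (auto simp: supported_def init_wave_def all_party[of _ Alice] split: if_splits)
  then show "final_ok n x (commit_phase \<Pi>) (init_labels \<Pi>) (init_wave n \<Pi> (\<lambda>_. 1))"
    by (rule run_final_ok[OF valid fin _ _ x]) simp
  have "wnorm n (init_labels \<Pi>) (init_wave n \<Pi> (\<lambda>_. 1))
    = (\<Sum>b\<in>init_labels \<Pi> Bob. \<Sum>c\<in>mem_labels n. if c = replicate n 0 then \<Sum>a\<in>init_labels \<Pi> Alice. (cmod (init_state \<Pi> a b))\<^sup>2 else 0)"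
    unfolding wnorm_def sum_config[of _ _ _ Alice] other.simps
    by (intro sum.cong refl) (auto simp: init_wave_def mk_def)
  also have "\<dots> = (\<Sum>b\<in>init_labels \<Pi> Bob. \<Sum>a\<in>init_labels \<Pi> Alice. (cmod (init_state \<Pi> a b))\<^sup>2)"
    using zero by simp
  also have "\<dots> = 1" by (subst sum.swap) (rule norm)
  finally show "wnorm n (init_labels \<Pi>) (init_wave n \<Pi> (\<lambda>_. 1)) = 1" .
qed

text \<open>Norm 1 says that the probabilities of all transcripts add up to 1; the final
  configurations become rows and columns once the transcript is written into both.\<close>

lemma commit_matrix_facts:
  assumes sc: "string_commitment n l \<Pi>" and x: "x \<in> bits l"
  shows "finite (party_labels \<Pi> q)"
    and "commit_matrix n \<Pi> x \<in> mats (party_labels \<Pi> Bob) (party_labels \<Pi> Alice \<times> mem_labels n)"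
    and "hsn (party_labels \<Pi> Bob) (party_labels \<Pi> Alice \<times> mem_labels n) (commit_matrix n \<Pi> x) = 1"
proof -
  let ?LA = "party_labels \<Pi> Alice" and ?LB = "party_labels \<Pi> Bob" and ?C = "mem_labels n"
  let ?r = "\<lambda>t s c. run (\<lambda>_. x) (commit_phase \<Pi>) t (init_wave n \<Pi> (\<lambda>_::unit. 1)) () s c"
  let ?fc = "final_config n (commit_phase \<Pi>) (init_labels \<Pi>)"
  note ok = commit_run_ok(1)[OF sc x, unfolded final_ok_def commit_run_ok(2)[OF sc x]]
  show fin: "finite (party_labels \<Pi> q)" for q
    using ok by (simp add: party_labels_def)
  have supp: "(t, a) \<in> ?LA \<and> (t, b) \<in> ?LB \<and> c \<in> ?C" if "?r t (case_party a b) c \<noteq> 0" for t a b c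
  proof -
    have "(t, case_party a b, c) \<in> ?fc" using ok that by blast
    then show ?thesis by (auto simp: final_config_def party_labels_def all_party[of _ Alice])
  qed
  show "commit_matrix n \<Pi> x \<in> mats ?LB (?LA \<times> ?C)"
    unfolding mats_def commit_matrix_def using supp by (auto split: if_splits)
  have finfc: "finite ?fc" using ok by (intro finite_final_config) blast
  have finB: "finite (?LB \<times> ?LA \<times> ?C)" using fin by simp
  have "(\<Sum>(t, s, c)\<in>?fc. (cmod (?r t s c))\<^sup>2) = (\<Sum>(p, q)\<in>?LB \<times> ?LA \<times> ?C. (cmod (commit_matrix n \<Pi> x p q))\<^sup>2)"
    by (rule sum_transport[OF finfc finB, where i = "\<lambda>(t, s, c). ((t, s Bob), (t, s Alice), c)" and j = "\<lambda>((u, b), (t, a), c). (t, case_party a b, c)"])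
       (use supp in \<open>auto simp: commit_matrix_def case_party_eta final_config_def party_labels_def
          all_party[of _ Alice] split: if_splits\<close>)
  then have "(\<Sum>p\<in>?LB. \<Sum>q\<in>?LA \<times> ?C. (cmod (commit_matrix n \<Pi> x p q))\<^sup>2) = 1"
    using ok by (simp add: sum.cartesian_product)
  then show "hsn ?LB (?LA \<times> ?C) (commit_matrix n \<Pi> x) = 1"
    by (simp only: hsn_def real_sqrt_one)
qed

lemma rho_XB_commit_matrix:
  "rho_XB n l \<Pi> (x, p) (y, q) = of_bool (x = y) *
     mmul (party_labels \<Pi> Alice \<times> mem_labels n) (commit_matrix n \<Pi> x) (adj (commit_matrix n \<Pi> x)) p q / 2 ^ l"
proof -
  have "joint_opr (\<lambda>t. run (\<lambda>_. x) (commit_phase \<Pi>) t (init_wave n \<Pi> (\<lambda>_::unit. 1))) (((), a), p, c) (((), a), q, c)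
    = commit_matrix n \<Pi> x p (a, c) * cnj (commit_matrix n \<Pi> x q (a, c))" for a c
    by (auto simp: joint_opr_def commit_matrix_def split: prod.split)
  then show ?thesis
    by (simp add: rho_XB_def rho_XABC_def rho_input_def mmul_def adj_def sum_Times sum_distrib_left sum_divide_distrib)
qed

text \<open>Rows belong to Bob and the memory, columns to all that Alice holds, the layout expected
  by \<open>uhlmann\<close>.\<close>

definition superposed_matrix ::
  "nat \<Rightarrow> commitment \<Rightarrow> bool list set \<Rightarrow> (transcript \<times> reg) \<times> mem \<Rightarrow> (bool list \<times> bool list) \<times> transcript \<times> reg \<Rightarrow> complex" where
  "superposed_matrix n \<Pi> X = (\<lambda>(p, c) ((x, x'), a).
     of_bool (x = x' \<and> x \<in> X) / complex_of_real (sqrt (real (card X))) * commit_matrix n \<Pi> x p (a, c))"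

text \<open>Dephasing Bob's copy of the transcript is enough, because the matrix vanishes unless
  Alice's copy agrees. \<open>run_pointwise\<close> and \<open>run_scale\<close> reduce the
  superposed run to the runs on single inputs.\<close>

lemma rho_superposed_dephased:
  "rho_superposed n \<Pi> X = dephased (\<lambda>(p, c). fst p) (superposed_matrix n \<Pi> X)"
proof -
  define \<phi> where "\<phi> = (\<lambda>(x, x'). of_bool (x = x' \<and> x \<in> X) / complex_of_real (sqrt (real (card X))))"
  have run: "run fst (commit_phase \<Pi>) t (init_wave n \<Pi> \<phi>) r s c
    = \<phi> r * run (\<lambda>_. fst r) (commit_phase \<Pi>) t (init_wave n \<Pi> (\<lambda>_::unit. 1)) () s c" for t r s c
  proof -
    have "(\<lambda>_::unit. init_wave n \<Pi> \<phi> r) = (\<lambda>u s c. \<phi> r * init_wave n \<Pi> (\<lambda>_. 1) u s c)"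
      by (intro ext) (simp add: init_wave_def)
    then show ?thesis by (subst run_pointwise) (simp add: run_scale)
  qed
  have "rho_superposed n \<Pi> X = joint_opr (\<lambda>t. run fst (commit_phase \<Pi>) t (init_wave n \<Pi> \<phi>))"
    by (simp add: rho_superposed_def \<phi>_def)
  also have "\<dots> = dephased (\<lambda>(p, c). fst p) (superposed_matrix n \<Pi> X)"
  proof -
    have "superposed_matrix n \<Pi> X = (\<lambda>(p, c) (r, a). \<phi> r * commit_matrix n \<Pi> (fst r) p (a, c))"
      by (intro ext) (auto simp: superposed_matrix_def \<phi>_def split: prod.split)
    then show ?thesis
      by (intro ext) (auto simp: joint_opr_def dephased_def commit_matrix_def run split: prod.split)
  qed
  finally show ?thesis .
qed

text \<open>Alice keeps X and X', so the terms for different inputs are orthogonal on her side, and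
  Bob and the memory see the uniform mixture over \<open>X\<close>. This brings
  \<open>partition_close\<close> to bear on the superpositions.\<close>

lemma superposed_matrix_facts:
  assumes sc: "string_commitment n l \<Pi>" and X: "X \<subseteq> bits l" "X \<noteq> {}"
  shows "superposed_matrix n \<Pi> X \<in> mats (party_labels \<Pi> Bob \<times> mem_labels n) (primed_labels l \<Pi>)"
    and "mmul (primed_labels l \<Pi>) (superposed_matrix n \<Pi> X) (adj (superposed_matrix n \<Pi> X))
      = (\<lambda>i j. (\<Sum>x\<in>X. reduced (party_labels \<Pi> Alice) (commit_matrix n \<Pi> x) i j) / card X)"
    and "hsn (party_labels \<Pi> Bob \<times> mem_labels n) (primed_labels l \<Pi>) (superposed_matrix n \<Pi> X) = 1"
proof -
  let ?LA = "party_labels \<Pi> Alice" and ?LB = "party_labels \<Pi> Bob" and ?C = "mem_labels n"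
  have fX: "finite X" by (rule finite_subset[OF X(1) finite_bits])
  then have card: "card X > 0" using X(2) by (simp add: card_gt_0_iff)
  show "superposed_matrix n \<Pi> X \<in> mats (?LB \<times> ?C) (primed_labels l \<Pi>)"
  proof -
    have "p \<in> ?LB \<and> a \<in> ?LA \<and> c \<in> ?C" if "commit_matrix n \<Pi> x p (a, c) \<noteq> 0" "x \<in> X" for x p a c
    proof -
      have "x \<in> bits l" using that X by blast
      from commit_matrix_facts(2)[OF sc this] that(1) show ?thesis unfolding mats_def by blast
    qed
    then show ?thesis
      using X by (auto simp: mats_def superposed_matrix_def primed_labels_def)
  qed
  show MM: "mmul (primed_labels l \<Pi>) (superposed_matrix n \<Pi> X) (adj (superposed_matrix n \<Pi> X))
      = (\<lambda>i j. (\<Sum>x\<in>X. reduced ?LA (commit_matrix n \<Pi> x) i j) / card X)"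
  proof (intro ext, clarify)
    fix p c q d
    define z where "z = 1 / complex_of_real (sqrt (real (card X)))"
    have z: "z * cnj z = 1 / of_nat (card X)"
      using card by (simp add: z_def flip: of_real_mult)
    have "mmul (primed_labels l \<Pi>) (superposed_matrix n \<Pi> X) (adj (superposed_matrix n \<Pi> X)) (p, c) (q, d)
      = (\<Sum>x\<in>bits l. \<Sum>x'\<in>bits l. \<Sum>a\<in>?LA. superposed_matrix n \<Pi> X (p, c) ((x, x'), a) * cnj (superposed_matrix n \<Pi> X (q, d) ((x, x'), a)))"
      by (simp add: mmul_def adj_def primed_labels_def sum_Times)
    also have "\<dots> = (\<Sum>x\<in>bits l. \<Sum>x'\<in>bits l. if x' = x then
        of_bool (x \<in> X) * (z * cnj z * reduced ?LA (commit_matrix n \<Pi> x) (p, c) (q, d)) else 0)"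
      by (intro sum.cong refl)
         (auto simp: superposed_matrix_def reduced_def reshape_def mmul_def adj_def z_def sum_distrib_left sum_divide_distrib mult_ac)
    also have "\<dots> = (\<Sum>x\<in>bits l. of_bool (x \<in> X) * (z * cnj z * reduced ?LA (commit_matrix n \<Pi> x) (p, c) (q, d)))"
      by simp
    also have "\<dots> = (\<Sum>x\<in>X. z * cnj z * reduced ?LA (commit_matrix n \<Pi> x) (p, c) (q, d))"
      using X by (intro sum.mono_neutral_cong_right) auto
    finally show "mmul (primed_labels l \<Pi>) (superposed_matrix n \<Pi> X) (adj (superposed_matrix n \<Pi> X)) (p, c) (q, d)
      = (\<Sum>x\<in>X. reduced ?LA (commit_matrix n \<Pi> x) (p, c) (q, d)) / card X"
      unfolding z by (simp add: sum_divide_distrib)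
  qed
  have tr: "opr_trace (?LB \<times> ?C) (reduced ?LA (commit_matrix n \<Pi> x)) = 1" if "x \<in> X" for x
  proof -
    have "x \<in> bits l" using that X by blast
    then show ?thesis
      unfolding reduced_def hsn_sq_trace[symmetric] hsn_reshape by (simp add: commit_matrix_facts(3)[OF sc])
  qed
  have "complex_of_real ((hsn (?LB \<times> ?C) (primed_labels l \<Pi>) (superposed_matrix n \<Pi> X))\<^sup>2)
    = (\<Sum>x\<in>X. opr_trace (?LB \<times> ?C) (reduced ?LA (commit_matrix n \<Pi> x))) / card X"
    unfolding hsn_sq_trace MM opr_trace_def by (subst sum.swap) (simp add: sum_divide_distrib)
  also have "\<dots> = complex_of_real 1" using tr card by simp
  finally have "(hsn (?LB \<times> ?C) (primed_labels l \<Pi>) (superposed_matrix n \<Pi> X))\<^sup>2 = 1"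
    unfolding of_real_eq_iff .
  then show "hsn (?LB \<times> ?C) (primed_labels l \<Pi>) (superposed_matrix n \<Pi> X) = 1"
    using hsn_nonneg by (metis power2_eq_1_iff neg_0_le_iff_le not_one_le_zero)
qed

text \<open>The superpositions have norm 1, so \<open>uhlmann\<close> gives an overlap of at least 1
  - T / 2 and the attack comes within distance sqrt (2 (T / 2)) = sqrt T. Binding then forces 1 -
  \<Delta> \<le> sqrt T, and T is bounded by \<open>partition_close\<close>.\<close>

lemma hiding_binding_bound:
  assumes l: "l \<ge> 1" and \<Delta>: "\<Delta> \<le> 1" and sc: "string_commitment n l \<Pi>"
    and hiding: "weakly_hiding n l \<Pi> \<epsilon>" and binding: "weakly_binding n l \<Pi> \<Delta>"
  shows "(1 - \<Delta>)\<^sup>2 \<le> 4 * sqrt (2 * \<epsilon>) + 2 * 2 ^ n * sqrt (2 / 2 ^ l)"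
proof -
  let ?LA = "party_labels \<Pi> Alice" and ?LB = "party_labels \<Pi> Bob" and ?C = "mem_labels n"
  let ?K = "primed_labels l \<Pi>"
  have "replicate l False \<in> bits l" by (simp add: bits_def)
  note fin = commit_matrix_facts(1)[OF sc this]
  have finI: "finite (?LB \<times> ?C)" and finK: "finite ?K"
    using fin by (simp_all add: primed_labels_def)
  obtain \<sigma> where \<sigma>: "density ?LB \<sigma>"
    and dist: "trace_dist (bits l \<times> ?LB) (rho_XB n l \<Pi>) (\<lambda>(x, b) (y, b'). of_bool (x = y) * \<sigma> b b' / 2 ^ l) \<le> \<epsilon>"
    using hiding unfolding weakly_hiding_def by blast
  let ?blk = "blk (bits l) (\<lambda>x i j. (mmul (?LA \<times> ?C) (commit_matrix n \<Pi> x) (adj (commit_matrix n \<Pi> x)) i j - \<sigma> i j) / card (bits l))"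
  have "trace_norm (bits l \<times> ?LB) (\<lambda>i j. rho_XB n l \<Pi> i j - (\<lambda>(x, b) (y, b'). of_bool (x = y) * \<sigma> b b' / 2 ^ l) i j)
    = trace_norm (bits l \<times> ?LB) ?blk"
  proof (rule trace_norm_cong, clarify)
    fix x p y q assume "x \<in> bits l"
    then show "rho_XB n l \<Pi> (x, p) (y, q) - of_bool (x = y) * \<sigma> p q / 2 ^ l = ?blk (x, p) (y, q)"
      by (simp add: rho_XB_commit_matrix blk_def card_bits diff_divide_distrib)
  qed
  then have le: "trace_norm (bits l \<times> ?LB) ?blk \<le> 2 * \<epsilon>"
    using dist by (simp add: trace_dist_def)
  obtain X0 X1 where X: "X0 \<subseteq> bits l" "X1 \<subseteq> bits l" "X0 \<noteq> {}" "X1 \<noteq> {}" "X0 \<inter> X1 = {}"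
    and close: "trace_norm (?LB \<times> ?C) (\<lambda>i j. (\<Sum>x\<in>X0. reduced ?LA (commit_matrix n \<Pi> x) i j) / card X0
        - (\<Sum>x\<in>X1. reduced ?LA (commit_matrix n \<Pi> x) i j) / card X1)
      \<le> 4 * sqrt (2 * \<epsilon>) + 2 * card ?C * sqrt (2 / 2 ^ l)"
    by (rule partition_close[OF fin fin finite_mem_labels l commit_matrix_facts(2,3)[OF sc] \<sigma> le]) (assumption, assumption, rule that)
  define M0 where "M0 = superposed_matrix n \<Pi> X0"
  define M1 where "M1 = superposed_matrix n \<Pi> X1"
  note M0 = superposed_matrix_facts[OF sc X(1,3), folded M0_def]
  note M1 = superposed_matrix_facts[OF sc X(2,4), folded M1_def]
  define T where "T = trace_norm (?LB \<times> ?C) (\<lambda>i j. mmul ?K M0 (adj M0) i j - mmul ?K M1 (adj M1) i j)"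
  have T: "T \<le> 4 * sqrt (2 * \<epsilon>) + 2 * 2 ^ n * sqrt (2 / 2 ^ l)"
    using close by (simp add: T_def M0(2) M1(2) card_mem_labels)
  obtain V where V: "unitary ?K V" and
    F: "((hsn (?LB \<times> ?C) ?K M0)\<^sup>2 + (hsn (?LB \<times> ?C) ?K M1)\<^sup>2 - T) / 2
      \<le> Re (opr_trace (?LB \<times> ?C) (mmul ?K (mmul ?K M0 V) (adj M1)))"
    unfolding T_def by (rule uhlmann[OF finI finK M0(1) M1(1)]) (rule that[unfolded T_def])
  let ?E = "\<lambda>\<rho>. mmul ?K (\<lambda>i j. V j i) (mmul ?K \<rho> (adj (\<lambda>i j. V j i)))"
  have "1 - \<Delta> \<le> trace_dist (?K \<times> ?LB \<times> ?C) (tensor_id ?E (rho_superposed n \<Pi> X0)) (rho_superposed n \<Pi> X1)"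
    using binding X cptp_unitary[OF finK unitary_transpose[OF V]] unfolding weakly_binding_def by blast
  also have "\<dots> \<le> sqrt (2 * (1 - Re (opr_trace (?LB \<times> ?C) (mmul ?K (mmul ?K M0 V) (adj M1)))))"
    unfolding rho_superposed_dephased M0_def[symmetric] M1_def[symmetric]
    by (rule unitary_attack_le[OF finI finK M0(1) M1(1) _ _ V]) (simp_all add: M0(3) M1(3))
  also have "\<dots> \<le> sqrt T"
    using F by (intro real_sqrt_le_mono) (simp add: M0(3) M1(3) field_simps)
  finally have "1 - \<Delta> \<le> sqrt T" .
  moreover have "T \<ge> 0"
    using calculation \<Delta> by (metis diff_ge_0_iff_ge order_trans real_sqrt_ge_0_iff)
  ultimately have "(1 - \<Delta>)\<^sup>2 \<le> T"
    using \<Delta> power_mono[of "1 - \<Delta>" "sqrt T" 2] by simp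
  then show ?thesis using T by linarith
qed

theorem theorem15:
  fixes n l :: nat and \<epsilon> \<Delta> :: real and \<Pi> :: commitment
  assumes "l \<ge> 1"
    and "\<epsilon> \<ge> 0" and "0 \<le> \<Delta>" and "\<Delta> \<le> 1"
    and "(1 - \<Delta>)\<^sup>2 / 4 > sqrt (2 * \<epsilon>)"
    and "string_commitment n l \<Pi>"
    and "weakly_hiding n l \<Pi> \<epsilon>"
    and "weakly_binding n l \<Pi> \<Delta>"
  shows "real l \<le> 2 * real n - 2 * log 2 ((1 - \<Delta>)\<^sup>2 / 4 - sqrt (2 * \<epsilon>)) - 1 \<and>
    (\<Delta> = \<epsilon> \<and> \<epsilon> \<le> 0.01 \<longrightarrow> l \<le> 2 * n + 6)"
proof -
  define q where "q = (1 - \<Delta>)\<^sup>2 / 4 - sqrt (2 * \<epsilon>)"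
  have q: "q > 0" using assms(5) by (simp add: q_def)
  have "q \<le> 2 ^ n * sqrt (2 / 2 ^ l) / 2"
    using hiding_binding_bound[OF assms(1,4,6-8)] by (simp add: q_def)
  then have "q\<^sup>2 \<le> (2 ^ n * sqrt (2 / 2 ^ l) / 2)\<^sup>2"
    using q by (intro power_mono) auto
  \<comment> \<open>Squaring gives 2^(2n) (2 / 2^l) / 4; the extra 2 in the denominator is the
    source of the summand -1.\<close>
  also have "\<dots> = 2 ^ (2 * n) / 2 ^ (l + 1)"
    by (simp add: power_mult_distrib power_divide power_mult mult.commute[of 2 n])
  finally have "log 2 (q\<^sup>2) \<le> log 2 (2 ^ (2 * n) / 2 ^ (l + 1))"
    using q by (subst log_le_cancel_iff) auto
  also have "\<dots> = real (2 * n) - real (l + 1)"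
    by (simp only: log_divide_pos zero_less_power zero_less_numeral log_pow_cancel)
  finally have bound: "real l \<le> 2 * real n - 2 * log 2 q - 1"
    using q by (simp add: log_nat_power)
  have "l \<le> 2 * n + 6" if "\<Delta> = \<epsilon>" "\<epsilon> \<le> 0.01"
  proof -
    \<comment> \<open>Numerically 0.99^2 / 4 - 0.15 exceeds 1 / 16, where 0.15 bounds sqrt 0.02 from
      above. The power of two 1 / 16 has logarithm -4 and yields the summand 8 - 1 = 7.\<close>
    have "(0.99::real)\<^sup>2 \<le> (1 - \<Delta>)\<^sup>2"
      using that by (intro power_mono) auto
    moreover have "sqrt (2 * \<epsilon>) \<le> 0.15"
      using that by (intro real_le_lsqrt) (auto simp: power2_eq_square)
    ultimately have "1 / 16 < q" by (simp add: q_def power2_eq_square)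
    then have "log 2 (1 / 16) < log 2 q" by (subst log_less_cancel_iff) auto
    moreover have "log 2 (1 / 16) = - (4 :: real)"
    proof -
      have "log 2 (1 / 16) = - log 2 (2 ^ 4 :: real)" by (simp add: log_divide)
      then show ?thesis by (simp only: log_pow_cancel)
    qed
    \<comment> \<open>Strictness of the bound on \<open>q\<close> turns 7 into 6 for
      integers.\<close>
    ultimately have "real l < real (2 * n + 7)" using bound by simp
    then show ?thesis by simp
  qed
  then show ?thesis using bound by (simp add: q_def)
qed

end
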